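(* Let $k\ge 0$ be an integer, let $K=\mathbb{Q}(t_1,\ldots,t_k)$, and let $a,b,c\in K$ be such that the equation $aX^2+bY^2+cZ^2=0$ is in reduced form. Then this equation has a solution $(X:Y:Z)\in P^2(K)$ (that is, there are $X,Y,Z\in K$, not all zero, with $aX^2+bY^2+cZ^2=0$) if and only if a solubility certificate for this equation exists.
   Context: Let $k\ge 0$ be an integer, $t_1,\ldots,t_k$ variables, and $K=\mathbb{Q}(t_1,\ldots,t_k)$ (so $K=\mathbb{Q}$ if $k=0$). Rings. $R_k:=\mathbb{Z}$ if $k=0$ and $R_k:=\mathbb{Q}[t_1,\ldots,t_k]$ if $k>0$. $\tilde R_k:=\mathbb{Z}$ if $k=0$ and $\tilde R_k:=\mathbb{Q}(t_1,\ldots,t_{k-1})[t_k]$ if $k>0$. Reduced form. The equation $aX^2+bY^2+cZ^2=0$ over $K$ is in reduced form if: (i) $abc\ne 0$, and if $k=0$ then $a,b,c$ do not all have the same sign; (ii) $a,b,c\in R_k$; (iii) $\gcd(a,b)=\gcd(b,c)=\gcd(c,a)=1$ in $R_k$; (iv) $abc$ is not divisible in $R_k$ by a non-trivial square, where a non-trivial square is $d^2$ with $d\in R_k$ non-zero and not a unit of $R_k$. A reduced form of a given equation $aX^2+bY^2+cZ^2=0$ (with $a,b,c\in K$ satisfying (i)) is an equation in reduced form obtained from it by the following procedure: multiply $(a,b,c)$ by a common denominator so that $a,b,c\in R_k$; with $g=\gcd(a,b)$ replace $(a,b,c)$ by $(a/g,b/g,cg)$, and do the same for the pairs $(b,c)$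 and $(c,a)$, until the coefficients are pairwise coprime; divide each of $a,b,c$ by the non-trivial squares dividing it. The resulting equation is equivalent to the original one via a rescaling of the coordinates $X,Y,Z$. An equation over $\mathbb{Q}$ (case $k=0$) whose three non-zero coefficients all have the same sign has no reduced form, and hence no reduced form with a solubility certificate. Degrees and case. If $k>0$, degree and leading coefficient always mean with respect to $t_k$; let $d_a,d_b,d_c$ be the degrees and $l_a,l_b,l_c\in\mathbb{Q}[t_1,\ldots,t_{k-1}]$ the leading coefficients of $a,b,c$. Put $\mathrm{case}:=0$ if $k>0$ and $d_a\equiv d_b\equiv d_c \pmod 2$, and $\mathrm{case}:=1$ otherwise. Factors. For non-zero $a\in R_k$, $\mathrm{Factors}(a)$ is the set of all irreducible $p\in\tilde R_k$ dividing $a$ in $\tilde R_k$, with $p$ positive (a prime number) if $k=0$ and $p$ monic in $t_k$ if $k>0$. For such $p$ put $\mathbf{F}_p:=\tilde R_k/(p)$. For a polynomial $f\in\tilde R_k[T]$, $f \bmod p$ denotes its image in $\mathbf{F}_p[T]$. Put $f_a:=bT^2+c$, $f_b:=cT^2+a$, $f_c:=aT^2+b$ in $R_k[T]$. Solubility certificate (defined recursively on $k$). For an equation $aX^2+bY^2+cZ^2=0$ over $K=\mathbb{Q}(t_1,\ldots,t_k)$ in reduced form, a solubility certificate is a list containing: for every $p\in\mathrm{Factors}(a)$ a root in $\mathbf{F}_p$ of $f_a\bmod p$; for every $p\in\mathrm{Factors}(b)$ a root in $\mathbf{F}_p$ of $f_b\bmod p$; for every $p\in\mathrm{Factors}(c)$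 a root in $\mathbf{F}_p$ of $f_c\bmod p$; and, if $\mathrm{case}=0$, a reduced form of the equation $l_ax^2+l_by^2+l_cz^2=0$ over $\mathbb{Q}(t_1,\ldots,t_{k-1})$ together with a solubility certificate for that reduced form. *)

theory Defs
  imports
    "HOL-Algebra.Algebra"
    "HOL-Library.Poly_Mapping"
    "HOL-Computational_Algebra.Fraction_Field"
    "HOL-Computational_Algebra.Polynomial"
begin

section \<open>Rational function fields over the rationals\<close>

text \<open>
  As \<open>k\<close> varies, all the fields \<open>\<rat>(t\<^sub>1,\<dots>,t\<^sub>k)\<close> and the rings inside them are realised as subsets of one
  field: the field of fractions of the ring of rational polynomials in countably many variables.
  A polynomial is a finitely supported map from monomials to coefficients; a monomial is a
  finitely supported map from variable indices to exponents.
\<close>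

type_synonym mpoly = "(nat \<Rightarrow>\<^sub>0 nat) \<Rightarrow>\<^sub>0 rat"
type_synonym ratfun = "mpoly fract"

text \<open>A triple \<open>(a, b, c)\<close> stands for the equation \<open>a X\<^sup>2 + b Y\<^sup>2 + c Z\<^sup>2 = 0\<close>.\<close>

type_synonym conic = "ratfun \<times> ratfun \<times> ratfun"

definition of_mpoly :: "mpoly \<Rightarrow> ratfun" where
  "of_mpoly p = Fraction_Field.Fract p 1"

definition const :: "rat \<Rightarrow> ratfun" where
  "const q = of_mpoly (Poly_Mapping.single 0 q)"

definition tvar :: "nat \<Rightarrow> ratfun" where
  "tvar i = of_mpoly (Poly_Mapping.single (Poly_Mapping.single i 1) 1)"

text \<open>The polynomial ring \<open>\<rat>[t\<^sub>1,\<dots>,t\<^sub>k]\<close> and its field of fractions \<open>K = \<rat>(t\<^sub>1,\<dots>,t\<^sub>k)\<close>.\<close>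

definition mpolys :: "nat \<Rightarrow> mpoly set" where
  "mpolys k = {p. \<forall>m \<in> Poly_Mapping.keys p. Poly_Mapping.keys m \<subseteq> {1..k}}"

definition K :: "nat \<Rightarrow> ratfun set" where
  "K k = {Fraction_Field.Fract p q | p q. p \<in> mpolys k \<and> q \<in> mpolys k \<and> q \<noteq> 0}"

definition ring_of :: "ratfun set \<Rightarrow> ratfun ring" where
  "ring_of S = \<lparr>carrier = S, monoid.mult = (*), one = 1, ring.zero = 0, add = (+)\<rparr>"

definition R :: "nat \<Rightarrow> ratfun ring" where
  "R k = ring_of (if k = 0 then const ` \<int> else of_mpoly ` mpolys k)"

text \<open>\<open>\<rat>(t\<^sub>1,\<dots>,t\<^sub>k\<^sub>-\<^sub>1)[T]\<close>; evaluation at \<open>T = t\<^sub>k\<close> is injective on it.\<close>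

definition polys_over :: "nat \<Rightarrow> ratfun poly set" where
  "polys_over k = {f. \<forall>i. Polynomial.coeff f i \<in> K (k - 1)}"

definition R_tilde :: "nat \<Rightarrow> ratfun ring" where
  "R_tilde k = ring_of (if k = 0 then const ` \<int> else (\<lambda>f. poly f (tvar k)) ` polys_over k)"

text \<open>
  The expansion of \<open>a\<close> in powers of \<open>t\<^sub>k\<close>, for \<open>k > 0\<close> and \<open>a\<close> in \<open>\<rat>(t\<^sub>1,\<dots>,t\<^sub>k\<^sub>-\<^sub>1)[t\<^sub>k]\<close>
  (otherwise it is unspecified).
\<close>

definition expansion :: "nat \<Rightarrow> ratfun \<Rightarrow> ratfun poly" where
  "expansion k a = (THE f. f \<in> polys_over k \<and> poly f (tvar k) = a)"

definition deg :: "nat \<Rightarrow> ratfun \<Rightarrow> nat" where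
  "deg k a = Polynomial.degree (expansion k a)"

definition lc :: "nat \<Rightarrow> ratfun \<Rightarrow> ratfun" where
  "lc k a = Polynomial.lead_coeff (expansion k a)"


section \<open>Reduced forms\<close>

definition same_sign :: "conic \<Rightarrow> bool" where
  "same_sign = (\<lambda>(a, b, c).
     {a, b, c} \<subseteq> const ` {0<..} \<or> {a, b, c} \<subseteq> const ` {..<0})"

definition admissible :: "nat \<Rightarrow> conic \<Rightarrow> bool" where
  "admissible k = (\<lambda>(a, b, c). a * b * c \<noteq> 0 \<and> (k = 0 \<longrightarrow> \<not> same_sign (a, b, c)))"

definition pairwise_coprime :: "nat \<Rightarrow> conic \<Rightarrow> bool" where
  "pairwise_coprime k = (\<lambda>(a, b, c).
     1 gcdof\<^bsub>R k\<^esub> a b \<and> 1 gcdof\<^bsub>R k\<^esub> b c \<and> 1 gcdof\<^bsub>R k\<^esub> c a)"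

definition nontrivial_square :: "nat \<Rightarrow> ratfun \<Rightarrow> bool" where
  "nontrivial_square k s \<longleftrightarrow> (\<exists>d \<in> carrier (R k). d \<noteq> 0 \<and> d \<notin> Units (R k) \<and> s = d\<^sup>2)"

definition in_reduced_form :: "nat \<Rightarrow> conic \<Rightarrow> bool" where
  "in_reduced_form k = (\<lambda>(a, b, c).
     admissible k (a, b, c) \<and>
     {a, b, c} \<subseteq> carrier (R k) \<and>
     pairwise_coprime k (a, b, c) \<and>
     \<not> (\<exists>s. nontrivial_square k s \<and> s divides\<^bsub>R k\<^esub> (a * b * c)))"

text \<open>
  One step of each loop of the reduction procedure.  Greatest common divisors are only determined
  up to units, so \<open>g\<close> may be any of them.  The quotients are exact, so they may be taken in the field.
\<close>

inductive gcd_step :: "nat \<Rightarrow> conic \<Rightarrow> conic \<Rightarrow> bool" for k where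
  "g \<in> carrier (R k) \<Longrightarrow> g gcdof\<^bsub>R k\<^esub> a b \<Longrightarrow> gcd_step k (a, b, c) (a / g, b / g, c * g)"
| "g \<in> carrier (R k) \<Longrightarrow> g gcdof\<^bsub>R k\<^esub> b c \<Longrightarrow> gcd_step k (a, b, c) (a * g, b / g, c / g)"
| "g \<in> carrier (R k) \<Longrightarrow> g gcdof\<^bsub>R k\<^esub> c a \<Longrightarrow> gcd_step k (a, b, c) (a / g, b * g, c / g)"

inductive square_step :: "nat \<Rightarrow> conic \<Rightarrow> conic \<Rightarrow> bool" for k where
  "nontrivial_square k s \<Longrightarrow> s divides\<^bsub>R k\<^esub> a \<Longrightarrow> square_step k (a, b, c) (a / s, b, c)"
| "nontrivial_square k s \<Longrightarrow> s divides\<^bsub>R k\<^esub> b \<Longrightarrow> square_step k (a, b, c) (a, b / s, c)"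
| "nontrivial_square k s \<Longrightarrow> s divides\<^bsub>R k\<^esub> c \<Longrightarrow> square_step k (a, b, c) (a, b, c / s)"

definition reduced_form_of :: "nat \<Rightarrow> conic \<Rightarrow> conic \<Rightarrow> bool" where
  "reduced_form_of k = (\<lambda>(a, b, c) e''.
     {a, b, c} \<subseteq> K k \<and> admissible k (a, b, c) \<and>
     (\<exists>m e'. m \<in> carrier (R k) \<and> m \<noteq> 0 \<and> {m * a, m * b, m * c} \<subseteq> carrier (R k) \<and>
        (gcd_step k)\<^sup>*\<^sup>* (m * a, m * b, m * c) e' \<and> pairwise_coprime k e' \<and>
        (square_step k)\<^sup>*\<^sup>* e' e'' \<and> in_reduced_form k e''))"


section \<open>Solubility certificates\<close>

definition leading_conic :: "nat \<Rightarrow> conic \<Rightarrow> conic" where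
  "leading_conic k = (\<lambda>(a, b, c). (lc k a, lc k b, lc k c))"

definition conic_case :: "nat \<Rightarrow> conic \<Rightarrow> nat" where
  "conic_case k = (\<lambda>(a, b, c).
     if k > 0 \<and> deg k a mod 2 = deg k b mod 2 \<and> deg k b mod 2 = deg k c mod 2 then 0 else 1)"

definition Factors :: "nat \<Rightarrow> ratfun \<Rightarrow> ratfun set" where
  "Factors k a = {p \<in> carrier (R_tilde k).
     ring_irreducible\<^bsub>R_tilde k\<^esub> p \<and> p divides\<^bsub>R_tilde k\<^esub> a \<and>
     (if k = 0 then p \<in> const ` {0<..} else lc k p = 1)}"

definition residue_field :: "nat \<Rightarrow> ratfun \<Rightarrow> ratfun set ring" where
  "residue_field k p = R_tilde k Quot (PIdl\<^bsub>R_tilde k\<^esub> p)"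

text \<open>As in \<^theory>\<open>HOL-Algebra.Polynomials\<close>, a list of coefficients with the leading one first is a polynomial.\<close>

definition poly_mod :: "nat \<Rightarrow> ratfun \<Rightarrow> ratfun list \<Rightarrow> ratfun set list" where
  "poly_mod k p f = map (\<lambda>r. (PIdl\<^bsub>R_tilde k\<^esub> p) +>\<^bsub>R_tilde k\<^esub> r) f"

text \<open>A list that gives, for every \<open>p\<close> in \<open>Factors(a)\<close>, a root of \<open>b T\<^sup>2 + c\<close> modulo \<open>p\<close>.\<close>

definition root_list ::
    "nat \<Rightarrow> ratfun \<Rightarrow> ratfun \<Rightarrow> ratfun \<Rightarrow> (ratfun \<times> ratfun set) list \<Rightarrow> bool" where
  "root_list k a b c rs \<longleftrightarrow>
     fst ` set rs = Factors k a \<and>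
     (\<forall>(p, x) \<in> set rs. ring.is_root (residue_field k p) (poly_mod k p [b, 0, c]) x)"

text \<open>
  The three root lists for \<open>a\<close>, \<open>b\<close>, \<open>c\<close>, and in case 0 a reduced form of the equation of leading
  coefficients with a certificate for it.
\<close>

datatype certificate =
  Certificate
    "(ratfun \<times> ratfun set) list"
    "(ratfun \<times> ratfun set) list"
    "(ratfun \<times> ratfun set) list"
    "(conic \<times> certificate) option"

inductive solubility_certificate :: "nat \<Rightarrow> conic \<Rightarrow> certificate \<Rightarrow> bool" where
  case_1:
    "in_reduced_form k (a, b, c) \<Longrightarrow>
     root_list k a b c ra \<Longrightarrow> root_list k b c a rb \<Longrightarrow> root_list k c a b rc \<Longrightarrow>
     conic_case k (a, b, c) = 1 \<Longrightarrow>
     solubility_certificate k (a, b, c) (Certificate ra rb rc None)"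
| case_0:
    "in_reduced_form k (a, b, c) \<Longrightarrow>
     root_list k a b c ra \<Longrightarrow> root_list k b c a rb \<Longrightarrow> root_list k c a b rc \<Longrightarrow>
     conic_case k (a, b, c) = 0 \<Longrightarrow>
     reduced_form_of (k - 1) (leading_conic k (a, b, c)) e \<Longrightarrow>
     solubility_certificate (k - 1) e C \<Longrightarrow>
     solubility_certificate k (a, b, c) (Certificate ra rb rc (Some (e, C)))"

end

theory Submission
  imports Defs
begin

text \<open>
  Put \<open>A = \<int>\<close> if \<open>k = 0\<close> and \<open>A = \<rat>(t\<^sub>1,\<dots>,t\<^sub>k\<^sub>-\<^sub>1)[t\<^sub>k]\<close> otherwise.  This is a Euclidean ring with field of
  fractions \<open>K\<close>, and the certificate speaks of its primes.  The theorem is proved by induction on \<open>k\<close>.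

  A solution yields a certificate.  Let \<open>p\<close> be a prime of \<open>A\<close> that divides \<open>a\<close>.  After denominators are
  cleared and powers of \<open>p\<close> cancelled, \<open>p\<close> does not divide \<open>z\<close>, and \<open>y / z\<close> is a root of \<open>b T\<^sup>2 + c\<close> modulo
  \<open>p\<close> (\<open>solution_imp_root_modulo_prime\<close>).  If the degrees of \<open>a\<close>, \<open>b\<close>, \<open>c\<close> have the same parity, the
  coefficients of highest degree of a solution solve the equation of leading coefficients
  (\<open>leading_form_soluble\<close>).  That equation has a reduced form (\<open>reduced_form_exists\<close>), and the steps of
  the reduction only rescale the coordinates, so the reduced form is soluble and has a certificate
  by induction.

  A certificate yields a solution.  The Chinese remainder theorem combines the roots into \<open>r\<close>, \<open>s\<close>, \<open>t\<close>
  with \<open>a\<close> dividing \<open>b r\<^sup>2 + c\<close>, \<open>b\<close> dividing \<open>c s\<^sup>2 + a\<close> and \<open>c\<close> dividing \<open>a t\<^sup>2 + b\<close>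
  (\<open>root_modulo_squarefree\<close>).  If \<open>y \<equiv> r z\<close> modulo \<open>a\<close>, \<open>z \<equiv> s x\<close> modulo \<open>b\<close> and \<open>x \<equiv> t y\<close> modulo \<open>c\<close>, then
  \<open>a b c\<close> divides \<open>a x\<^sup>2 + b y\<^sup>2 + c z\<^sup>2\<close> (\<open>squarefree_conic_value_dvd\<close>), so a solution of these congruences
  that is too small for a non-zero multiple of \<open>a b c\<close> solves the equation.

  For \<open>k > 0\<close> small means of low degree.  The congruences are \<open>deg (a b c)\<close> linear conditions on the
  coefficients of \<open>x\<close>, \<open>y\<close>, \<open>z\<close>.  If the degrees of \<open>a\<close>, \<open>b\<close>, \<open>c\<close> do not have the same parity, there is one
  coefficient more than that (\<open>conic_solution_mixed_parity\<close>).  Otherwise one is missing, and it is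
  supplied by a solution of the equation of leading coefficients, which exists by induction
  (\<open>conic_solution_equal_parity\<close>).  For \<open>k = 0\<close> the pigeonhole principle gives a short solution of the
  congruences, and a classical identity deals with the one non-zero value that is left
  (\<open>legendre_of_roots\<close>).

  For \<open>k > 0\<close>, being reduced is a condition in \<open>\<rat>[t\<^sub>1,\<dots>,t\<^sub>k]\<close>, while the arguments above need \<open>a b c\<close> to be squarefree in
  \<open>A\<close>.  Gauss's lemma makes \<open>\<rat>[t\<^sub>1,\<dots>,t\<^sub>k]\<close> a unique factorization domain, which also provides the
  greatest common divisors for the reduction, and carries squares back from \<open>A\<close>
  (\<open>prime_square_imp_nontrivial_square\<close>).
\<close>


section \<open>Divisibility in a subring\<close>

hide_const (open) Polynomials.degree Polynomials.lead_coeff UnivPoly.up_ring.coeff UnivPoly.up_ring.monom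
no_notation Polynomials.var (\<open>X\<index>\<close>)

text \<open>
  For all \<open>k\<close> the rings lie in one field, in which divisibility is trivial.  Therefore divisibility, units
  and primes are relative to a set of elements.
\<close>

definition dvd_in :: "'a::idom set \<Rightarrow> 'a \<Rightarrow> 'a \<Rightarrow> bool" where
  "dvd_in S x y \<longleftrightarrow> (\<exists>z\<in>S. y = x * z)"

definition unit_in :: "'a::idom set \<Rightarrow> 'a \<Rightarrow> bool" where
  "unit_in S x \<longleftrightarrow> dvd_in S x 1"

definition prime_in :: "'a::idom set \<Rightarrow> 'a \<Rightarrow> bool" where
  "prime_in S p \<longleftrightarrow> p \<in> S \<and> p \<noteq> 0 \<and> \<not> unit_in S p \<and>
     (\<forall>x\<in>S. \<forall>y\<in>S. dvd_in S p (x * y) \<longrightarrow> dvd_in S p x \<or> dvd_in S p y)"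

locale unital_subring =
  fixes S :: "'a::idom set"
  assumes zero_closed: "0 \<in> S"
    and one_closed: "1 \<in> S"
    and diff_closed: "x \<in> S \<Longrightarrow> y \<in> S \<Longrightarrow> x - y \<in> S"
    and mult_closed: "x \<in> S \<Longrightarrow> y \<in> S \<Longrightarrow> x * y \<in> S"
begin

lemma uminus_closed: "x \<in> S \<Longrightarrow> - x \<in> S"
  using diff_closed[of 0 x] zero_closed by simp

lemma add_closed: "x \<in> S \<Longrightarrow> y \<in> S \<Longrightarrow> x + y \<in> S"
  using diff_closed[of x "- y"] uminus_closed by simp

lemma power_closed: "x \<in> S \<Longrightarrow> x ^ n \<in> S"
  by (induction n) (auto intro: one_closed mult_closed)

lemma sum_closed: "(\<And>i. i \<in> I \<Longrightarrow> f i \<in> S) \<Longrightarrow> sum f I \<in> S"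
  by (induction I rule: infinite_finite_induct) (auto intro: zero_closed add_closed)

lemmas closed = zero_closed one_closed diff_closed mult_closed uminus_closed add_closed power_closed

lemma dvd_in_refl: "dvd_in S x x"
  unfolding dvd_in_def using one_closed by force

lemma dvd_in_0: "dvd_in S x 0"
  unfolding dvd_in_def using zero_closed by force

lemma dvd_in_trans: "dvd_in S x y \<Longrightarrow> dvd_in S y z \<Longrightarrow> dvd_in S x z"
  unfolding dvd_in_def using mult_closed by (metis mult.assoc)

lemma dvd_in_triv: "y \<in> S \<Longrightarrow> dvd_in S x (x * y)"
  unfolding dvd_in_def by blast

lemma dvd_in_mult: "dvd_in S x y \<Longrightarrow> z \<in> S \<Longrightarrow> dvd_in S x (y * z)"
  by (meson dvd_in_trans dvd_in_triv)

lemma dvd_in_mult2: "dvd_in S x y \<Longrightarrow> z \<in> S \<Longrightarrow> dvd_in S x (z * y)"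
  using dvd_in_mult by (simp add: mult.commute)

lemma dvd_in_add: "dvd_in S x y \<Longrightarrow> dvd_in S x z \<Longrightarrow> dvd_in S x (y + z)"
  unfolding dvd_in_def using add_closed by (metis distrib_left)

lemma dvd_in_diff: "dvd_in S x y \<Longrightarrow> dvd_in S x z \<Longrightarrow> dvd_in S x (y - z)"
  unfolding dvd_in_def using diff_closed by (metis right_diff_distrib)

lemma dvd_in_sum: "(\<And>i. i \<in> I \<Longrightarrow> dvd_in S x (f i)) \<Longrightarrow> dvd_in S x (sum f I)"
  by (induction I rule: infinite_finite_induct) (auto intro: dvd_in_0 dvd_in_add)

lemma dvd_in_mult_mono: "dvd_in S x y \<Longrightarrow> dvd_in S z w \<Longrightarrow> dvd_in S (x * z) (y * w)"
proof -
  assume "dvd_in S x y" "dvd_in S z w"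
  then obtain u v where "u \<in> S" "v \<in> S" "y = x * u" "w = z * v"
    unfolding dvd_in_def by blast
  then show ?thesis
    unfolding dvd_in_def by (intro bexI[of _ "u * v"]) (auto intro: mult_closed simp: algebra_simps)
qed

lemma dvd_in_cancel: "c \<noteq> 0 \<Longrightarrow> dvd_in S (c * x) (c * y) \<longleftrightarrow> dvd_in S x y"
  unfolding dvd_in_def by (simp add: mult.assoc)

lemma unit_in_dvd: "unit_in S u \<Longrightarrow> x \<in> S \<Longrightarrow> dvd_in S u x"
  unfolding unit_in_def using dvd_in_mult[of u 1 x] by simp

lemma dvd_in_unit: "dvd_in S x u \<Longrightarrow> unit_in S u \<Longrightarrow> unit_in S x"
  unfolding unit_in_def by (rule dvd_in_trans)

lemma unit_in_mult_cancel:
  assumes "unit_in S u" "u \<in> S"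
  shows "dvd_in S x (u * y) \<longleftrightarrow> dvd_in S x y"
proof
  obtain v where v: "v \<in> S" "u * v = 1"
    using assms unfolding unit_in_def dvd_in_def by metis
  assume "dvd_in S x (u * y)"
  then have "dvd_in S x (v * (u * y))" using v(1) by (rule dvd_in_mult2)
  moreover have "v * (u * y) = (u * v) * y" by (simp only: ac_simps)
  ultimately show "dvd_in S x y" using v by simp
qed (use assms in \<open>auto intro: dvd_in_mult2\<close>)

lemma prime_in_mult_iff:
  "prime_in S p \<Longrightarrow> x \<in> S \<Longrightarrow> y \<in> S \<Longrightarrow>
   dvd_in S p (x * y) \<longleftrightarrow> dvd_in S p x \<or> dvd_in S p y"
  by (metis prime_in_def dvd_in_mult dvd_in_mult2)

lemma prime_in_square_iff:
  "prime_in S p \<Longrightarrow> x \<in> S \<Longrightarrow> dvd_in S p (x\<^sup>2) \<longleftrightarrow> dvd_in S p x"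
  using prime_in_mult_iff[of p x x] by (simp add: power2_eq_square)

text \<open>
  The prime can be cancelled twice, each time from \<open>y\<close>, because it does not divide \<open>x\<close>.
\<close>

lemma prime_in_square_dvd_coprime_mult:
  assumes p: "prime_in S p" and x: "x \<in> S" and y: "y \<in> S"
    and dvd: "dvd_in S (p\<^sup>2) (x * y)" and ndvd: "\<not> dvd_in S p x"
  shows "dvd_in S (p\<^sup>2) y"
proof -
  have pS: "p \<in> S" "p \<noteq> 0" using p by (auto simp: prime_in_def)
  obtain z where z: "z \<in> S" "x * y = p\<^sup>2 * z" using dvd unfolding dvd_in_def by blast
  have "dvd_in S p (x * y)"
    unfolding z power2_eq_square mult.assoc using z pS by (intro dvd_in_triv closed)
  then have "dvd_in S p y" using prime_in_mult_iff[OF p x y] ndvd by blast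
  then obtain y' where y': "y' \<in> S" "y = p * y'" unfolding dvd_in_def by blast
  have "p * (x * y') = p * (p * z)" using z y' by (simp add: power2_eq_square algebra_simps)
  then have "x * y' = p * z" using pS by simp
  then have "dvd_in S p (x * y')" using z by (simp add: dvd_in_triv)
  then have "dvd_in S p y'" using prime_in_mult_iff[OF p x y'(1)] ndvd by blast
  then show ?thesis
    unfolding y' power2_eq_square using pS by (simp add: dvd_in_cancel)
qed

end

section \<open>Unique factorization and greatest common divisors\<close>

text \<open>
  A domain in which every non-unit has a prime divisor and proper divisors are smaller is a unique
  factorization domain.  The measure \<open>N\<close> takes the place of the number of prime factors: it makes the
  repeated cancellation of non-units terminate.
\<close>

locale ufd_in = unital_subring S for S :: "'a::idom set" +
  fixes N :: "'a \<Rightarrow> nat"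
  assumes N_mult_le: "x \<in> S \<Longrightarrow> y \<in> S \<Longrightarrow> x * y \<noteq> 0 \<Longrightarrow> N x \<le> N (x * y)"
    and N_mult_less: "x \<in> S \<Longrightarrow> y \<in> S \<Longrightarrow> x * y \<noteq> 0 \<Longrightarrow> \<not> unit_in S y \<Longrightarrow> N x < N (x * y)"
    and prime_divisor: "x \<in> S \<Longrightarrow> x \<noteq> 0 \<Longrightarrow> \<not> unit_in S x \<Longrightarrow> \<exists>p. prime_in S p \<and> dvd_in S p x"
begin

text \<open>
  Common prime divisors are split off one by one; once there is none left, every common divisor is a
  unit.
\<close>

lemma gcd_exists:
  assumes "x \<in> S" "x \<noteq> 0" "y \<in> S"
  shows "\<exists>g\<in>S. dvd_in S g x \<and> dvd_in S g y \<and>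
    (\<forall>d\<in>S. dvd_in S d x \<and> dvd_in S d y \<longrightarrow> dvd_in S d g)"
  using assms
proof (induction "N x" arbitrary: x y rule: less_induct)
  case less
  show ?case
  proof (cases "\<exists>p. prime_in S p \<and> dvd_in S p x \<and> dvd_in S p y")
    case True
    then obtain p x' y' where p: "prime_in S p" and x': "x' \<in> S" "x = p * x'"
      and y': "y' \<in> S" "y = p * y'" unfolding dvd_in_def by blast
    have pS: "p \<in> S" "p \<noteq> 0" "\<not> unit_in S p" using p by (auto simp: prime_in_def)
    have "N x' < N x" using N_mult_less[of x' p] less x' pS by (auto simp: mult.commute)
    from less(1)[OF this x'(1) _ y'(1)] less(3) x' obtain g where g: "g \<in> S" "dvd_in S g x'"
      "dvd_in S g y'" "\<And>d. d \<in> S \<Longrightarrow> dvd_in S d x' \<Longrightarrow> dvd_in S d y' \<Longrightarrow> dvd_in S d g"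
      by auto
    show ?thesis
    proof (intro bexI[of _ "p * g"] conjI ballI impI)
      show "dvd_in S (p * g) x" "dvd_in S (p * g) y" "p * g \<in> S"
        using g x' y' pS by (auto simp: dvd_in_cancel closed)
      fix d assume dS: "d \<in> S" and "dvd_in S d x \<and> dvd_in S d y"
      then have d: "dvd_in S d (p * x')" "dvd_in S d (p * y')" using x' y' by auto
      show "dvd_in S d (p * g)"
      proof (cases "dvd_in S p d")
        case True
        then obtain d' where d': "d' \<in> S" "d = p * d'" unfolding dvd_in_def by blast
        then show ?thesis using d g(4)[of d'] pS by (simp add: dvd_in_cancel)
      next
        case False
        have cancel: "dvd_in S d w" if w: "dvd_in S d (p * w)" "w \<in> S" for w
        proof -
          obtain e where e: "e \<in> S" "p * w = d * e" using w unfolding dvd_in_def by blast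
          then have "dvd_in S p (d * e)" using dvd_in_triv[of w p] w by simp
          then have "dvd_in S p e" using False prime_in_mult_iff[OF p dS e(1)] by blast
          then obtain e' where e': "e' \<in> S" "e = p * e'" unfolding dvd_in_def by blast
          have "p * w = p * (d * e')" using e e' by (simp add: mult.left_commute)
          then show ?thesis using e' pS by (simp add: dvd_in_triv)
        qed
        show ?thesis
          using g(4)[OF dS cancel[OF d(1) x'(1)] cancel[OF d(2) y'(1)]] pS by (intro dvd_in_mult2)
      qed
    qed
  next
    case False
    show ?thesis
    proof (intro bexI[of _ 1] conjI ballI impI)
      show "dvd_in S 1 x" "dvd_in S 1 y" "1 \<in> S"
        using less by (auto intro!: unit_in_dvd simp: unit_in_def dvd_in_refl closed)
      fix d assume dS: "d \<in> S" and d: "dvd_in S d x \<and> dvd_in S d y"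
      then have "d \<noteq> 0" using less unfolding dvd_in_def by auto
      then have "unit_in S d" using False prime_divisor[OF dS] d dvd_in_trans by blast
      then show "dvd_in S d 1" by (simp add: unit_in_def)
    qed
  qed
qed

end


section \<open>Euclidean subrings\<close>

locale euclidean_in = unital_subring S for S :: "'a::idom set" +
  fixes N :: "'a \<Rightarrow> nat"
  assumes division: "x \<in> S \<Longrightarrow> d \<in> S \<Longrightarrow> d \<noteq> 0 \<Longrightarrow>
      \<exists>q\<in>S. \<exists>r\<in>S. x = q * d + r \<and> (r = 0 \<or> N r < N d)"
    and size_mult_le: "x \<in> S \<Longrightarrow> y \<in> S \<Longrightarrow> x * y \<noteq> 0 \<Longrightarrow> N x \<le> N (x * y)"
begin

text \<open>
  Dividing \<open>x\<close> by \<open>x y\<close> leaves the remainder \<open>x (1 - y q)\<close>.  It is a multiple of \<open>x\<close>, hence not smaller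
  than \<open>x\<close>, but it is smaller than \<open>x y\<close>.
\<close>

lemma size_mult_less:
  assumes "x \<in> S" "y \<in> S" "x * y \<noteq> 0" "\<not> unit_in S y"
  shows "N x < N (x * y)"
proof -
  obtain q r where qr: "q \<in> S" "r \<in> S" "x = q * (x * y) + r" "r = 0 \<or> N r < N (x * y)"
    using division[OF assms(1) mult_closed[OF assms(1,2)] assms(3)] by blast
  have r: "r = x * (1 - y * q)"
    using qr(3) by (simp add: algebra_simps)
  have "1 - y * q \<noteq> 0" using assms(4) qr(1) unfolding unit_in_def dvd_in_def by force
  then have "r \<noteq> 0" using assms(3) r by simp
  then have "N x \<le> N r" unfolding r using assms qr by (intro size_mult_le) (auto intro: closed)
  then show ?thesis using qr(4) \<open>r \<noteq> 0\<close> by simp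
qed

lemma bezout:
  assumes "x \<in> S" "y \<in> S" "x \<noteq> 0"
  shows "\<exists>u\<in>S. \<exists>v\<in>S. dvd_in S (u * x + v * y) x \<and> dvd_in S (u * x + v * y) y"
proof -
  let ?P = "\<lambda>d. d \<noteq> 0 \<and> (\<exists>u\<in>S. \<exists>v\<in>S. d = u * x + v * y)"
  have "?P x" using assms zero_closed one_closed
    by (intro conjI bexI[of _ 1] bexI[of _ 0]) auto
  then obtain d where d: "?P d" and min: "\<And>e. N e < N d \<Longrightarrow> \<not> ?P e"
    using exists_least_iff[of "\<lambda>n. \<exists>d. ?P d \<and> N d = n"] by metis
  from d obtain u v where uv: "u \<in> S" "v \<in> S" "d = u * x + v * y" by blast
  have dS: "d \<in> S" using uv assms by (auto intro: closed)
  have main: "dvd_in S d (s * x + t * y)" if st: "s \<in> S" "t \<in> S" for s t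
  proof -
    have "s * x + t * y \<in> S" using st assms by (auto intro: closed)
    then obtain q r where qr: "q \<in> S" "r \<in> S" "s * x + t * y = q * d + r" "r = 0 \<or> N r < N d"
      using division dS d by blast
    have "r = (s - q * u) * x + (t - q * v) * y"
      using qr(3) uv(3) by (simp add: algebra_simps)
    moreover have "s - q * u \<in> S" "t - q * v \<in> S" using qr uv st by (auto intro: closed)
    ultimately have "r = 0" using min[of r] qr(4) by blast
    then show ?thesis using qr unfolding dvd_in_def by (auto simp: mult.commute)
  qed
  show ?thesis
    using main[of 1 0] main[of 0 1] uv one_closed zero_closed by auto
qed

lemma prime_in_bezout:
  assumes p: "p \<in> S" "p \<noteq> 0" and atom: "\<And>d. d \<in> S \<Longrightarrow> dvd_in S d p \<Longrightarrow> unit_in S d \<or> dvd_in S p d"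
    and y: "y \<in> S" "\<not> dvd_in S p y"
  shows "\<exists>u\<in>S. \<exists>v\<in>S. u * p + v * y = 1"
proof -
  obtain u v where uv: "u \<in> S" "v \<in> S" "dvd_in S (u * p + v * y) p" "dvd_in S (u * p + v * y) y"
    using bezout[OF p(1) y(1) p(2)] by blast
  have "u * p + v * y \<in> S" using uv p y by (auto intro: closed)
  with atom uv have "unit_in S (u * p + v * y)" using y(2) dvd_in_trans by blast
  then obtain w where w: "w \<in> S" "1 = (u * p + v * y) * w" unfolding unit_in_def dvd_in_def by blast
  show ?thesis
    by (intro bexI[of _ "w * u"] bexI[of _ "w * v"]) (use w uv in \<open>auto intro: closed simp: algebra_simps\<close>)
qed

lemma atom_prime_in:
  assumes p: "p \<in> S" "p \<noteq> 0" "\<not> unit_in S p"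
    and atom: "\<And>d. d \<in> S \<Longrightarrow> dvd_in S d p \<Longrightarrow> unit_in S d \<or> dvd_in S p d"
  shows "prime_in S p"
  unfolding prime_in_def
proof (intro conjI ballI impI p)
  fix x y assume xy: "x \<in> S" "y \<in> S" and dvd: "dvd_in S p (x * y)"
  show "dvd_in S p x \<or> dvd_in S p y"
  proof (cases "dvd_in S p y")
    case False
    then obtain u v where uv: "u \<in> S" "v \<in> S" "u * p + v * y = 1"
      using prime_in_bezout[OF p(1,2) atom xy(2)] by blast
    have "x = p * (u * x) + v * (x * y)"
      using arg_cong[OF uv(3), of "\<lambda>w. w * x"] by (simp add: algebra_simps)
    moreover have "dvd_in S p (p * (u * x) + v * (x * y))"
      using uv xy by (intro dvd_in_add dvd_in_triv dvd_in_mult2[OF dvd] closed)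
    ultimately have "dvd_in S p x" by metis
    then show ?thesis ..
  qed simp
qed

lemma prime_in_atom:
  assumes "prime_in S p" "d \<in> S" "dvd_in S d p"
  shows "unit_in S d \<or> dvd_in S p d"
proof -
  obtain e where e: "e \<in> S" "p = d * e" using assms unfolding dvd_in_def by blast
  have "dvd_in S p d \<or> dvd_in S p e"
    using assms e dvd_in_refl[of p] unfolding prime_in_def by auto
  moreover have "unit_in S d" if pe: "dvd_in S p e"
  proof -
    obtain f where f: "f \<in> S" "e = p * f" using pe unfolding dvd_in_def by blast
    then have "p * (d * f) = p * 1" using e by (simp add: algebra_simps)
    then have "d * f = 1" using assms(1) by (simp only: mult_cancel_left prime_in_def) blast
    then show ?thesis using \<open>f \<in> S\<close> unfolding unit_in_def dvd_in_def by force
  qed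
  ultimately show ?thesis by blast
qed

text \<open>A non-unit divisor of least size is irreducible, and Bezout's identity makes it prime.\<close>

sublocale ufd_in S N
proof
  fix x assume x: "x \<in> S" "x \<noteq> 0" "\<not> unit_in S x"
  let ?P = "\<lambda>d. d \<in> S \<and> \<not> unit_in S d \<and> dvd_in S d x"
  have "?P x" using x dvd_in_refl by simp
  then obtain p where p: "?P p" and min: "\<And>e. N e < N p \<Longrightarrow> \<not> ?P e"
    using exists_least_iff[of "\<lambda>n. \<exists>d. ?P d \<and> N d = n"] by metis
  have p0: "p \<noteq> 0" using p x(2) unfolding dvd_in_def by auto
  have "prime_in S p"
  proof (rule atom_prime_in)
    fix d assume d: "d \<in> S" "dvd_in S d p"
    then obtain e where e: "e \<in> S" "p = d * e" unfolding dvd_in_def by blast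
    show "unit_in S d \<or> dvd_in S p d"
    proof (cases "unit_in S e")
      case True
      then have "dvd_in S p d"
        using unit_in_mult_cancel[OF True e(1), of p d] e dvd_in_refl[of p] by (simp add: mult.commute)
      then show ?thesis ..
    next
      case False
      then have "N d < N p" using size_mult_less d e p0 by blast
      then show ?thesis using min[of d] d p dvd_in_trans by blast
    qed
  qed (use p p0 in auto)
  then show "\<exists>p. prime_in S p \<and> dvd_in S p x" using p by blast
qed (fact size_mult_le, fact size_mult_less)

end

context euclidean_in
begin

text \<open>
  Here \<open>P\<close> is meant to pick out one prime from each class of associates, such as the positive primes or
  the monic ones.
\<close>

lemma finite_normalized_primes:
  assumes inj: "\<And>p q. prime_in S p \<Longrightarrow> prime_in S q \<Longrightarrow> P p \<Longrightarrow> P q \<Longrightarrow> dvd_in S p q \<Longrightarrow> p = q"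
    and "a \<in> S" "a \<noteq> 0"
  shows "finite {p. prime_in S p \<and> P p \<and> dvd_in S p a}"
  using assms(2,3)
proof (induction "N a" arbitrary: a rule: less_induct)
  case less
  show ?case
  proof (cases "unit_in S a")
    case True
    then have "{p. prime_in S p \<and> P p \<and> dvd_in S p a} = {}"
      using dvd_in_unit unfolding prime_in_def by blast
    then show ?thesis by (simp only: finite.emptyI)
  next
    case False
    then obtain p a' where p: "prime_in S p" and a': "a' \<in> S" "a = p * a'"
      using prime_divisor less.prems unfolding dvd_in_def by blast
    have pS: "p \<in> S" "\<not> unit_in S p" using p by (auto simp: prime_in_def)
    have "N a' < N a"
      using N_mult_less[of a' p] less.prems a' pS by (simp add: mult.commute)
    then have "finite {q. prime_in S q \<and> P q \<and> dvd_in S q a'}"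
      using less a' by simp
    moreover have "finite {q. prime_in S q \<and> P q \<and> dvd_in S q p}"
    proof (rule finite_subset)
      show "{q. prime_in S q \<and> P q \<and> dvd_in S q p} \<subseteq>
            {SOME q. prime_in S q \<and> P q \<and> dvd_in S q p}" (is "?Q \<subseteq> {?q}")
      proof
        fix q assume q: "q \<in> ?Q"
        then have q': "?q \<in> ?Q" using someI[of "\<lambda>q. q \<in> ?Q" q] by simp
        then have "?q \<in> S" "\<not> unit_in S ?q" "dvd_in S ?q p" by (auto simp: prime_in_def)
        then have "dvd_in S p ?q" using prime_in_atom[OF p] by blast
        then have "dvd_in S q ?q" using q dvd_in_trans by blast
        then show "q \<in> {?q}" using inj q q' by blast
      qed
    qed simp
    moreover have "{q. prime_in S q \<and> P q \<and> dvd_in S q a} \<subseteq>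
        {q. prime_in S q \<and> P q \<and> dvd_in S q p} \<union> {q. prime_in S q \<and> P q \<and> dvd_in S q a'}"
      using prime_in_mult_iff pS a' by auto
    ultimately show ?thesis by (meson finite_UnI finite_subset)
  qed
qed

lemma coprime_mult_dvd:
  assumes "u \<in> S" "v \<in> S" "x \<in> S" "y \<in> S" "u * x + v * y = 1" "dvd_in S x w" "dvd_in S y w"
  shows "dvd_in S (x * y) w"
proof -
  have "w = u * (x * w) + v * (w * y)"
    using arg_cong[OF assms(5), of "\<lambda>t. t * w"] by (simp add: algebra_simps)
  moreover have "dvd_in S (x * y) (u * (x * w) + v * (w * y))"
    using assms by (intro dvd_in_add dvd_in_mult2 dvd_in_mult_mono dvd_in_refl)
  ultimately show ?thesis by metis
qed

lemma square_congruent: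
  assumes "b \<in> S" "c \<in> S" "r \<in> S" "s \<in> S" "dvd_in S m (r - s)" "dvd_in S m (b * s\<^sup>2 + c)"
  shows "dvd_in S m (b * r\<^sup>2 + c)"
proof -
  have "b * r\<^sup>2 + c = (r - s) * (b * (r + s)) + (b * s\<^sup>2 + c)"
    by (simp add: algebra_simps power2_eq_square)
  then show ?thesis
    using assms by (simp only:) (intro dvd_in_add[OF _ assms(6)] dvd_in_mult[OF assms(5)] closed)
qed

text \<open>
  The Chinese remainder theorem turns the roots modulo the prime divisors of a squarefree element
  into a single root modulo that element.
\<close>

lemma root_modulo_squarefree:
  assumes b: "b \<in> S" and c: "c \<in> S" and "a \<in> S" "a \<noteq> 0"
    and "\<And>p. prime_in S p \<Longrightarrow> \<not> dvd_in S (p\<^sup>2) a"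
    and "\<And>p. prime_in S p \<Longrightarrow> dvd_in S p a \<Longrightarrow> \<exists>r\<in>S. dvd_in S p (b * r\<^sup>2 + c)"
  shows "\<exists>r\<in>S. dvd_in S a (b * r\<^sup>2 + c)"
  using assms(3-)
proof (induction "N a" arbitrary: a rule: less_induct)
  case less
  show ?case
  proof (cases "unit_in S a")
    case True
    then show ?thesis
      using b c zero_closed by (intro bexI[of _ 0] unit_in_dvd closed)
  next
    case False
    then obtain p a' where p: "prime_in S p" and a': "a' \<in> S" "a = p * a'"
      using prime_divisor less.prems unfolding dvd_in_def by blast
    have pS: "p \<in> S" "p \<noteq> 0" "\<not> unit_in S p" using p by (auto simp: prime_in_def)
    have "N a' < N a"
      using N_mult_less[of a' p] less.prems a' pS by (simp add: mult.commute)
    moreover have a'_dvd: "dvd_in S a' a" using a' pS dvd_in_mult2 dvd_in_refl by simp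
    have "a' \<noteq> 0" using a' less.prems(2) by auto
    moreover have "\<not> dvd_in S (q\<^sup>2) a'" if "prime_in S q" for q
      using less.prems(3)[OF that] dvd_in_trans[OF _ a'_dvd] by blast
    moreover have "\<exists>r\<in>S. dvd_in S q (b * r\<^sup>2 + c)" if "prime_in S q" "dvd_in S q a'" for q
      using less.prems(4)[OF that(1) dvd_in_trans[OF that(2) a'_dvd]] .
    ultimately obtain s where s: "s \<in> S" "dvd_in S a' (b * s\<^sup>2 + c)"
      using less.hyps[of a'] a'(1) by blast
    obtain t where t: "t \<in> S" "dvd_in S p (b * t\<^sup>2 + c)"
      using less.prems(4)[OF p] dvd_in_triv[OF a'(1), of p] unfolding a'(2) by blast
    have "\<not> dvd_in S p a'"
      using less.prems(3)[OF p] pS a' by (simp add: power2_eq_square dvd_in_cancel)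
    then obtain u v where uv: "u \<in> S" "v \<in> S" "u * p + v * a' = 1"
      using prime_in_bezout[OF pS(1,2) prime_in_atom[OF p] a'(1)] by blast
    define r where "r = u * p * s + v * a' * t"
    have r: "r \<in> S" using uv s t pS a' unfolding r_def by (intro closed)
    have vt: "v * a' = 1 - u * p" "u * p = 1 - v * a'" using uv(3) by (simp_all add: algebra_simps)
    have "r - t = p * (u * (s - t))" unfolding r_def vt(1) by (simp add: algebra_simps)
    then have "dvd_in S p (r - t)" using uv s t by (auto intro!: dvd_in_triv closed)
    then have "dvd_in S p (b * r\<^sup>2 + c)" using square_congruent b c r t by blast
    moreover have "r - s = a' * (v * (t - s))" unfolding r_def vt(2) by (simp add: algebra_simps)
    then have "dvd_in S a' (r - s)" using uv s t by (auto intro!: dvd_in_triv closed)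
    then have "dvd_in S a' (b * r\<^sup>2 + c)" using square_congruent b c r s by blast
    ultimately have "dvd_in S a (b * r\<^sup>2 + c)"
      unfolding a' using coprime_mult_dvd uv pS a' by blast
    then show ?thesis using r by blast
  qed
qed

text \<open>
  After cancelling powers of \<open>p\<close> from a solution, \<open>p\<close> does not divide \<open>z\<close>: otherwise it would divide
  \<open>y\<close>, its square would divide \<open>a x\<^sup>2\<close>, and it would divide \<open>x\<close> as well.  Then \<open>y / z\<close> is a root
  modulo \<open>p\<close>.
\<close>

lemma solution_imp_root_modulo_prime:
  assumes p: "prime_in S p" and abc: "a \<in> S" "b \<in> S" "c \<in> S"
    and pa: "dvd_in S p a" "\<not> dvd_in S (p\<^sup>2) a" and pb: "\<not> dvd_in S p b"
    and "x \<in> S" "y \<in> S" "z \<in> S" "\<not> (x = 0 \<and> y = 0 \<and> z = 0)"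
    and "a * x\<^sup>2 + b * y\<^sup>2 + c * z\<^sup>2 = 0"
  shows "\<exists>r\<in>S. dvd_in S p (b * r\<^sup>2 + c)"
  using assms(8-)
proof (induction "N x + N y + N z" arbitrary: x y z rule: less_induct)
  case less
  note xyz = less.prems(1-3) and eq = less.prems(5)
  have pS: "p \<in> S" "p \<noteq> 0" "\<not> unit_in S p" using p by (auto simp: prime_in_def)
  show ?case
  proof (cases "dvd_in S p z")
    case False
    then obtain u v where uv: "u \<in> S" "v \<in> S" "u * p + v * z = 1"
      using prime_in_bezout[OF pS(1,2) prime_in_atom[OF p] xyz(3)] by blast
    have by2: "b * y\<^sup>2 = - (a * x\<^sup>2) - c * z\<^sup>2" using eq by (simp add: algebra_simps eq_neg_iff_add_eq_0)
    have up: "v * z = 1 - u * p" using uv(3) by (simp add: algebra_simps)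
    have "b * (y * v)\<^sup>2 + c = (b * y\<^sup>2) * v\<^sup>2 + c" by (simp add: power_mult_distrib)
    also have "\<dots> = c - c * (v * z)\<^sup>2 - a * (x\<^sup>2 * v\<^sup>2)"
      unfolding by2 by (simp add: algebra_simps power_mult_distrib)
    also have "\<dots> = p * (c * u * (2 - u * p)) - a * (x\<^sup>2 * v\<^sup>2)"
      unfolding up by (simp add: algebra_simps power2_eq_square)
    also have "dvd_in S p \<dots>"
    proof (intro dvd_in_diff dvd_in_mult[OF pa(1)] dvd_in_triv)
      have "(2::'a) \<in> S" using add_closed[OF one_closed one_closed] by simp
      then show "c * u * (2 - u * p) \<in> S" using abc uv pS by (intro closed)
      show "x\<^sup>2 * v\<^sup>2 \<in> S" using xyz uv by (intro closed)
    qed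
    finally show ?thesis using xyz uv closed by blast
  next
    case True
    then obtain z' where z': "z' \<in> S" "z = p * z'" unfolding dvd_in_def by blast
    have "dvd_in S p (b * y\<^sup>2)"
    proof -
      have "b * y\<^sup>2 = - (a * x\<^sup>2 + c * z\<^sup>2)" using eq by (simp add: algebra_simps eq_neg_iff_add_eq_0)
      also have "\<dots> = 0 - (a * x\<^sup>2 + z * (c * z))" by (simp add: power2_eq_square)
      also have "dvd_in S p \<dots>"
        using xyz abc
        by (intro dvd_in_diff dvd_in_add dvd_in_0 dvd_in_mult[OF pa(1)] dvd_in_mult[OF True] closed)
      finally show ?thesis .
    qed
    then have "dvd_in S p (y\<^sup>2)"
      using prime_in_mult_iff[OF p abc(2) power_closed[OF xyz(2)], of 2] pb by simp
    then have "dvd_in S p y" using prime_in_square_iff[OF p xyz(2)] by simp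
    then obtain y' where y': "y' \<in> S" "y = p * y'" unfolding dvd_in_def by blast
    have "x\<^sup>2 * a = p\<^sup>2 * (- (b * y'\<^sup>2 + c * z'\<^sup>2))"
      using eq unfolding y' z' by (simp add: algebra_simps power2_eq_square eq_neg_iff_add_eq_0)
    then have "dvd_in S (p\<^sup>2) (x\<^sup>2 * a)" using abc y' z' by (auto intro!: dvd_in_triv closed)
    then have "dvd_in S p (x\<^sup>2)"
      using prime_in_square_dvd_coprime_mult[OF p power_closed[OF xyz(1)] abc(1)] pa(2) by blast
    then have "dvd_in S p x" using prime_in_square_iff[OF p xyz(1)] by simp
    then obtain x' where x': "x' \<in> S" "x = p * x'" unfolding dvd_in_def by blast
    have lt: "N w < N (p * w)" if "w \<in> S" "w \<noteq> 0" for w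
      using N_mult_less[of w p] that pS by (simp add: mult.commute)
    then have le: "N w \<le> N (p * w)" if "w \<in> S" for w
      using that by (cases "w = 0") (auto intro: less_imp_le)
    have "N x' + N y' + N z' < N x + N y + N z"
      using le[OF x'(1)] le[OF y'(1)] le[OF z'(1)] lt[OF x'(1)] lt[OF y'(1)] lt[OF z'(1)]
        less.prems(4) unfolding x'(2) y'(2) z'(2)
      by (cases "x' = 0"; cases "y' = 0"; cases "z' = 0") auto
    moreover have "p\<^sup>2 * (a * x'\<^sup>2 + b * y'\<^sup>2 + c * z'\<^sup>2) = 0"
      using eq unfolding x' y' z' by (simp add: algebra_simps power2_eq_square)
    then have "a * x'\<^sup>2 + b * y'\<^sup>2 + c * z'\<^sup>2 = 0" using pS by simp
    ultimately show ?thesis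
      using less.hyps[of x' y' z'] x' y' z' less.prems(4) by auto
  qed
qed

end

section \<open>Polynomials with coefficients in a subring\<close>

definition polys :: "'a::idom set \<Rightarrow> 'a poly set" where
  "polys S = {f. \<forall>i. coeff f i \<in> S}"

lemma polys_mono: "S \<subseteq> S' \<Longrightarrow> polys S \<subseteq> polys S'"
  by (auto simp: polys_def)

lemma coeff_polys: "f \<in> polys S \<Longrightarrow> coeff f i \<in> S"
  by (simp add: polys_def)

context unital_subring
begin

lemma unital_subring_polys: "unital_subring (polys S)"
proof
  show "0 \<in> polys S" by (simp add: polys_def zero_closed)
  show "1 \<in> polys S" by (simp add: polys_def zero_closed one_closed)
  fix f g assume fg: "f \<in> polys S" "g \<in> polys S"
  then show "f - g \<in> polys S" by (simp add: polys_def diff_closed)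
  show "f * g \<in> polys S"
    using fg unfolding polys_def by (auto simp: coeff_mult intro!: sum_closed mult_closed)
qed

interpretation P: unital_subring "polys S" by (rule unital_subring_polys)

lemma const_polys_iff: "[:c:] \<in> polys S \<longleftrightarrow> c \<in> S"
  using zero_closed by (auto simp: polys_def coeff_pCons split: nat.splits)

lemma monom_polys: "c \<in> S \<Longrightarrow> monom c n \<in> polys S"
  using zero_closed by (auto simp: polys_def)

lemma smult_polys: "c \<in> S \<Longrightarrow> f \<in> polys S \<Longrightarrow> smult c f \<in> polys S"
  by (auto simp: polys_def mult_closed)

lemma dvd_in_const_iff:
  "f \<in> polys S \<Longrightarrow> dvd_in (polys S) [:c:] f \<longleftrightarrow> (\<forall>i. dvd_in S c (coeff f i))"
proof (induction f)
  case 0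
  then show ?case by (simp add: P.dvd_in_0 dvd_in_0)
next
  case (pCons a f)
  have f: "f \<in> polys S" using pCons(3) by (force simp: polys_def coeff_pCons split: nat.splits)
  show ?case
  proof
    assume "dvd_in (polys S) [:c:] (pCons a f)"
    then show "\<forall>i. dvd_in S c (coeff (pCons a f) i)"
      by (auto simp: dvd_in_def polys_def)
  next
    assume dvd: "\<forall>i. dvd_in S c (coeff (pCons a f) i)"
    from dvd[rule_format, of 0] obtain z where z: "z \<in> S" "a = c * z" by (auto simp: dvd_in_def)
    from dvd have "\<forall>i. dvd_in S c (coeff f i)" by (metis coeff_pCons_Suc)
    then obtain g where g: "g \<in> polys S" "f = [:c:] * g"
      using pCons(2)[OF f] by (auto simp: dvd_in_def)
    have "pCons z g \<in> polys S" using z g by (auto simp: polys_def coeff_pCons split: nat.splits)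
    moreover have "pCons a f = [:c:] * pCons z g" using z g by simp
    ultimately show "dvd_in (polys S) [:c:] (pCons a f)" unfolding dvd_in_def by blast
  qed
qed

text \<open>
  This is the core of Gauss's lemma: primes of the ring of coefficients do not split in the polynomial
  ring.
\<close>

lemma prime_in_const:
  assumes p: "prime_in S p"
  shows "prime_in (polys S) [:p:]"
  unfolding prime_in_def
proof (intro conjI ballI impI)
  have pS: "p \<in> S" "p \<noteq> 0" "\<not> unit_in S p" using p by (auto simp: prime_in_def)
  show "[:p:] \<in> polys S" "[:p:] \<noteq> 0" using pS by (auto simp: const_polys_iff)
  show "\<not> unit_in (polys S) [:p:]"
    using pS(3) dvd_in_const_iff[OF P.one_closed, of p] unfolding unit_in_def
    by (metis lead_coeff_1)
  fix f g assume fg: "f \<in> polys S" "g \<in> polys S" and dvd: "dvd_in (polys S) [:p:] (f * g)"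
  show "dvd_in (polys S) [:p:] f \<or> dvd_in (polys S) [:p:] g"
  proof (rule ccontr)
    assume "\<not> ?thesis"
    then have ex: "\<exists>i. \<not> dvd_in S p (coeff f i)" "\<exists>i. \<not> dvd_in S p (coeff g i)"
      using fg dvd_in_const_iff by auto
    \<comment> \<open>Modulo \<open>p\<close>, the lowest terms of the two factors give the lowest term of the product.\<close>
    define i where "i = (LEAST i. \<not> dvd_in S p (coeff f i))"
    define j where "j = (LEAST i. \<not> dvd_in S p (coeff g i))"
    have i: "\<not> dvd_in S p (coeff f i)" "\<And>k. k < i \<Longrightarrow> dvd_in S p (coeff f k)"
      using LeastI_ex[OF ex(1)] not_less_Least unfolding i_def by blast+
    have j: "\<not> dvd_in S p (coeff g j)" "\<And>k. k < j \<Longrightarrow> dvd_in S p (coeff g k)"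
      using LeastI_ex[OF ex(2)] not_less_Least unfolding j_def by blast+
    have fgS: "coeff f k \<in> S" "coeff g k \<in> S" for k using fg by (auto simp: polys_def)
    have "dvd_in S p (coeff (f * g) (i + j))" using dvd dvd_in_const_iff P.mult_closed fg by blast
    moreover have "coeff (f * g) (i + j) =
        coeff f i * coeff g j + (\<Sum>k\<in>{..i+j}-{i}. coeff f k * coeff g (i + j - k))"
      by (simp add: coeff_mult sum.remove[of "{..i+j}" i])
    moreover have "dvd_in S p (\<Sum>k\<in>{..i+j}-{i}. coeff f k * coeff g (i + j - k))"
    proof (rule dvd_in_sum)
      fix k assume that: "k \<in> {..i+j}-{i}"
      show "dvd_in S p (coeff f k * coeff g (i + j - k))"
      proof (cases "k < i")
        case True
        then show ?thesis using i fgS dvd_in_mult by blast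
      next
        case False
        then have "i + j - k < j" using that by auto
        then show ?thesis using j fgS dvd_in_mult2 by blast
      qed
    qed
    ultimately have "dvd_in S p (coeff f i * coeff g j)"
      using dvd_in_diff[of p "coeff (f * g) (i + j)"
          "\<Sum>k\<in>{..i+j}-{i}. coeff f k * coeff g (i + j - k)"] by (simp only: add_diff_cancel_right')
    then show False using prime_in_mult_iff[OF p fgS(1) fgS(2)] i(1) j(1) by blast
  qed
qed

text \<open>
  Multiplying \<open>f\<close> by the leading coefficient of \<open>d\<close> before each step of the long division keeps all
  coefficients in the subring.
\<close>

lemma pseudo_division:
  assumes d: "d \<in> polys S" "d \<noteq> 0" and "f \<in> polys S"
  shows "\<exists>m. \<exists>q\<in>polys S. \<exists>r\<in>polys S.
    smult (lead_coeff d ^ m) f = q * d + r \<and> (r = 0 \<or> degree r < degree d)"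
  using assms(3)
proof (induction "if f = 0 then 0 else Suc (degree f)" arbitrary: f rule: less_induct)
  case less
  show ?case
  proof (cases "f = 0 \<or> degree f < degree d")
    case True
    then show ?thesis
      using less.prems P.zero_closed by (intro exI[of _ 0] bexI[of _ 0] bexI[of _ f]) auto
  next
    case False
    let ?q = "monom (lead_coeff f) (degree f - degree d)"
    define g where "g = smult (lead_coeff d) f - ?q * d"
    have q: "?q \<in> polys S" using less.prems by (intro monom_polys coeff_polys)
    have gP: "g \<in> polys S"
      unfolding g_def using q d less.prems by (intro P.diff_closed P.mult_closed smult_polys coeff_polys)
    have "degree g \<le> degree f"
      unfolding g_def using False
      by (intro degree_diff_le degree_smult_le order_trans[OF degree_mult_le])
         (auto simp: degree_monom_eq)
    moreover have "coeff g (degree f) = 0"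
      using False by (simp add: g_def coeff_monom_mult)
    ultimately have "g = 0 \<or> degree g < degree f"
      by (metis le_neq_implies_less leading_coeff_0_iff)
    then have "(if g = 0 then 0 else Suc (degree g)) < (if f = 0 then 0 else Suc (degree f))"
      using False by auto
    from less.hyps[OF this gP] obtain m q' r where
      m: "q' \<in> polys S" "r \<in> polys S" "smult (lead_coeff d ^ m) g = q' * d + r"
        "r = 0 \<or> degree r < degree d" by blast
    let ?l = "lead_coeff d ^ m"
    have "smult (lead_coeff d ^ Suc m) f = (q' + smult ?l ?q) * d + r"
      using m(3) unfolding g_def by (simp add: algebra_simps smult_diff_right)
    moreover have "q' + smult ?l ?q \<in> polys S"
      using m q d by (intro P.add_closed smult_polys power_closed coeff_polys)
    ultimately show ?thesis using m by blast
  qed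
qed

end


section \<open>Gauss's lemma\<close>

context ufd_in
begin

interpretation P: unital_subring "polys S" by (rule unital_subring_polys)

definition primitive :: "'a poly \<Rightarrow> bool" where
  "primitive f \<longleftrightarrow> (\<forall>p. prime_in S p \<longrightarrow> \<not> dvd_in (polys S) [:p:] f)"

text \<open>
  Splitting off primes of the coefficient ring terminates because each of them makes the leading
  coefficient smaller.
\<close>

lemma content_primitive_part:
  assumes "f \<in> polys S" "f \<noteq> 0"
  shows "\<exists>c\<in>S. \<exists>g\<in>polys S. f = smult c g \<and> primitive g"
  using assms
proof (induction "N (lead_coeff f)" arbitrary: f rule: less_induct)
  case less
  show ?case
  proof (cases "primitive f")
    case True
    then show ?thesis using less.prems one_closed by (intro bexI[of _ 1] bexI[of _ f]) auto
  next
    case False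
    then obtain p g where p: "prime_in S p" and g: "g \<in> polys S" "f = [:p:] * g"
      unfolding primitive_def dvd_in_def by blast
    have pS: "p \<in> S" "p \<noteq> 0" "\<not> unit_in S p" using p by (auto simp: prime_in_def)
    have "g \<noteq> 0" using less.prems g by auto
    have "N (lead_coeff g) < N (lead_coeff g * p)"
      using pS g \<open>g \<noteq> 0\<close> by (intro N_mult_less) (auto simp: polys_def)
    then have "N (lead_coeff g) < N (lead_coeff f)" using g(2) pS by (simp add: mult.commute)
    then obtain c h where "c \<in> S" "h \<in> polys S" "g = smult c h" "primitive h"
      using less.hyps g(1) \<open>g \<noteq> 0\<close> by blast
    then show ?thesis
      using g(2) pS by (intro bexI[of _ "p * c"] bexI[of _ h]) (auto intro: mult_closed simp: mult.commute)
  qed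
qed

text \<open>
  The prime factors of \<open>s\<close> do not divide \<open>f\<close> and stay prime in the polynomial ring, so they divide
  the cofactor and cancel one by one.
\<close>

lemma primitive_dvd_smult:
  assumes f: "f \<in> polys S" "primitive f" and g: "g \<in> polys S"
    and "s \<in> S" "s \<noteq> 0" "dvd_in (polys S) f (smult s g)"
  shows "dvd_in (polys S) f g"
  using assms(4-)
proof (induction "N s" arbitrary: s rule: less_induct)
  case less
  show ?case
  proof (cases "unit_in S s")
    case True
    then obtain t where t: "t \<in> S" "1 = s * t" unfolding unit_in_def dvd_in_def by blast
    have "dvd_in (polys S) f ([:t:] * smult s g)"
      using less.prems t by (intro P.dvd_in_mult2) (auto simp: const_polys_iff)
    then show ?thesis using t by (simp add: mult.commute)
  next
    case False
    then obtain p s' where p: "prime_in S p" and s': "s' \<in> S" "s = p * s'"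
      using prime_divisor less.prems unfolding dvd_in_def by blast
    have pS: "p \<in> S" "p \<noteq> 0" "\<not> unit_in S p" using p by (auto simp: prime_in_def)
    obtain q where q: "q \<in> polys S" "smult s g = f * q"
      using less.prems unfolding dvd_in_def by blast
    have "f * q = [:p:] * smult s' g" using q s' by (simp add: mult.commute)
    then have "dvd_in (polys S) [:p:] (f * q)"
      using P.dvd_in_triv[OF smult_polys[OF s'(1) g]] by metis
    then have "dvd_in (polys S) [:p:] q"
      using P.prime_in_mult_iff[OF prime_in_const[OF p] f(1) q(1)] f(2) p
      unfolding primitive_def by blast
    then obtain q' where q': "q' \<in> polys S" "q = [:p:] * q'" unfolding dvd_in_def by blast
    have "[:p:] * smult s' g = [:p:] * (f * q')" using q q' s' by (simp add: mult.commute)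
    then have "smult s' g = f * q'" using pS by (metis mult_cancel_left pCons_eq_0_iff)
    then have "dvd_in (polys S) f (smult s' g)" using q' by (simp add: P.dvd_in_triv)
    moreover have "N s' < N s"
      using N_mult_less[of s' p] less.prems s' pS by (simp add: mult.commute)
    ultimately show ?thesis using less.hyps s' less.prems by auto
  qed
qed

lemma primitive_mult:
  assumes "f \<in> polys S" "g \<in> polys S" "primitive f" "primitive g"
  shows "primitive (f * g)"
  using assms P.prime_in_mult_iff[OF prime_in_const] unfolding primitive_def by blast

lemma unit_in_const:
  assumes "unit_in S c"
  shows "unit_in (polys S) [:c:]"
  using dvd_in_const_iff[OF P.one_closed, of c] assms
  by (auto simp: unit_in_def dvd_in_0)

lemma unit_in_polys_degree:
  assumes "unit_in (polys S) f"
  shows "degree f = 0"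
proof -
  obtain g where "1 = f * g" using assms unfolding unit_in_def dvd_in_def by blast
  then have "f dvd 1" by (rule dvdI)
  then show ?thesis by (auto simp: is_unit_poly_iff)
qed

text \<open>
  A divisor of least positive degree of a primitive polynomial is prime.  If it divides \<open>g h\<close>, take an
  element \<open>d\<close> of least degree in the ideal that it generates together with \<open>g\<close>: pseudo-division
  shows that \<open>d\<close> divides both generators up to constants, so either \<open>d\<close> is constant, and the
  divisor divides \<open>h\<close>, or its primitive part is associated to the divisor, which then divides \<open>g\<close>.
\<close>

lemma primitive_minimal_prime_in:
  assumes f: "f \<in> polys S" "primitive f" "degree f > 0"
    and minimal: "\<And>e. e \<in> polys S \<Longrightarrow> dvd_in (polys S) e f \<Longrightarrow> degree e > 0 \<Longrightarrow> degree f \<le> degree e"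
  shows "prime_in (polys S) f"
  unfolding prime_in_def
proof (intro conjI ballI impI)
  show "f \<in> polys S" "f \<noteq> 0" using f by auto
  show "\<not> unit_in (polys S) f" using unit_in_polys_degree f by force
  fix g h assume g: "g \<in> polys S" and h: "h \<in> polys S" and dvd: "dvd_in (polys S) f (g * h)"
  let ?P = "\<lambda>d. d \<noteq> 0 \<and> (\<exists>u\<in>polys S. \<exists>v\<in>polys S. d = u * f + v * g)"
  have "?P f" using f P.zero_closed P.one_closed
    by (intro conjI bexI[of _ 1] bexI[of _ 0]) auto
  then obtain d where d: "?P d" and min: "\<And>e. degree e < degree d \<Longrightarrow> \<not> ?P e"
    using exists_least_iff[of "\<lambda>n. \<exists>d. ?P d \<and> degree d = n"] by metis
  from d obtain u v where uv: "u \<in> polys S" "v \<in> polys S" "d = u * f + v * g" by blast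
  have dP: "d \<in> polys S" using uv f g by (auto intro: P.closed)
  have multiple: "\<exists>e\<in>S. e \<noteq> 0 \<and> dvd_in (polys S) d (smult e (s * f + t * g))"
    if st: "s \<in> polys S" "t \<in> polys S" for s t
  proof -
    have "s * f + t * g \<in> polys S" using st f g by (intro P.closed)
    then obtain m q r where qr: "q \<in> polys S" "r \<in> polys S"
      "smult (lead_coeff d ^ m) (s * f + t * g) = q * d + r" "r = 0 \<or> degree r < degree d"
      using pseudo_division[OF dP] d by blast
    let ?e = "lead_coeff d ^ m"
    have e: "?e \<in> S" "?e \<noteq> 0" using d dP by (auto intro!: power_closed coeff_polys)
    have "r = (smult ?e s - q * u) * f + (smult ?e t - q * v) * g"
      using qr(3) uv(3) by (simp add: algebra_simps smult_add_right)
    moreover have "smult ?e s - q * u \<in> polys S" "smult ?e t - q * v \<in> polys S"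
      using qr uv st e by (auto intro!: P.diff_closed P.mult_closed smult_polys)
    ultimately have "r = 0" using min[of r] qr(4) by blast
    then show ?thesis using e qr unfolding dvd_in_def
      by (intro bexI[of _ ?e] conjI bexI[of _ q]) (auto simp: mult.commute)
  qed
  show "dvd_in (polys S) f g \<or> dvd_in (polys S) f h"
  proof (cases "degree d = 0")
    case True
    then obtain s where s: "d = [:s:]" by (metis degree_eq_zeroE)
    have sS: "s \<in> S" "s \<noteq> 0" using d dP s by (auto simp: const_polys_iff)
    have "smult s h = (u * f + v * g) * h" using s uv(3) by (metis mult_pCons_left mult_zero_left pCons_0_0 add.right_neutral)
    also have "\<dots> = f * (u * h) + (g * h) * v" by (simp add: algebra_simps)
    also have "dvd_in (polys S) f \<dots>"
      using uv h by (intro P.dvd_in_add P.dvd_in_triv P.dvd_in_mult[OF dvd] P.closed)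
    finally show ?thesis using primitive_dvd_smult f h sS by blast
  next
    case False
    obtain c d' where d': "c \<in> S" "d' \<in> polys S" "d = smult c d'" "primitive d'"
      using content_primitive_part dP d by blast
    have c0: "c \<noteq> 0" using d d' by auto
    have "d = d' * [:c:]" using d' by simp
    then have "dvd_in (polys S) d' d" using d' P.dvd_in_triv const_polys_iff by metis
    then have d'_dvd: "dvd_in (polys S) d' (s * f + t * g)" if "s \<in> polys S" "t \<in> polys S" for s t
      using multiple[OF that] primitive_dvd_smult[OF d'(2,4)] P.dvd_in_trans that f g P.closed
      by (meson P.add_closed P.mult_closed)
    have df: "dvd_in (polys S) d' f" using d'_dvd[of 1 0] P.closed by simp
    have dg: "dvd_in (polys S) d' g" using d'_dvd[of 0 1] P.closed by simp
    from df obtain k where k: "k \<in> polys S" "f = d' * k" unfolding dvd_in_def by blast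
    have "degree d' > 0" using False d' c0 by simp
    then have "degree f \<le> degree d'" using minimal d'(2) df by blast
    moreover have "degree f = degree d' + degree k"
      using k f by (metis degree_mult_eq degree_0 less_irrefl mult_eq_0_iff)
    ultimately obtain \<kappa> where \<kappa>: "k = [:\<kappa>:]" by (metis add_le_same_cancel1 le_zero_eq degree_eq_zeroE)
    have \<kappa>S: "\<kappa> \<in> S" "\<kappa> \<noteq> 0" using k \<kappa> f by (auto simp: const_polys_iff)
    have "unit_in S \<kappa>"
    proof (rule ccontr)
      assume "\<not> unit_in S \<kappa>"
      then obtain p z where p: "prime_in S p" and z: "z \<in> S" "\<kappa> = p * z"
        using prime_divisor \<kappa>S unfolding dvd_in_def by blast
      have "f = [:p:] * smult z d'" using k \<kappa> z by (simp add: mult.commute)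
      then have "dvd_in (polys S) [:p:] f" using d' z P.dvd_in_triv smult_polys by metis
      then show False using p f unfolding primitive_def by blast
    qed
    then have "unit_in (polys S) k" unfolding \<kappa> by (rule unit_in_const)
    then have "dvd_in (polys S) f d'"
      using P.unit_in_mult_cancel[OF _ k(1), of f d'] k(2) P.dvd_in_refl[of f] by (simp add: mult.commute)
    then show ?thesis using dg P.dvd_in_trans by blast
  qed
qed

text \<open>
  The degree measures the factors of positive degree, and the size of the leading coefficient measures
  the constant factors.  A non-unit has a constant prime divisor, or it is primitive and its divisors of
  least positive degree are prime.
\<close>

theorem ufd_in_polys: "ufd_in (polys S) (\<lambda>f. degree f + N (lead_coeff f))"
proof
  fix f g assume fg: "f \<in> polys S" "g \<in> polys S" "f * g \<noteq> 0"
  then have deg: "degree (f * g) = degree f + degree g" "f \<noteq> 0" "g \<noteq> 0" by (auto simp: degree_mult_eq)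
  have lc: "lead_coeff f \<in> S" "lead_coeff g \<in> S" "lead_coeff f * lead_coeff g \<noteq> 0"
    using fg by (auto simp: coeff_polys)
  have lc_mult: "lead_coeff (f * g) = lead_coeff f * lead_coeff g" by (rule lead_coeff_mult)
  show "degree f + N (lead_coeff f) \<le> degree (f * g) + N (lead_coeff (f * g))"
    using N_mult_le[OF lc] deg(1) unfolding lc_mult by linarith
  assume g: "\<not> unit_in (polys S) g"
  show "degree f + N (lead_coeff f) < degree (f * g) + N (lead_coeff (f * g))"
  proof (cases "degree g = 0")
    case True
    then have "\<not> unit_in S (lead_coeff g)"
      using g unit_in_const degree_0_id by (metis degree_0_id)
    then show ?thesis using N_mult_less[OF lc] deg(1) unfolding lc_mult by linarith
  next
    case False
    then show ?thesis using N_mult_le[OF lc] deg(1) unfolding lc_mult by linarith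
  qed
next
  fix x assume x: "x \<in> polys S" "x \<noteq> 0" "\<not> unit_in (polys S) x"
  show "\<exists>p. prime_in (polys S) p \<and> dvd_in (polys S) p x"
  proof (cases "primitive x")
    case False
    then show ?thesis using prime_in_const unfolding primitive_def by blast
  next
    case True
    have "degree x \<noteq> 0"
    proof
      assume "degree x = 0"
      then obtain c where c: "x = [:c:]" by (metis degree_eq_zeroE)
      have "\<not> unit_in S c" "c \<in> S" "c \<noteq> 0" using x c unit_in_const by (auto simp: const_polys_iff)
      then obtain p where p: "prime_in S p" "dvd_in S p c" using prime_divisor by blast
      have "dvd_in (polys S) [:p:] x"
        using p(2) unfolding dvd_in_const_iff[OF x(1)] unfolding c
        by (auto simp: coeff_pCons dvd_in_0 split: nat.splits)
      then show False using p True unfolding primitive_def by blast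
    qed
    let ?P = "\<lambda>f. f \<in> polys S \<and> dvd_in (polys S) f x \<and> degree f > 0"
    have "?P x" using x \<open>degree x \<noteq> 0\<close> P.dvd_in_refl by simp
    then obtain f where f: "?P f" and min: "\<And>e. degree e < degree f \<Longrightarrow> \<not> ?P e"
      using exists_least_iff[of "\<lambda>n. \<exists>d. ?P d \<and> degree d = n"] by metis
    have "primitive f" using True f P.dvd_in_trans unfolding primitive_def by blast
    moreover have "degree f \<le> degree e"
      if "e \<in> polys S" "dvd_in (polys S) e f" "degree e > 0" for e
      using min[of e] that f P.dvd_in_trans not_less by blast
    ultimately have "prime_in (polys S) f" using primitive_minimal_prime_in f by blast
    then show ?thesis using f by blast
  qed
qed

end

section \<open>Transport along embeddings\<close>

text \<open>
  The examples are the inclusion of the integers and the evaluation of polynomials at a transcendental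
  element of a large field.  The latter is a homomorphism on all polynomials over that field, but
  injective only on the set \<open>T\<close> of those with coefficients in a suitable subring.
\<close>

locale ring_embedding = unital_subring T for T :: "'b::idom set" +
  fixes h :: "'b \<Rightarrow> 'a::idom"
  assumes h_one: "h 1 = 1" and h_diff: "h (x - y) = h x - h y" and h_mult: "h (x * y) = h x * h y"
    and inj: "inj_on h T"
begin

lemma h_zero: "h 0 = 0"
  using h_diff[of 0 0] by simp

lemma h_eq_0_iff: "x \<in> T \<Longrightarrow> h x = 0 \<longleftrightarrow> x = 0"
  using inj_on_eq_iff[OF inj, of x 0] h_zero zero_closed by simp

lemma h_add: "h (x + y) = h x + h y"
  using h_diff[of x "0 - y"] h_diff[of 0 y] h_zero by simp

lemma unital_subring_image: "unital_subring (h ` T)"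
proof
  show "0 \<in> h ` T" "1 \<in> h ` T"
    using h_zero h_one zero_closed one_closed by (metis image_eqI)+
  fix x y assume "x \<in> h ` T" "y \<in> h ` T"
  then obtain a b where "a \<in> T" "b \<in> T" "x = h a" "y = h b" by blast
  then show "x - y \<in> h ` T" "x * y \<in> h ` T"
    using h_diff[of a b] h_mult[of a b] diff_closed mult_closed by (metis image_eqI)+
qed

lemma dvd_in_image: "x \<in> T \<Longrightarrow> y \<in> T \<Longrightarrow> dvd_in (h ` T) (h x) (h y) \<longleftrightarrow> dvd_in T x y"
  unfolding dvd_in_def using inj_on_eq_iff[OF inj, of y] by (auto simp: h_mult[symmetric] mult_closed)

lemma unit_in_image: "x \<in> T \<Longrightarrow> unit_in (h ` T) (h x) \<longleftrightarrow> unit_in T x"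
  unfolding unit_in_def h_one[symmetric] using one_closed by (simp add: dvd_in_image)

lemma prime_in_image: "p \<in> T \<Longrightarrow> prime_in (h ` T) (h p) \<longleftrightarrow> prime_in T p"
  unfolding prime_in_def
  by (simp add: unit_in_image h_eq_0_iff h_mult[symmetric] dvd_in_image mult_closed)

lemma ufd_in_image:
  assumes "ufd_in T N"
  shows "ufd_in (h ` T) (\<lambda>x. N (the_inv_into T h x))"
proof -
  interpret ufd_in T N by fact
  interpret I: unital_subring "h ` T" by (rule unital_subring_image)
  have inv: "the_inv_into T h (h a) = a" if "a \<in> T" for a
    using the_inv_into_f_f[OF inj that] .
  show ?thesis
  proof
    fix x y assume "x \<in> h ` T" "y \<in> h ` T" and xy: "x * y \<noteq> 0"
    then obtain a b where ab: "a \<in> T" "b \<in> T" "x = h a" "y = h b" by blast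
    then have *: "x * y = h (a * b)" "a * b \<in> T" by (simp_all add: h_mult mult_closed)
    then have "a * b \<noteq> 0" using xy h_zero by auto
    then show "N (the_inv_into T h x) \<le> N (the_inv_into T h (x * y))"
      unfolding * unfolding ab using ab inv * N_mult_le by simp
    assume "\<not> unit_in (h ` T) y"
    then show "N (the_inv_into T h x) < N (the_inv_into T h (x * y))"
      unfolding * unfolding ab using ab inv * N_mult_less \<open>a * b \<noteq> 0\<close> unit_in_image by simp
  next
    fix x assume "x \<in> h ` T" "x \<noteq> 0" "\<not> unit_in (h ` T) x"
    then obtain a where "a \<in> T" "x = h a" "a \<noteq> 0" "\<not> unit_in T a"
      using h_zero unit_in_image by blast
    moreover then obtain p where "prime_in T p" "dvd_in T p a" using prime_divisor by blast
    moreover from this have "p \<in> T" by (simp add: prime_in_def)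
    ultimately show "\<exists>p. prime_in (h ` T) p \<and> dvd_in (h ` T) p x"
      using prime_in_image dvd_in_image by blast
  qed
qed

lemma euclidean_in_image:
  assumes "euclidean_in T N"
  shows "euclidean_in (h ` T) (\<lambda>x. N (the_inv_into T h x))"
proof -
  interpret euclidean_in T N by fact
  interpret I: unital_subring "h ` T" by (rule unital_subring_image)
  have inv: "the_inv_into T h (h a) = a" if "a \<in> T" for a
    using the_inv_into_f_f[OF inj that] .
  show ?thesis
  proof
    fix x y assume "x \<in> h ` T" "y \<in> h ` T" and xy: "x * y \<noteq> 0"
    then obtain a b where ab: "a \<in> T" "b \<in> T" "x = h a" "y = h b" by blast
    then have *: "x * y = h (a * b)" "a * b \<in> T" by (simp_all add: h_mult mult_closed)
    then have "a * b \<noteq> 0" using xy h_zero by auto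
    then show "N (the_inv_into T h x) \<le> N (the_inv_into T h (x * y))"
      unfolding * unfolding ab using ab inv * size_mult_le by simp
  next
    fix x d assume "x \<in> h ` T" "d \<in> h ` T" "d \<noteq> 0"
    then obtain a b where ab: "a \<in> T" "b \<in> T" "x = h a" "d = h b" "b \<noteq> 0" using h_zero by auto
    then obtain q r where "q \<in> T" "r \<in> T" "a = q * b + r" "r = 0 \<or> N r < N b"
      using division by blast
    then show "\<exists>q\<in>h ` T. \<exists>r\<in>h ` T. x = q * d + r \<and>
        (r = 0 \<or> N (the_inv_into T h r) < N (the_inv_into T h d))"
      using ab inv h_zero by (intro bexI[of _ "h q"] bexI[of _ "h r"]) (auto simp: h_add h_mult)
  qed
qed

end


section \<open>Fractions\<close>

definition fracs :: "'a::field set \<Rightarrow> 'a set" where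
  "fracs S = {x / y |x y. x \<in> S \<and> y \<in> S \<and> y \<noteq> 0}"

locale subfield_in = unital_subring S for S :: "'a::field set" +
  assumes inverse_closed: "x \<in> S \<Longrightarrow> inverse x \<in> S"
begin

lemma divide_closed: "x \<in> S \<Longrightarrow> y \<in> S \<Longrightarrow> x / y \<in> S"
  by (simp add: divide_inverse mult_closed inverse_closed)

lemma unit_in_subfield: "x \<in> S \<Longrightarrow> x \<noteq> 0 \<Longrightarrow> unit_in S x"
  unfolding unit_in_def dvd_in_def using inverse_closed by (intro bexI[of _ "inverse x"]) auto

lemma ufd_in_subfield: "ufd_in S (\<lambda>_. 0)"
  by unfold_locales (use unit_in_subfield in auto)

lemma euclidean_in_polys: "euclidean_in (polys S) degree"
proof -
  interpret P: unital_subring "polys S" by (rule unital_subring_polys)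
  show ?thesis
  proof
    fix f d assume f: "f \<in> polys S" and d: "d \<in> polys S" "d \<noteq> 0"
    obtain m q r where qr: "q \<in> polys S" "r \<in> polys S"
      "smult (lead_coeff d ^ m) f = q * d + r" "r = 0 \<or> degree r < degree d"
      using pseudo_division[OF d f] by blast
    define c where "c = inverse (lead_coeff d ^ m)"
    have c: "c \<in> S" "c \<noteq> 0" unfolding c_def using d by (auto intro!: inverse_closed power_closed coeff_polys)
    have "f = smult c (smult (lead_coeff d ^ m) f)" using d by (simp add: c_def)
    also have "\<dots> = smult c q * d + smult c r" unfolding qr(3) by (simp add: smult_add_right)
    finally show "\<exists>q\<in>polys S. \<exists>r\<in>polys S. f = q * d + r \<and> (r = 0 \<or> degree r < degree d)"
      using qr c by (intro bexI[of _ "smult c q"] bexI[of _ "smult c r"]) (auto intro: smult_polys)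
  qed (auto simp: degree_mult_eq)
qed

end

lemma subset_fracs: "unital_subring S \<Longrightarrow> S \<subseteq> fracs S"
proof
  fix x assume "unital_subring S" "x \<in> S"
  then show "x \<in> fracs S"
    unfolding fracs_def using unital_subring.one_closed[of S]
    by (intro CollectI exI[of _ x] exI[of _ 1]) auto
qed

lemma subfield_in_fracs:
  assumes "unital_subring S"
  shows "subfield_in (fracs S)"
proof -
  interpret unital_subring S by fact
  show ?thesis
  proof
    show "0 \<in> fracs S" "1 \<in> fracs S" using subset_fracs[OF assms] closed by auto
    fix x y assume "x \<in> fracs S" "y \<in> fracs S"
    then obtain a b c d where ab: "x = a / b" "y = c / d" "a \<in> S" "b \<in> S" "c \<in> S" "d \<in> S"
      "b \<noteq> 0" "d \<noteq> 0" unfolding fracs_def by blast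
    have "x - y = (a * d - c * b) / (b * d)" using ab by (simp add: diff_frac_eq)
    then show "x - y \<in> fracs S"
      unfolding fracs_def using ab
      by (intro CollectI exI[of _ "a * d - c * b"] exI[of _ "b * d"]) (auto intro: closed)
    have "x * y = (a * c) / (b * d)" using ab by simp
    then show "x * y \<in> fracs S"
      unfolding fracs_def using ab
      by (intro CollectI exI[of _ "a * c"] exI[of _ "b * d"]) (auto intro: closed)
  next
    fix x assume "x \<in> fracs S"
    then obtain a b where ab: "x = a / b" "a \<in> S" "b \<in> S" "b \<noteq> 0" unfolding fracs_def by blast
    show "inverse x \<in> fracs S"
    proof (cases "a = 0")
      case True
      then show ?thesis using ab subset_fracs[OF assms] closed by auto
    next
      case False
      then show ?thesis unfolding fracs_def using ab by auto
    qed
  qed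
qed

context unital_subring
begin

lemma common_denominator_polys:
  fixes S' :: "'a set"
  assumes "\<And>x. x \<in> S' \<Longrightarrow> \<exists>d\<in>S. d \<noteq> 0 \<and> d * x \<in> S" and "f \<in> polys S'"
  shows "\<exists>d\<in>S. d \<noteq> 0 \<and> smult d f \<in> polys S"
  using assms(2)
proof (induction f)
  case 0
  then show ?case using one_closed zero_closed by (intro bexI[of _ 1]) (auto simp: polys_def)
next
  case (pCons a f)
  have "f \<in> polys S'" using pCons(3) by (force simp: polys_def coeff_pCons split: nat.splits)
  then obtain d where d: "d \<in> S" "d \<noteq> 0" "smult d f \<in> polys S" using pCons(2) by blast
  have "a \<in> S'" using coeff_polys[OF pCons(3), of 0] by simp
  then obtain e where e: "e \<in> S" "e \<noteq> 0" "e * a \<in> S" using assms(1) by blast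
  have "e * d * a \<in> S" using mult_closed[OF d(1) e(3)] by (simp add: ac_simps)
  moreover have "smult (e * d) f \<in> polys S" using smult_polys[OF e(1) d(3)] by simp
  ultimately have "smult (e * d) (pCons a f) \<in> polys S"
    by (auto simp: polys_def coeff_pCons split: nat.splits)
  then show ?case using d e by (intro bexI[of _ "e * d"]) (auto intro: mult_closed)
qed

end

lemma fracs_denominator: "x \<in> fracs S \<Longrightarrow> \<exists>d\<in>S. d \<noteq> 0 \<and> d * x \<in> S"
  unfolding fracs_def by auto


section \<open>The rings of polynomials in finitely many variables\<close>

lemma of_mpoly_0: "of_mpoly 0 = 0"
  by (simp add: of_mpoly_def fract_collapse)

lemma of_mpoly_1: "of_mpoly 1 = 1"
  by (simp add: of_mpoly_def fract_collapse)

lemma of_mpoly_add: "of_mpoly (p + q) = of_mpoly p + of_mpoly q"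
  by (simp add: of_mpoly_def)

lemma of_mpoly_diff: "of_mpoly (p - q) = of_mpoly p - of_mpoly q"
  by (simp add: of_mpoly_def)

lemma of_mpoly_mult: "of_mpoly (p * q) = of_mpoly p * of_mpoly q"
  by (simp add: of_mpoly_def)

lemma of_mpoly_power: "of_mpoly (p ^ n) = of_mpoly p ^ n"
  by (induction n) (auto simp: of_mpoly_1 of_mpoly_mult)

lemma of_mpoly_sum: "of_mpoly (sum f I) = (\<Sum>i\<in>I. of_mpoly (f i))"
  by (induction I rule: infinite_finite_induct) (auto simp: of_mpoly_0 of_mpoly_add)

lemma of_mpoly_eq_iff: "of_mpoly p = of_mpoly q \<longleftrightarrow> p = q"
  by (simp add: of_mpoly_def eq_fract)

lemma of_mpoly_eq_0_iff: "of_mpoly p = 0 \<longleftrightarrow> p = 0"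
  using of_mpoly_eq_iff[of p 0] by (simp add: of_mpoly_0)

lemma Fract_eq_divide: "q \<noteq> 0 \<Longrightarrow> Fraction_Field.Fract p q = of_mpoly p / of_mpoly q"
  by (simp add: of_mpoly_def)

definition rat_polys :: "nat \<Rightarrow> ratfun set" where
  "rat_polys k = of_mpoly ` mpolys k"

lemma unital_subring_mpolys: "unital_subring (mpolys k)"
proof
  show "0 \<in> mpolys k" "1 \<in> mpolys k" by (simp_all add: mpolys_def)
  fix p q assume pq: "p \<in> mpolys k" "q \<in> mpolys k"
  have "Poly_Mapping.keys (p - q) \<subseteq> Poly_Mapping.keys p \<union> Poly_Mapping.keys q"
    by (auto simp: in_keys_iff lookup_minus)
  then show "p - q \<in> mpolys k" using pq unfolding mpolys_def by blast
  show "p * q \<in> mpolys k"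
    unfolding mpolys_def
  proof (intro CollectI ballI)
    fix m assume "m \<in> Poly_Mapping.keys (p * q)"
    then obtain a b where ab: "m = a + b" "a \<in> Poly_Mapping.keys p" "b \<in> Poly_Mapping.keys q"
      using keys_mult[of p q] by blast
    then show "Poly_Mapping.keys m \<subseteq> {1..k}"
      using keys_add[of a b] pq unfolding mpolys_def by blast
  qed
qed

lemma unital_subring_rat_polys: "unital_subring (rat_polys k)"
proof -
  interpret unital_subring "mpolys k" by (rule unital_subring_mpolys)
  interpret ring_embedding "mpolys k" of_mpoly
    by unfold_locales (auto simp: of_mpoly_1 of_mpoly_diff of_mpoly_mult of_mpoly_eq_iff inj_on_def)
  show ?thesis unfolding rat_polys_def by (rule unital_subring_image)
qed

lemma K_eq_fracs: "K k = fracs (rat_polys k)"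
proof -
  have "K k = {of_mpoly p / of_mpoly q |p q. p \<in> mpolys k \<and> q \<in> mpolys k \<and> q \<noteq> 0}"
    unfolding K_def by (metis (mono_tags, opaque_lifting) Fract_eq_divide)
  also have "\<dots> = fracs (rat_polys k)"
    unfolding fracs_def rat_polys_def using of_mpoly_eq_0_iff by blast
  finally show ?thesis .
qed

lemma subfield_in_K: "subfield_in (K k)"
  unfolding K_eq_fracs by (rule subfield_in_fracs, rule unital_subring_rat_polys)

lemma rat_polys_subset_K: "rat_polys k \<subseteq> K k"
  unfolding K_eq_fracs by (rule subset_fracs, rule unital_subring_rat_polys)

lemma mpolys_0: "mpolys 0 = range (Poly_Mapping.single 0)"
proof (intro equalityI subsetI)
  fix p assume "p \<in> mpolys 0"
  then have "Poly_Mapping.keys p \<subseteq> {0}" by (auto simp: mpolys_def)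
  then have "p = Poly_Mapping.single 0 (Poly_Mapping.lookup p 0)"
    by (intro poly_mapping_eqI) (auto simp: lookup_single when_def in_keys_iff)
  then show "p \<in> range (Poly_Mapping.single 0)" by blast
qed (auto simp: mpolys_def split: if_splits)

lemma rat_polys_0: "rat_polys 0 = range const"
  unfolding rat_polys_def mpolys_0 const_def image_image ..

lemma const_diff: "const (p - q) = const p - const q"
  by (simp add: const_def single_diff of_mpoly_diff)

lemma const_mult: "const (p * q) = const p * const q"
  by (simp add: const_def of_mpoly_mult[symmetric] mult_single)

lemma const_1: "const 1 = 1"
  by (simp add: const_def of_mpoly_1)

lemma const_eq_iff: "const p = const q \<longleftrightarrow> p = q"
  by (metis const_def of_mpoly_eq_iff lookup_single_eq)

lemma const_0: "const 0 = 0"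
  by (simp add: const_def of_mpoly_0)

lemma const_eq_0_iff: "const p = 0 \<longleftrightarrow> p = 0"
  using const_eq_iff[of p 0] by (simp add: const_0)

lemma const_add: "const (p + q) = const p + const q"
  by (simp add: const_def single_add of_mpoly_add)

lemma const_divide: "const (p / q) = const p / const q"
proof (cases "q = 0")
  case False
  then have "const (p / q) * const q = const p" by (simp flip: const_mult)
  then show ?thesis using False by (simp add: const_eq_0_iff nonzero_eq_divide_eq)
qed (simp add: const_0)

lemma const_power: "const (p ^ n) = const p ^ n"
  by (induction n) (auto simp: const_1 const_mult)

lemma K_0: "K 0 = range const"
proof
  show "K 0 \<subseteq> range const"
    unfolding K_eq_fracs fracs_def rat_polys_0 by (auto simp flip: const_divide)
  show "range const \<subseteq> K 0" using rat_polys_subset_K[of 0] rat_polys_0 by simp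
qed

lemma subfield_in_rat_polys_0: "subfield_in (rat_polys 0)"
  using subfield_in_K[of 0] by (simp add: K_0 rat_polys_0)

subsection \<open>Expansion in powers of the last variable\<close>

lemma mpoly_eq_sum_single:
  "p = (\<Sum>m\<in>Poly_Mapping.keys p. Poly_Mapping.single m (Poly_Mapping.lookup p m))"
  by (rule poly_mapping_eqI)
     (auto simp: lookup_sum lookup_single when_def in_keys_iff sum.delta split: if_splits)

lemma single_variable_power:
  "(Poly_Mapping.single (Poly_Mapping.single i 1) 1 :: mpoly) ^ n =
   Poly_Mapping.single (Poly_Mapping.single i n) 1"
  by (induction n) (auto simp: mult_single single_add[symmetric])

lemma tvar_power: "tvar i ^ n = of_mpoly (Poly_Mapping.single (Poly_Mapping.single i n) 1)"
  unfolding tvar_def of_mpoly_power[symmetric] single_variable_power ..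

text \<open>
  The variable with index \<open>j\<close> does not occur in \<open>p\<close>, so its exponent in a monomial of the product tells
  which power of it the monomial comes from.
\<close>

lemma lookup_mult_variable_power:
  fixes p :: mpoly
  assumes p: "p \<in> mpolys k" and m: "Poly_Mapping.keys m \<subseteq> {1..k}" and "j > k"
  shows "Poly_Mapping.lookup (p * Poly_Mapping.single (Poly_Mapping.single j n) 1) (m + Poly_Mapping.single j n') =
    (if n = n' then Poly_Mapping.lookup p m else 0)"
proof -
  have avoid: "Poly_Mapping.lookup m' j = 0" if "Poly_Mapping.keys m' \<subseteq> {1..k}" for m' :: "nat \<Rightarrow>\<^sub>0 nat"
    using that \<open>j > k\<close> by (metis atLeastAtMost_iff in_keys_iff not_less subsetD)
  have eq_iff: "m' + Poly_Mapping.single j n = m + Poly_Mapping.single j n' \<longleftrightarrow> m' = m \<and> n = n'"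
    if "m' \<in> Poly_Mapping.keys p" for m'
  proof
    assume eq: "m' + Poly_Mapping.single j n = m + Poly_Mapping.single j n'"
    have "Poly_Mapping.lookup m' j = 0" "Poly_Mapping.lookup m j = 0" using avoid m p that by (auto simp: mpolys_def)
    then have "n = n'" using arg_cong[OF eq, of "\<lambda>x. Poly_Mapping.lookup x j"] by (simp add: lookup_add)
    then show "m' = m \<and> n = n'" using eq by simp
  qed simp
  have "p * Poly_Mapping.single (Poly_Mapping.single j n) 1 =
      (\<Sum>m'\<in>Poly_Mapping.keys p. Poly_Mapping.single (m' + Poly_Mapping.single j n) (Poly_Mapping.lookup p m'))"
    by (subst mpoly_eq_sum_single[of p]) (simp add: sum_distrib_right mult_single)
  then have "Poly_Mapping.lookup (p * Poly_Mapping.single (Poly_Mapping.single j n) 1) (m + Poly_Mapping.single j n') =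
      (\<Sum>m'\<in>Poly_Mapping.keys p. Poly_Mapping.lookup p m' when
         (m' + Poly_Mapping.single j n = m + Poly_Mapping.single j n'))"
    by (simp add: lookup_sum lookup_single)
  also have "\<dots> = (\<Sum>m'\<in>Poly_Mapping.keys p. if m' = m then (if n = n' then Poly_Mapping.lookup p m else 0) else 0)"
    by (intro sum.cong) (auto simp: when_def eq_iff)
  also have "\<dots> = (if n = n' then Poly_Mapping.lookup p m else 0)"
    by (auto simp: sum.delta in_keys_iff)
  finally show ?thesis .
qed

text \<open>
  This says that the next variable is transcendental over the polynomials in the previous ones; the
  same for rational functions follows by clearing denominators.
\<close>

lemma rat_polys_expansion_unique:
  assumes f: "f \<in> polys (rat_polys k)" and root: "poly f (tvar (Suc k)) = 0"
  shows "f = 0"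
proof (rule poly_eqI)
  fix n
  have "\<exists>p. \<forall>i. p i \<in> mpolys k \<and> coeff f i = of_mpoly (p i)"
    using f unfolding polys_def rat_polys_def by (intro choice) blast
  then obtain p where p: "p i \<in> mpolys k" "coeff f i = of_mpoly (p i)" for i by blast
  let ?x = "\<lambda>n. Poly_Mapping.single (Poly_Mapping.single (Suc k) n) 1 :: mpoly"
  have "of_mpoly (\<Sum>i\<le>degree f. p i * ?x i) = 0"
    using root by (simp add: poly_altdef p(2) tvar_power of_mpoly_sum of_mpoly_mult)
  then have sum0: "(\<Sum>i\<le>degree f. p i * ?x i) = 0" by (simp add: of_mpoly_eq_0_iff)
  have "p n = 0" if "n \<le> degree f"
  proof (rule poly_mapping_eqI)
    fix m
    show "Poly_Mapping.lookup (p n) m = Poly_Mapping.lookup 0 m"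
    proof (cases "Poly_Mapping.keys m \<subseteq> {1..k}")
      case True
      have "0 = Poly_Mapping.lookup (\<Sum>i\<le>degree f. p i * ?x i) (m + Poly_Mapping.single (Suc k) n)"
        using sum0 by simp
      also have "\<dots> = (\<Sum>i\<le>degree f. if i = n then Poly_Mapping.lookup (p i) m else 0)"
        unfolding lookup_sum by (intro sum.cong refl lookup_mult_variable_power[OF p(1) True]) simp
      also have "\<dots> = Poly_Mapping.lookup (p n) m" using that by simp
      finally show ?thesis by simp
    next
      case False
      then show ?thesis using p(1)[of n] by (auto simp: mpolys_def in_keys_iff)
    qed
  qed
  then show "coeff f n = coeff 0 n"
    using p(2)[of n] by (cases "n \<le> degree f") (auto simp: of_mpoly_0 coeff_eq_0)
qed

lemma K_expansion_unique:
  assumes f: "f \<in> polys (K k)" and root: "poly f (tvar (Suc k)) = 0"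
  shows "f = 0"
proof -
  interpret unital_subring "rat_polys k" by (rule unital_subring_rat_polys)
  obtain d where d: "d \<noteq> 0" "smult d f \<in> polys (rat_polys k)"
    using common_denominator_polys[of "K k"] f fracs_denominator unfolding K_eq_fracs by metis
  moreover have "poly (smult d f) (tvar (Suc k)) = 0" using root by simp
  ultimately show ?thesis using rat_polys_expansion_unique by (metis smult_eq_0_iff)
qed

lemma mpolys_mono: "mpolys j \<subseteq> mpolys (Suc j)"
  unfolding mpolys_def by (auto dest!: bspec)

lemma tvar_in_rat_polys: "tvar (Suc j) \<in> rat_polys (Suc j)"
  by (auto simp: tvar_def rat_polys_def mpolys_def intro!: imageI split: if_splits)

lemma ring_embedding_poly_tvar:
  assumes "unital_subring S" "S \<subseteq> K k"
  shows "ring_embedding (polys S) (\<lambda>f. poly f (tvar (Suc k)))"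
proof -
  interpret K: subfield_in "K k" by (rule subfield_in_K)
  interpret KP: unital_subring "polys (K k)" by (rule K.unital_subring_polys)
  interpret unital_subring "polys S" using assms unital_subring.unital_subring_polys by blast
  show ?thesis
  proof
    show "inj_on (\<lambda>f. poly f (tvar (Suc k))) (polys S)"
    proof (rule inj_onI)
      fix f g assume "f \<in> polys S" "g \<in> polys S" and eq: "poly f (tvar (Suc k)) = poly g (tvar (Suc k))"
      then have "f - g \<in> polys (K k)" using assms by (auto simp: polys_def intro!: K.diff_closed)
      then have "f - g = 0" by (rule K_expansion_unique) (use eq in simp)
      then show "f = g" by simp
    qed
  qed auto
qed

lemma rat_polys_Suc: "rat_polys (Suc k) = (\<lambda>f. poly f (tvar (Suc k))) ` polys (rat_polys k)"
proof -
  interpret M: unital_subring "rat_polys k" by (rule unital_subring_rat_polys)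
  interpret S: unital_subring "rat_polys (Suc k)" by (rule unital_subring_rat_polys)
  interpret E: ring_embedding "polys (rat_polys k)" "\<lambda>f. poly f (tvar (Suc k))"
    by (rule ring_embedding_poly_tvar) (fact unital_subring_rat_polys rat_polys_subset_K)+
  interpret I: unital_subring "(\<lambda>f. poly f (tvar (Suc k))) ` polys (rat_polys k)"
    by (rule E.unital_subring_image)
  show ?thesis
  proof (intro equalityI subsetI)
    fix x assume "x \<in> rat_polys (Suc k)"
    then obtain p where p: "p \<in> mpolys (Suc k)" "x = of_mpoly p" unfolding rat_polys_def by blast
    have "of_mpoly (Poly_Mapping.single m (Poly_Mapping.lookup p m)) \<in> (\<lambda>f. poly f (tvar (Suc k))) ` polys (rat_polys k)"
      if m: "m \<in> Poly_Mapping.keys p" for m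
    proof -
      let ?n = "Poly_Mapping.lookup m (Suc k)"
      define m' where "m' = m - Poly_Mapping.single (Suc k) ?n"
      have mm': "m = m' + Poly_Mapping.single (Suc k) ?n"
        by (rule poly_mapping_eqI) (auto simp: m'_def lookup_add lookup_minus lookup_single when_def)
      have "Poly_Mapping.keys m' \<subseteq> {1..k}"
      proof
        fix i assume i: "i \<in> Poly_Mapping.keys m'"
        then have "i \<in> Poly_Mapping.keys m" "i \<noteq> Suc k"
          by (auto simp: m'_def in_keys_iff lookup_minus lookup_single when_def split: if_splits)
        moreover have "Poly_Mapping.keys m \<subseteq> {1..Suc k}" using p(1) m by (simp add: mpolys_def)
        ultimately show "i \<in> {1..k}" by auto
      qed
      then have "Poly_Mapping.single m' (Poly_Mapping.lookup p m) \<in> mpolys k" by (simp add: mpolys_def)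
      then have "monom (of_mpoly (Poly_Mapping.single m' (Poly_Mapping.lookup p m))) ?n \<in> polys (rat_polys k)"
        by (intro M.monom_polys) (simp add: rat_polys_def)
      moreover have "Poly_Mapping.single m (Poly_Mapping.lookup p m) =
          Poly_Mapping.single m' (Poly_Mapping.lookup p m) * Poly_Mapping.single (Poly_Mapping.single (Suc k) ?n) 1"
        by (subst mm') (simp add: mult_single)
      then have "of_mpoly (Poly_Mapping.single m (Poly_Mapping.lookup p m)) =
          poly (monom (of_mpoly (Poly_Mapping.single m' (Poly_Mapping.lookup p m))) ?n) (tvar (Suc k))"
        by (simp only: of_mpoly_mult poly_monom tvar_power)
      ultimately show ?thesis by (metis image_eqI)
    qed
    then show "x \<in> (\<lambda>f. poly f (tvar (Suc k))) ` polys (rat_polys k)"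
      unfolding p(2) by (subst mpoly_eq_sum_single[of p]) (auto simp: of_mpoly_sum intro!: I.sum_closed)
  next
    fix x assume "x \<in> (\<lambda>f. poly f (tvar (Suc k))) ` polys (rat_polys k)"
    then obtain f where f: "f \<in> polys (rat_polys k)" "x = poly f (tvar (Suc k))" by blast
    then have "coeff f i \<in> rat_polys (Suc k)" for i
      using mpolys_mono[of k] unfolding polys_def rat_polys_def by blast
    then show "x \<in> rat_polys (Suc k)"
      using tvar_in_rat_polys unfolding f(2) poly_altdef by (intro S.sum_closed S.mult_closed S.power_closed)
  qed
qed

theorem ufd_in_rat_polys: "\<exists>N. ufd_in (rat_polys k) N"
proof (induction k)
  case 0
  show ?case using subfield_in.ufd_in_subfield[OF subfield_in_rat_polys_0] by blast
next
  case (Suc k)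
  then obtain N where "ufd_in (rat_polys k) N" by blast
  then have "ufd_in (polys (rat_polys k)) (\<lambda>f. degree f + N (lead_coeff f))" by (rule ufd_in.ufd_in_polys)
  moreover have "ring_embedding (polys (rat_polys k)) (\<lambda>f. poly f (tvar (Suc k)))"
    by (rule ring_embedding_poly_tvar) (fact unital_subring_rat_polys rat_polys_subset_K)+
  ultimately show ?case unfolding rat_polys_Suc using ring_embedding.ufd_in_image by blast
qed


section \<open>Linear systems over a subfield\<close>

context subfield_in
begin

text \<open>
  Gaussian elimination: a pivot in one equation eliminates one unknown together with that equation.
\<close>

lemma homogeneous_system_nontrivial:
  fixes M :: "'i \<Rightarrow> 'j \<Rightarrow> 'a"
  assumes "finite I" "finite J" "card I < card J" "\<And>i j. i \<in> I \<Longrightarrow> j \<in> J \<Longrightarrow> M i j \<in> S"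
  shows "\<exists>c. (\<forall>j\<in>J. c j \<in> S) \<and> (\<exists>j\<in>J. c j \<noteq> 0) \<and> (\<forall>i\<in>I. (\<Sum>j\<in>J. c j * M i j) = 0)"
  using assms
proof (induction I arbitrary: J M rule: finite_induct)
  case empty
  then show ?case
    using one_closed by (intro exI[of _ "\<lambda>_. 1"]) (auto simp: card_gt_0_iff)
next
  case (insert i0 I)
  show ?case
  proof (cases "\<forall>j\<in>J. M i0 j = 0")
    case True
    have "\<exists>c. (\<forall>j\<in>J. c j \<in> S) \<and> (\<exists>j\<in>J. c j \<noteq> 0) \<and> (\<forall>i\<in>I. (\<Sum>j\<in>J. c j * M i j) = 0)"
      using insert.prems insert.hyps by (intro insert.IH) auto
    then show ?thesis using True by auto
  next
    case False
    then obtain j0 where j0: "j0 \<in> J" "M i0 j0 \<noteq> 0" by blast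
    let ?J = "J - {j0}"
    define M' where "M' i j = M i j - M i j0 * M i0 j / M i0 j0" for i j
    have "\<exists>c. (\<forall>j\<in>?J. c j \<in> S) \<and> (\<exists>j\<in>?J. c j \<noteq> 0) \<and> (\<forall>i\<in>I. (\<Sum>j\<in>?J. c j * M' i j) = 0)"
      using insert.prems insert.hyps j0 unfolding M'_def
      by (intro insert.IH) (auto intro!: diff_closed divide_closed mult_closed)
    then obtain c where c: "\<forall>j\<in>?J. c j \<in> S" "\<exists>j\<in>?J. c j \<noteq> 0"
      "\<And>i. i \<in> I \<Longrightarrow> (\<Sum>j\<in>?J. c j * M' i j) = 0" by blast
    define s where "s = (\<Sum>j\<in>?J. c j * M i0 j)"
    define c' where "c' = c(j0 := - s / M i0 j0)"
    have sum_c': "(\<Sum>j\<in>J. c' j * M i j) = (\<Sum>j\<in>?J. c j * M i j) - s / M i0 j0 * M i j0" for i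
    proof -
      have "(\<Sum>j\<in>J. c' j * M i j) = c' j0 * M i j0 + (\<Sum>j\<in>?J. c' j * M i j)"
        using insert.prems(1) j0 by (simp add: sum.remove)
      also have "(\<Sum>j\<in>?J. c' j * M i j) = (\<Sum>j\<in>?J. c j * M i j)"
        by (intro sum.cong) (auto simp: c'_def)
      finally show ?thesis by (simp add: c'_def)
    qed
    have "(\<Sum>j\<in>J. c' j * M i j) = 0" if "i \<in> insert i0 I" for i
    proof (cases "i = i0")
      case True
      then show ?thesis using j0 unfolding sum_c' by (simp add: s_def)
    next
      case False
      then have "0 = (\<Sum>j\<in>?J. c j * M' i j)" using c(3) that by simp
      also have "\<dots> = (\<Sum>j\<in>?J. c j * M i j) - s / M i0 j0 * M i j0"
        unfolding M'_def s_def
        by (simp add: right_diff_distrib sum_subtractf sum_divide_distrib sum_distrib_right sum_distrib_left mult_ac)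
      finally show ?thesis unfolding sum_c' by simp
    qed
    moreover have "s \<in> S" unfolding s_def using c(1) insert.prems by (intro sum_closed mult_closed) auto
    then have "\<forall>j\<in>J. c' j \<in> S"
      using c(1) j0 insert.prems(3) unfolding c'_def by (auto intro!: divide_closed uminus_closed)
    moreover have "\<exists>j\<in>J. c' j \<noteq> 0" using c(2) unfolding c'_def by auto
    ultimately show ?thesis by blast
  qed
qed

text \<open>
  A congruence modulo \<open>m\<close> between combinations of polynomials amounts to \<open>degree m\<close> linear
  equations for the coefficients of the combination.
\<close>

lemma simultaneous_congruences:
  fixes w :: "'l \<Rightarrow> 'j \<Rightarrow> 'a poly"
  assumes L: "finite L" and J: "finite J" "(\<Sum>l\<in>L. degree (m l)) < card J"
    and m: "\<And>l. l \<in> L \<Longrightarrow> m l \<in> polys S \<and> m l \<noteq> 0"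
    and w: "\<And>l j. l \<in> L \<Longrightarrow> j \<in> J \<Longrightarrow> w l j \<in> polys S"
  shows "\<exists>c. (\<forall>j\<in>J. c j \<in> S) \<and> (\<exists>j\<in>J. c j \<noteq> 0) \<and>
    (\<forall>l\<in>L. dvd_in (polys S) (m l) (\<Sum>j\<in>J. smult (c j) (w l j)))"
proof -
  interpret P: euclidean_in "polys S" degree by (rule euclidean_in_polys)
  let ?D = "\<lambda>l j qr. fst qr \<in> polys S \<and> snd qr \<in> polys S \<and>
      w l j = fst qr * m l + snd qr \<and> (snd qr = 0 \<or> degree (snd qr) < degree (m l))"
  define q where "q l j = fst (SOME qr. ?D l j qr)" for l j
  define r where "r l j = snd (SOME qr. ?D l j qr)" for l j
  have qr: "q l j \<in> polys S \<and> r l j \<in> polys S \<and>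
      w l j = q l j * m l + r l j \<and> (r l j = 0 \<or> degree (r l j) < degree (m l))"
    if "l \<in> L" "j \<in> J" for l j
  proof -
    have "\<exists>qr. ?D l j qr" using P.division[OF w[OF that]] m[OF that(1)] by fastforce
    then show ?thesis unfolding q_def r_def by (rule someI_ex)
  qed
  let ?I = "SIGMA l:L. {..<degree (m l)}"
  have "\<exists>c. (\<forall>j\<in>J. c j \<in> S) \<and> (\<exists>j\<in>J. c j \<noteq> 0) \<and>
      (\<forall>i\<in>?I. (\<Sum>j\<in>J. c j * coeff (r (fst i) j) (snd i)) = 0)"
    using L J qr by (intro homogeneous_system_nontrivial) (auto simp: card_SigmaI coeff_polys)
  then obtain c where c: "\<forall>j\<in>J. c j \<in> S" "\<exists>j\<in>J. c j \<noteq> 0"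
    and system: "\<forall>i\<in>?I. (\<Sum>j\<in>J. c j * coeff (r (fst i) j) (snd i)) = 0"
    by (elim exE conjE) (rule that)
  have zero: "(\<Sum>j\<in>J. c j * coeff (r l j) i) = 0" if "l \<in> L" "i < degree (m l)" for l i
    using bspec[OF system, of "(l, i)"] that by simp
  have "dvd_in (polys S) (m l) (\<Sum>j\<in>J. smult (c j) (w l j))" if l: "l \<in> L" for l
  proof -
    have "(\<Sum>j\<in>J. smult (c j) (r l j)) = 0"
    proof (rule poly_eqI)
      fix i
      have "(\<Sum>j\<in>J. c j * coeff (r l j) i) = 0"
      proof (cases "i < degree (m l)")
        case False
        then have "coeff (r l j) i = 0" if "j \<in> J" for j
          using qr[OF l that] by (cases "r l j = 0") (auto intro!: coeff_eq_0)
        then show ?thesis by simp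
      qed (rule zero[OF l])
      then show "coeff (\<Sum>j\<in>J. smult (c j) (r l j)) i = coeff 0 i" by (simp add: coeff_sum)
    qed
    moreover have "(\<Sum>j\<in>J. smult (c j) (w l j)) =
        m l * (\<Sum>j\<in>J. smult (c j) (q l j)) + (\<Sum>j\<in>J. smult (c j) (r l j))"
      using qr[OF l] by (simp add: smult_add_right sum.distrib sum_distrib_left mult.commute)
    moreover have "(\<Sum>j\<in>J. smult (c j) (q l j)) \<in> polys S"
      using c(1) qr[OF l] by (intro P.sum_closed smult_polys) auto
    ultimately show ?thesis using P.dvd_in_triv by simp
  qed
  then show ?thesis using c by blast
qed

end


section \<open>Conics over Euclidean rings\<close>

context euclidean_in
begin

lemma coprime_bezout:
  assumes "x \<in> S" "x \<noteq> 0" "y \<in> S" and coprime: "\<And>p. prime_in S p \<Longrightarrow> dvd_in S p x \<Longrightarrow> \<not> dvd_in S p y"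
  shows "\<exists>u\<in>S. \<exists>v\<in>S. u * x + v * y = 1"
proof -
  obtain u v where uv: "u \<in> S" "v \<in> S" "dvd_in S (u * x + v * y) x" "dvd_in S (u * x + v * y) y"
    using bezout assms by blast
  let ?g = "u * x + v * y"
  have g: "?g \<in> S" using uv assms by (intro closed)
  have "?g \<noteq> 0" using uv(3) assms(2) unfolding dvd_in_def by auto
  have "unit_in S ?g"
  proof (rule ccontr)
    assume "\<not> unit_in S ?g"
    then obtain p where "prime_in S p" "dvd_in S p ?g" using prime_divisor g \<open>?g \<noteq> 0\<close> by blast
    then show False using coprime uv dvd_in_trans by blast
  qed
  then obtain w where w: "w \<in> S" "1 = ?g * w" unfolding unit_in_def dvd_in_def by blast
  show ?thesis
    by (intro bexI[of _ "w * u"] bexI[of _ "w * v"]) (use w uv in \<open>auto intro: closed simp: algebra_simps\<close>)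
qed

lemma conic_value_dvd:
  assumes S: "a \<in> S" "b \<in> S" "c \<in> S" "r \<in> S" "x \<in> S" "y \<in> S" "z \<in> S"
    and r: "dvd_in S a (b * r\<^sup>2 + c)" and yz: "dvd_in S a (y - r * z)"
  shows "dvd_in S a (a * x\<^sup>2 + b * y\<^sup>2 + c * z\<^sup>2)"
proof -
  have "a * x\<^sup>2 + b * y\<^sup>2 + c * z\<^sup>2 = a * x\<^sup>2 + (y - r * z) * (b * (y + r * z)) + (b * r\<^sup>2 + c) * z\<^sup>2"
    by (simp add: algebra_simps power2_eq_square)
  also have "dvd_in S a \<dots>"
    using S by (intro dvd_in_add dvd_in_triv dvd_in_mult[OF yz] dvd_in_mult[OF r] closed)
  finally show ?thesis .
qed

text \<open>
  Modulo \<open>a\<close> the value is \<open>(b r\<^sup>2 + c) z\<^sup>2\<close>, which vanishes, and similarly for \<open>b\<close> and \<open>c\<close>.  A common prime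
  divisor of two of the coefficients would have its square divide \<open>a b c\<close>; so they are coprime, and
  the three divisibilities combine.
\<close>

lemma squarefree_conic_value_dvd:
  assumes S: "a \<in> S" "b \<in> S" "c \<in> S" "x \<in> S" "y \<in> S" "z \<in> S" and abc: "a * b * c \<noteq> 0"
    and sqfree: "\<And>p. prime_in S p \<Longrightarrow> \<not> dvd_in S (p\<^sup>2) (a * b * c)"
    and r: "r \<in> S" "dvd_in S a (b * r\<^sup>2 + c)" "dvd_in S a (y - r * z)"
    and s: "s \<in> S" "dvd_in S b (c * s\<^sup>2 + a)" "dvd_in S b (z - s * x)"
    and t: "t \<in> S" "dvd_in S c (a * t\<^sup>2 + b)" "dvd_in S c (x - t * y)"
  shows "dvd_in S (a * b * c) (a * x\<^sup>2 + b * y\<^sup>2 + c * z\<^sup>2)" (is "dvd_in S _ ?V")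
proof -
  have sq: "dvd_in S (p\<^sup>2) (u * v * w)"
    if "dvd_in S p u" "dvd_in S p v" "w \<in> S" for p u v w
    unfolding power2_eq_square using that by (intro dvd_in_mult dvd_in_mult_mono)
  have a: "dvd_in S a ?V" 
    by (rule conic_value_dvd[OF S(1-3) r(1) S(4-6) r(2,3)])
  have "dvd_in S b (b * y\<^sup>2 + c * z\<^sup>2 + a * x\<^sup>2)"
    by (rule conic_value_dvd[OF S(2,3,1) s(1) S(5,6,4) s(2,3)])
  then have b: "dvd_in S b ?V" by (simp add: ac_simps)
  have "dvd_in S c (c * z\<^sup>2 + a * x\<^sup>2 + b * y\<^sup>2)" 
    by (rule conic_value_dvd[OF S(3,1,2) t(1) S(6,4,5) t(2,3)])
  then have c: "dvd_in S c ?V" by (simp add: ac_simps)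
  have "\<not> dvd_in S p b" if "prime_in S p" "dvd_in S p a" for p
    using sq[OF that(2) _ S(3)] sqfree[OF that(1)] by blast
  then obtain u v where "u \<in> S" "v \<in> S" "u * a + v * b = 1"
    using coprime_bezout[OF S(1) _ S(2)] abc by auto
  then have ab: "dvd_in S (a * b) ?V" using coprime_mult_dvd S a b by blast
  have "\<not> dvd_in S p c" if "prime_in S p" "dvd_in S p (a * b)" for p
    using sq[OF that(2) _ one_closed] sqfree[OF that(1)] by auto
  then obtain u v where "u \<in> S" "v \<in> S" "u * (a * b) + v * c = 1"
    using coprime_bezout[OF mult_closed[OF S(1,2)] _ S(3)] abc by auto
  then show ?thesis using coprime_mult_dvd[OF _ _ mult_closed[OF S(1,2)] S(3)] ab c by blast
qed

end


section \<open>Conics over polynomial rings\<close>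

lemma coeff_mult_of_bounds:
  fixes f g :: "'a::comm_semiring_0 poly"
  assumes "degree f \<le> m" "degree g \<le> n"
  shows "coeff (f * g) (m + n) = coeff f m * coeff g n"
proof -
  have "coeff (f * g) (m + n) = (\<Sum>i\<le>m + n. coeff f i * coeff g (m + n - i))" by (rule coeff_mult)
  also have "\<dots> = (\<Sum>i\<le>m + n. if i = m then coeff f m * coeff g n else 0)"
  proof (intro sum.cong refl)
    fix i
    have "coeff f i * coeff g (m + n - i) = 0" if "i < m"
      using assms that by (simp add: coeff_eq_0)
    moreover have "coeff f i * coeff g (m + n - i) = 0" if "i > m"
      using assms that by (simp add: coeff_eq_0)
    ultimately show "coeff f i * coeff g (m + n - i) = (if i = m then coeff f m * coeff g n else 0)"
      by (cases i m rule: linorder_cases) auto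
  qed
  finally show ?thesis by simp
qed

lemma coeff_mult_square:
  fixes f g :: "'a::comm_semiring_1 poly"
  assumes "degree f \<le> m"
  shows "coeff (g * f\<^sup>2) (degree g + 2 * m) = lead_coeff g * (coeff f m)\<^sup>2"
    and "degree (g * f\<^sup>2) \<le> degree g + 2 * m"
proof -
  have deg: "degree (f\<^sup>2) \<le> 2 * m"
    using degree_mult_le[of f f] assms by (simp add: power2_eq_square)
  have "coeff (f\<^sup>2) (2 * m) = (coeff f m)\<^sup>2"
    using coeff_mult_of_bounds[OF assms assms] by (simp add: power2_eq_square mult_2)
  then show "coeff (g * f\<^sup>2) (degree g + 2 * m) = lead_coeff g * (coeff f m)\<^sup>2"
    using coeff_mult_of_bounds[OF order_refl deg] by simp
  show "degree (g * f\<^sup>2) \<le> degree g + 2 * m"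
    using degree_mult_le[of g "f\<^sup>2"] deg by simp
qed

text \<open>
  When the degrees of \<open>a\<close>, \<open>b\<close>, \<open>c\<close> have the same parity, the three terms of a solution can be compared
  in a single degree \<open>n\<close>, the largest degree that occurs.  Multiplying the solution by a power of the
  variable makes \<open>n\<close> large enough for a zero coordinate to have a coefficient in that degree, too.
\<close>

lemma (in unital_subring) leading_form_soluble:
  assumes abc: "a \<noteq> 0" "b \<noteq> 0" "c \<noteq> 0"
    and parity: "degree a mod 2 = degree b mod 2" "degree b mod 2 = degree c mod 2"
    and "X \<in> polys S" "Y \<in> polys S" "Z \<in> polys S" "\<not> (X = 0 \<and> Y = 0 \<and> Z = 0)"
    and "a * X\<^sup>2 + b * Y\<^sup>2 + c * Z\<^sup>2 = 0"
  shows "\<exists>x\<in>S. \<exists>y\<in>S. \<exists>z\<in>S. \<not> (x = 0 \<and> y = 0 \<and> z = 0) \<and>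
    lead_coeff a * x\<^sup>2 + lead_coeff b * y\<^sup>2 + lead_coeff c * z\<^sup>2 = 0"
proof -
  interpret P: unital_subring "polys S" by (rule unital_subring_polys)
  define T where "T = monom (1::'a) (degree a + degree b + degree c)"
  have T: "T \<in> polys S" "T \<noteq> 0" "degree T = degree a + degree b + degree c"
    using one_closed by (auto simp: T_def degree_monom_eq intro: monom_polys)
  define e where "e g f = (if f = 0 then 0 else degree g + 2 * degree (T * f))" for g f :: "'a poly"
  define n where "n = Max {e a X, e b Y, e c Z}"
  have e_le: "e a X \<le> n" "e b Y \<le> n" "e c Z \<le> n" unfolding n_def by auto
  have "n \<in> {e a X, e b Y, e c Z}" unfolding n_def by (rule Max_in) auto
  then obtain g f where gf: "(g, f) \<in> {(a, X), (b, Y), (c, Z)}" "n = e g f" "f \<noteq> 0"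
  proof (cases "n = 0")
    case True
    then show ?thesis
      using that[of a X] that[of b Y] that[of c Z] assms(9) e_le by auto
  next
    case False
    then show ?thesis
      using that[of a X] that[of b Y] that[of c Z] \<open>n \<in> _\<close> unfolding e_def by (auto split: if_splits)
  qed
  have "degree (T * f) \<ge> degree a + degree b + degree c"
    using T gf(3) by (simp add: degree_mult_eq)
  then have n_ge: "degree a \<le> n" "degree b \<le> n" "degree c \<le> n"
    using gf(2,3) by (auto simp: e_def)
  have n_parity: "n mod 2 = degree a mod 2" "n mod 2 = degree b mod 2" "n mod 2 = degree c mod 2"
    using gf parity unfolding e_def by auto
  define \<mu> where "\<mu> g = (n - degree g) div 2" for g :: "'a poly"
  have "degree g + 2 * \<mu> g = n" if "degree g \<le> n" "n mod 2 = degree g mod 2" for g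
    using that unfolding \<mu>_def by (simp add: mod_eq_dvd_iff_nat)
  then have \<mu>: "degree a + 2 * \<mu> a = n" "degree b + 2 * \<mu> b = n" "degree c + 2 * \<mu> c = n"
    using n_ge n_parity by blast+
  have bound: "degree (T * f') \<le> \<mu> g'" if "e g' f' \<le> n" "degree g' + 2 * \<mu> g' = n" for f' g'
    using that unfolding e_def by (auto split: if_splits)
  let ?x = "coeff (T * X) (\<mu> a)" and ?y = "coeff (T * Y) (\<mu> b)" and ?z = "coeff (T * Z) (\<mu> c)"
  have "a * (T * X)\<^sup>2 + b * (T * Y)\<^sup>2 + c * (T * Z)\<^sup>2 = T\<^sup>2 * (a * X\<^sup>2 + b * Y\<^sup>2 + c * Z\<^sup>2)"
    by (simp add: algebra_simps power_mult_distrib)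
  then have "coeff (a * (T * X)\<^sup>2 + b * (T * Y)\<^sup>2 + c * (T * Z)\<^sup>2) n = 0" using assms(10) by simp
  then have "lead_coeff a * ?x\<^sup>2 + lead_coeff b * ?y\<^sup>2 + lead_coeff c * ?z\<^sup>2 = 0"
    using coeff_mult_square(1)[OF bound[OF e_le(1) \<mu>(1)], of a]
      coeff_mult_square(1)[OF bound[OF e_le(2) \<mu>(2)], of b]
      coeff_mult_square(1)[OF bound[OF e_le(3) \<mu>(3)], of c] \<mu> by simp
  moreover have "?x \<in> S" "?y \<in> S" "?z \<in> S"
    using T assms(6-8) by (auto intro!: coeff_polys P.mult_closed)
  moreover have "\<not> (?x = 0 \<and> ?y = 0 \<and> ?z = 0)"
  proof -
    have "degree g + 2 * \<mu> g = n" using gf(1) \<mu> by auto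
    then have "\<mu> g = degree (T * f)" using gf(2,3) by (auto simp: e_def)
    then have "coeff (T * f) (\<mu> g) \<noteq> 0" using gf(3) T(2) by simp
    then show ?thesis using gf(1) by auto
  qed
  ultimately show ?thesis by blast
qed

context subfield_in
begin

text \<open>
  For each \<open>j\<close> the polynomials \<open>vx j\<close>, \<open>vy j\<close>, \<open>vz j\<close> are the coordinates of one vector.  A family with more
  vectors than the degree of \<open>a b c\<close> has a non-trivial combination that satisfies the three congruences.
\<close>

lemma conic_ansatz:
  assumes abc: "a \<in> polys S" "b \<in> polys S" "c \<in> polys S" "a * b * c \<noteq> 0"
    and sqfree: "\<And>p. prime_in (polys S) p \<Longrightarrow> \<not> dvd_in (polys S) (p\<^sup>2) (a * b * c)"
    and r: "r \<in> polys S" "dvd_in (polys S) a (b * r\<^sup>2 + c)"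
    and s: "s \<in> polys S" "dvd_in (polys S) b (c * s\<^sup>2 + a)"
    and t: "t \<in> polys S" "dvd_in (polys S) c (a * t\<^sup>2 + b)"
    and J: "finite J" "degree a + degree b + degree c < card J"
    and v: "\<And>j. j \<in> J \<Longrightarrow> vx j \<in> polys S \<and> vy j \<in> polys S \<and> vz j \<in> polys S"
  shows "\<exists>k. (\<forall>j\<in>J. k j \<in> S) \<and> (\<exists>j\<in>J. k j \<noteq> 0) \<and> dvd_in (polys S) (a * b * c)
    (a * (\<Sum>j\<in>J. smult (k j) (vx j))\<^sup>2 + b * (\<Sum>j\<in>J. smult (k j) (vy j))\<^sup>2
      + c * (\<Sum>j\<in>J. smult (k j) (vz j))\<^sup>2)"
proof -
  interpret P: euclidean_in "polys S" degree by (rule euclidean_in_polys)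
  define m where "m l = (if l = 0 then a else if l = 1 then b else c)" for l :: nat
  define w where "w l j = (if l = 0 then vy j - r * vz j else if l = 1 then vz j - s * vx j
    else vx j - t * vy j)" for l :: nat and j
  have "\<exists>k. (\<forall>j\<in>J. k j \<in> S) \<and> (\<exists>j\<in>J. k j \<noteq> 0) \<and>
      (\<forall>l\<in>{0,1,2}. dvd_in (polys S) (m l) (\<Sum>j\<in>J. smult (k j) (w l j)))"
    using abc r s t J v unfolding m_def w_def
    by (intro simultaneous_congruences) (auto intro!: P.diff_closed P.mult_closed)
  then obtain k where k: "\<forall>j\<in>J. k j \<in> S" "\<exists>j\<in>J. k j \<noteq> 0"
    and dvd: "\<And>l. l \<in> {0,1,2} \<Longrightarrow> dvd_in (polys S) (m l) (\<Sum>j\<in>J. smult (k j) (w l j))"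
    by blast
  let ?X = "\<Sum>j\<in>J. smult (k j) (vx j)" and ?Y = "\<Sum>j\<in>J. smult (k j) (vy j)"
    and ?Z = "\<Sum>j\<in>J. smult (k j) (vz j)"
  have cong: "dvd_in (polys S) a (?Y - r * ?Z)" "dvd_in (polys S) b (?Z - s * ?X)"
    "dvd_in (polys S) c (?X - t * ?Y)"
    using dvd[of 0] dvd[of 1] dvd[of 2]
    by (simp_all add: m_def w_def smult_diff_right sum_subtractf sum_distrib_left)
  have "?X \<in> polys S" "?Y \<in> polys S" "?Z \<in> polys S"
    using k(1) v by (auto intro!: P.sum_closed smult_polys)
  then have "dvd_in (polys S) (a * b * c) (a * ?X\<^sup>2 + b * ?Y\<^sup>2 + c * ?Z\<^sup>2)"
    by (rule P.squarefree_conic_value_dvd[OF abc(1-3) _ _ _ abc(4) sqfree r cong(1) s cong(2) t cong(3)])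
  then show ?thesis using k by blast
qed

lemma low_degree_dvd_imp_0:
  fixes V :: "'a poly"
  assumes "dvd_in (polys S) (a * b * c) V" "a * b * c \<noteq> 0"
    and "\<And>i. i \<ge> degree a + degree b + degree c \<Longrightarrow> coeff V i = 0"
  shows "V = 0"
proof (rule ccontr)
  assume V: "V \<noteq> 0"
  obtain W where W: "V = a * b * c * W" using assms(1) unfolding dvd_in_def by blast
  have "degree V = degree a + degree b + degree c + degree W"
    using V assms(2) unfolding W by (simp add: degree_mult_eq)
  then have "lead_coeff V = 0" using assms(3) by simp
  then show False using V by simp
qed

text \<open>
  The index \<open>(l, i)\<close> belongs to the vector with the monomial of degree \<open>i\<close> in coordinate \<open>l\<close> and zeros
  elsewhere; \<open>basis_vector l j\<close> is coordinate \<open>l\<close> of the vector with index \<open>j\<close>.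
\<close>

definition basis_vector :: "nat \<Rightarrow> nat \<times> nat \<Rightarrow> 'a poly" where
  "basis_vector l j = (if fst j = l then monom 1 (snd j) else 0)"

lemma coeff_sum_basis_vector:
  assumes "finite J"
  shows "coeff (\<Sum>j\<in>J. smult (k j) (basis_vector l j)) i = (if (l, i) \<in> J then k (l, i) else 0)"
proof -
  have "coeff (\<Sum>j\<in>J. smult (k j) (basis_vector l j)) i = (\<Sum>j\<in>J. if j = (l, i) then k j else 0)"
    unfolding coeff_sum by (intro sum.cong) (auto simp: basis_vector_def)
  then show ?thesis using assms by simp
qed

lemma basis_vector_polys: "basis_vector l j \<in> polys S"
  unfolding basis_vector_def using one_closed unital_subring.zero_closed[OF unital_subring_polys]
  by (auto intro: monom_polys)

definition ansatz_indices :: "nat \<Rightarrow> nat \<Rightarrow> nat \<Rightarrow> (nat \<times> nat) set" where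
  "ansatz_indices A B C = {0} \<times> {..<A} \<union> {1} \<times> {..<B} \<union> {2} \<times> {..<C}"

lemma card_ansatz_indices: "card (ansatz_indices A B C) = A + B + C"
  unfolding ansatz_indices_def by (subst card_Un_disjoint; auto)+

lemma finite_ansatz_indices: "finite (ansatz_indices A B C)"
  by (simp add: ansatz_indices_def)

lemma ansatz_indices_iff:
  "(0, i) \<in> ansatz_indices A B C \<longleftrightarrow> i < A" "(1, i) \<in> ansatz_indices A B C \<longleftrightarrow> i < B"
  "(Suc 0, i) \<in> ansatz_indices A B C \<longleftrightarrow> i < B"
  "(2, i) \<in> ansatz_indices A B C \<longleftrightarrow> i < C" "(3, i) \<notin> ansatz_indices A B C"
  by (auto simp: ansatz_indices_def)

lemma ansatz_indices_cases:
  assumes "j \<in> ansatz_indices A B C"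
  obtains i where "j = (0, i)" "i < A" | i where "j = (1, i)" "i < B" | i where "j = (2, i)" "i < C"
  using assms by (auto simp: ansatz_indices_def)

text \<open>
  The first coordinate may have \<open>A\<close> coefficients, where \<open>A\<close> is half of \<open>deg b + deg c\<close>, rounded up, if
  the value of the form is to have lower degree than \<open>a b c\<close>; similarly for the others.  If the degrees
  do not have the same parity, two of the three numbers are rounded up, and there is one coefficient
  more than there are conditions.
\<close>

lemma conic_solution_mixed_parity:
  assumes abc: "a \<in> polys S" "b \<in> polys S" "c \<in> polys S" "a * b * c \<noteq> 0"
    and sqfree: "\<And>p. prime_in (polys S) p \<Longrightarrow> \<not> dvd_in (polys S) (p\<^sup>2) (a * b * c)"
    and r: "r \<in> polys S" "dvd_in (polys S) a (b * r\<^sup>2 + c)"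
    and s: "s \<in> polys S" "dvd_in (polys S) b (c * s\<^sup>2 + a)"
    and t: "t \<in> polys S" "dvd_in (polys S) c (a * t\<^sup>2 + b)"
    and parity: "\<not> (degree a mod 2 = degree b mod 2 \<and> degree b mod 2 = degree c mod 2)"
  shows "\<exists>X\<in>polys S. \<exists>Y\<in>polys S. \<exists>Z\<in>polys S. \<not> (X = 0 \<and> Y = 0 \<and> Z = 0) \<and>
    a * X\<^sup>2 + b * Y\<^sup>2 + c * Z\<^sup>2 = 0"
proof -
  interpret P: unital_subring "polys S" by (rule unital_subring_polys)
  define A where "A = (degree b + degree c + 1) div 2"
  define B where "B = (degree c + degree a + 1) div 2"
  define C where "C = (degree a + degree b + 1) div 2"
  let ?J = "ansatz_indices A B C"
  have card: "degree a + degree b + degree c < card ?J"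
    using parity unfolding card_ansatz_indices A_def B_def C_def
    by (cases "even (degree a)"; cases "even (degree b)"; cases "even (degree c)")
       (auto elim!: evenE oddE simp: mod_2_eq_odd)
  obtain k where k: "\<forall>j\<in>?J. k j \<in> S" "\<exists>j\<in>?J. k j \<noteq> 0"
    and dvd: "dvd_in (polys S) (a * b * c)
      (a * (\<Sum>j\<in>?J. smult (k j) (basis_vector 0 j))\<^sup>2 + b * (\<Sum>j\<in>?J. smult (k j) (basis_vector 1 j))\<^sup>2
      + c * (\<Sum>j\<in>?J. smult (k j) (basis_vector 2 j))\<^sup>2)"
    by (rule exE[OF conic_ansatz[OF abc sqfree r s t finite_ansatz_indices card, of "basis_vector 0"
            "basis_vector 1" "basis_vector 2"]])
       (assumption | simp add: basis_vector_polys | elim conjE, rule that)+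
  define X where "X l = (\<Sum>j\<in>?J. smult (k j) (basis_vector l j))" for l
  have X: "X l \<in> polys S" for l
    unfolding X_def using k(1) by (intro P.sum_closed smult_polys basis_vector_polys) auto
  have coeff_X: "coeff (X 0) i = (if i < A then k (0, i) else 0)"
    "coeff (X 1) i = (if i < B then k (1, i) else 0)"
    "coeff (X 2) i = (if i < C then k (2, i) else 0)" for i
    unfolding X_def coeff_sum_basis_vector[OF finite_ansatz_indices]
    by (simp_all add: ansatz_indices_iff)
  have "\<not> (X 0 = 0 \<and> X 1 = 0 \<and> X 2 = 0)"
  proof
    assume zero: "X 0 = 0 \<and> X 1 = 0 \<and> X 2 = 0"
    obtain j where "j \<in> ?J" "k j \<noteq> 0" using k(2) by blast
    then show False
    proof (cases rule: ansatz_indices_cases)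
      case (1 i)
      then show ?thesis using zero coeff_X(1)[of i] \<open>k j \<noteq> 0\<close> by simp
    next
      case (2 i)
      then show ?thesis using zero coeff_X(2)[of i] \<open>k j \<noteq> 0\<close> by simp
    next
      case (3 i)
      then show ?thesis using zero coeff_X(3)[of i] \<open>k j \<noteq> 0\<close> by simp
    qed
  qed
  moreover have small: "coeff (g * f\<^sup>2) i = 0"
    if "\<And>i. i \<ge> M \<Longrightarrow> coeff f i = 0" "degree g + 2 * M \<le> D + 1" "i \<ge> D" for f g :: "'a poly" and M D i
  proof (cases "f = 0")
    case False
    then have "degree f < M" using that(1) leading_coeff_0_iff not_le by blast
    then have "degree g + 2 * degree f < i" using that by linarith
    then show ?thesis using coeff_mult_square(2)[of f "degree f" g] by (intro coeff_eq_0) simp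
  qed simp
  have "a * (X 0)\<^sup>2 + b * (X 1)\<^sup>2 + c * (X 2)\<^sup>2 = 0"
  proof (rule low_degree_dvd_imp_0)
    show "dvd_in (polys S) (a * b * c) (a * (X 0)\<^sup>2 + b * (X 1)\<^sup>2 + c * (X 2)\<^sup>2)"
      using dvd unfolding X_def .
    fix i assume i: "degree a + degree b + degree c \<le> i"
    have "coeff (a * (X 0)\<^sup>2) i = 0" by (rule small[of A _ _ "degree a + degree b + degree c" i]) (auto simp: coeff_X A_def i)
    moreover have "coeff (b * (X 1)\<^sup>2) i = 0" using coeff_X(2) by (intro small[of B _ _ "degree a + degree b + degree c" i]) (auto simp: B_def i)
    moreover have "coeff (c * (X 2)\<^sup>2) i = 0" by (rule small[of C _ _ "degree a + degree b + degree c" i]) (auto simp: coeff_X C_def i)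
    ultimately show "coeff (a * (X 0)\<^sup>2 + b * (X 1)\<^sup>2 + c * (X 2)\<^sup>2) i = 0" by simp
  qed (fact abc)
  ultimately show ?thesis using X by blast
qed

text \<open>
  If the degrees have the same parity, nothing is rounded, and one coefficient is missing.  It is the
  multiplier of a solution of the equation of leading coefficients, which may be placed in the next
  higher degrees because it contributes nothing to the value in the degree of \<open>a b c\<close>.
\<close>

lemma conic_solution_equal_parity:
  assumes abc: "a \<in> polys S" "b \<in> polys S" "c \<in> polys S" "a * b * c \<noteq> 0"
    and sqfree: "\<And>p. prime_in (polys S) p \<Longrightarrow> \<not> dvd_in (polys S) (p\<^sup>2) (a * b * c)"
    and r: "r \<in> polys S" "dvd_in (polys S) a (b * r\<^sup>2 + c)"
    and s: "s \<in> polys S" "dvd_in (polys S) b (c * s\<^sup>2 + a)"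
    and t: "t \<in> polys S" "dvd_in (polys S) c (a * t\<^sup>2 + b)"
    and parity: "degree a mod 2 = degree b mod 2" "degree b mod 2 = degree c mod 2"
    and xyz: "x \<in> S" "y \<in> S" "z \<in> S" "\<not> (x = 0 \<and> y = 0 \<and> z = 0)"
      "lead_coeff a * x\<^sup>2 + lead_coeff b * y\<^sup>2 + lead_coeff c * z\<^sup>2 = 0"
  shows "\<exists>X\<in>polys S. \<exists>Y\<in>polys S. \<exists>Z\<in>polys S. \<not> (X = 0 \<and> Y = 0 \<and> Z = 0) \<and>
    a * X\<^sup>2 + b * Y\<^sup>2 + c * Z\<^sup>2 = 0"
proof -
  interpret P: unital_subring "polys S" by (rule unital_subring_polys)
  define A where "A = (degree b + degree c) div 2"
  define B where "B = (degree c + degree a) div 2"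
  define C where "C = (degree a + degree b) div 2"
  have "even (degree a) = even (degree b)" "even (degree b) = even (degree c)"
    using parity by (simp_all only: even_iff_mod_2_eq_zero)
  then have "even (degree b + degree c)" "even (degree c + degree a)" "even (degree a + degree b)"
    by simp_all
  then have ABC: "degree a + 2 * A = degree a + degree b + degree c"
    "degree b + 2 * B = degree a + degree b + degree c"
    "degree c + 2 * C = degree a + degree b + degree c"
    unfolding A_def B_def C_def by (simp_all only: dvd_mult_div_cancel ac_simps)
  \<comment> \<open>The index \<open>(3, 0)\<close> is not used by any monomial; it stands for the additional vector.\<close>
  let ?J = "ansatz_indices A B C" and ?top = "(3, 0) :: nat \<times> nat"
  have top: "?top \<notin> ?J" by (simp add: ansatz_indices_iff)
  define v where "v l w M j = (if j = ?top then monom w M else basis_vector l j)" for l w M j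
  have v: "w \<in> S \<Longrightarrow> v l w M j \<in> polys S" for l w M j
    unfolding v_def by (auto intro: monom_polys basis_vector_polys)
  have fin: "finite (insert ?top ?J)" by (simp add: finite_ansatz_indices)
  have card: "degree a + degree b + degree c < card (insert ?top ?J)"
    using ABC top by (simp add: card_ansatz_indices finite_ansatz_indices)
  obtain k where k: "\<forall>j\<in>insert ?top ?J. k j \<in> S" "\<exists>j\<in>insert ?top ?J. k j \<noteq> 0"
    and dvd: "dvd_in (polys S) (a * b * c)
      (a * (\<Sum>j\<in>insert ?top ?J. smult (k j) (v 0 x A j))\<^sup>2
      + b * (\<Sum>j\<in>insert ?top ?J. smult (k j) (v 1 y B j))\<^sup>2
      + c * (\<Sum>j\<in>insert ?top ?J. smult (k j) (v 2 z C j))\<^sup>2)"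
    by (rule exE[OF conic_ansatz[OF abc sqfree r s t fin card, of "v 0 x A" "v 1 y B" "v 2 z C"]])
       (assumption | simp add: v xyz | elim conjE, rule that)+
  let ?\<mu> = "k ?top"
  define V where "V l w M = (\<Sum>j\<in>insert ?top ?J. smult (k j) (v l w M j))" for l w M
  have V: "w \<in> S \<Longrightarrow> V l w M \<in> polys S" for l w M
    unfolding V_def using k(1) v by (intro P.sum_closed smult_polys) auto
  have V_eq: "V l w M = smult ?\<mu> (monom w M) + (\<Sum>j\<in>?J. smult (k j) (basis_vector l j))" for l w M
  proof -
    have "(\<Sum>j\<in>?J. smult (k j) (v l w M j)) = (\<Sum>j\<in>?J. smult (k j) (basis_vector l j))"
      using top by (intro sum.cong) (auto simp: v_def)
    then show ?thesis unfolding V_def using top by (simp add: finite_ansatz_indices v_def)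
  qed
  have coeff_V: "coeff (V 0 x A) i = (if i = A then ?\<mu> * x else if i < A then k (0, i) else 0)"
    "coeff (V 1 y B) i = (if i = B then ?\<mu> * y else if i < B then k (1, i) else 0)"
    "coeff (V 2 z C) i = (if i = C then ?\<mu> * z else if i < C then k (2, i) else 0)" for i
    unfolding V_eq coeff_add coeff_sum_basis_vector[OF finite_ansatz_indices]
    by (simp_all add: ansatz_indices_iff)
  have nonzero: "\<not> (V 0 x A = 0 \<and> V 1 y B = 0 \<and> V 2 z C = 0)"
  proof
    assume zero: "V 0 x A = 0 \<and> V 1 y B = 0 \<and> V 2 z C = 0"
    have "?\<mu> * x = 0" "?\<mu> * y = 0" "?\<mu> * z = 0"
      using zero coeff_V(1)[of A] coeff_V(2)[of B] coeff_V(3)[of C] by auto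
    then have "?\<mu> = 0" using xyz(4) by auto
    then obtain j where "j \<in> ?J" "k j \<noteq> 0" using k(2) by blast
    then show False
    proof (cases rule: ansatz_indices_cases)
      case (1 i)
      then show ?thesis using zero coeff_V(1)[of i] \<open>k j \<noteq> 0\<close> by simp
    next
      case (2 i)
      then show ?thesis using zero coeff_V(2)[of i] \<open>k j \<noteq> 0\<close> by simp
    next
      case (3 i)
      then show ?thesis using zero coeff_V(3)[of i] \<open>k j \<noteq> 0\<close> by simp
    qed
  qed
  have deg: "degree (V 0 x A) \<le> A" "degree (V 1 y B) \<le> B" "degree (V 2 z C) \<le> C"
    by (rule degree_le, simp add: coeff_V del: One_nat_def)+
  have "a * (V 0 x A)\<^sup>2 + b * (V 1 y B)\<^sup>2 + c * (V 2 z C)\<^sup>2 = 0" (is "?F = 0")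
  proof (rule low_degree_dvd_imp_0)
    show "dvd_in (polys S) (a * b * c) ?F" using dvd unfolding V_def .
    fix i assume i: "degree a + degree b + degree c \<le> i"
    show "coeff ?F i = 0"
    proof (cases "i = degree a + degree b + degree c")
      case True
      have "coeff ?F i = lead_coeff a * (?\<mu> * x)\<^sup>2 + lead_coeff b * (?\<mu> * y)\<^sup>2 + lead_coeff c * (?\<mu> * z)\<^sup>2"
        using coeff_mult_square(1)[OF deg(1), of a] coeff_mult_square(1)[OF deg(2), of b]
          coeff_mult_square(1)[OF deg(3), of c] coeff_V(1)[of A] coeff_V(2)[of B] coeff_V(3)[of C]
        unfolding True ABC coeff_add by simp
      also have "\<dots> = ?\<mu>\<^sup>2 * (lead_coeff a * x\<^sup>2 + lead_coeff b * y\<^sup>2 + lead_coeff c * z\<^sup>2)"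
        by (simp add: algebra_simps power_mult_distrib)
      finally show ?thesis using xyz(5) by simp
    next
      case False
      then have "degree (a * (V 0 x A)\<^sup>2) < i" "degree (b * (V 1 y B)\<^sup>2) < i" "degree (c * (V 2 z C)\<^sup>2) < i"
        using coeff_mult_square(2)[OF deg(1), of a] coeff_mult_square(2)[OF deg(2), of b]
          coeff_mult_square(2)[OF deg(3), of c] ABC i by linarith+
      then show ?thesis unfolding coeff_add by (simp only: coeff_eq_0 add_0)
    qed
  qed (fact abc)
  then show ?thesis using nonzero V xyz by blast
qed

end

section \<open>Conics over the integers\<close>

lemma dvd_in_UNIV: "dvd_in UNIV x y \<longleftrightarrow> x dvd y"
  by (auto simp: dvd_in_def dvd_def)

lemma euclidean_in_int: "euclidean_in (UNIV :: int set) (\<lambda>n. nat \<bar>n\<bar>)"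
proof
  fix x d :: int assume "d \<noteq> 0"
  then show "\<exists>q\<in>UNIV. \<exists>r\<in>UNIV. x = q * d + r \<and> (r = 0 \<or> nat \<bar>r\<bar> < nat \<bar>d\<bar>)"
    by (intro bexI[of _ "x div d"] bexI[of _ "x mod d"]) (auto simp: abs_mod_less)
next
  fix x y :: int assume "x * y \<noteq> 0"
  then have "\<bar>x\<bar> * 1 \<le> \<bar>x\<bar> * \<bar>y\<bar>" by (intro mult_left_mono) auto
  then show "nat \<bar>x\<bar> \<le> nat \<bar>x * y\<bar>" by (simp add: abs_mult)
qed auto

text \<open>
  The side of the box is chosen so that differences of its points stay strictly below the square root
  of \<open>m\<close>, while the box is still at least that wide.
\<close>

lemma box_side_exists:
  fixes m :: int
  assumes "m > 0"
  shows "\<exists>n>0. m \<le> n\<^sup>2 \<and> (\<forall>x. \<bar>x\<bar> < n \<longrightarrow> x\<^sup>2 < m)"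
proof -
  define n where "n = (LEAST n::nat. m \<le> (int n)\<^sup>2)"
  have "m \<le> (int (nat m))\<^sup>2" using assms by (simp add: power2_eq_square)
  then have n: "m \<le> (int n)\<^sup>2" unfolding n_def by (rule LeastI)
  have "x\<^sup>2 < m" if "\<bar>x\<bar> < int n" for x
  proof -
    have "nat \<bar>x\<bar> < n" using that by simp
    then have "\<not> m \<le> (int (nat \<bar>x\<bar>))\<^sup>2" unfolding n_def by (rule not_less_Least)
    then show ?thesis by simp
  qed
  moreover have "n > 0" using n assms by (cases "n = 0") auto
  ultimately show ?thesis using n by (intro exI[of _ "int n"]) simp
qed

text \<open>
  The congruences cut out a lattice of index at most \<open>\<bar>a b c\<bar>\<close>, and a box with more than that many points
  contains two points in the same class.
\<close>

lemma congruences_pigeonhole: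
  fixes a b c :: int
  assumes "a \<noteq> 0" "b \<noteq> 0" "c \<noteq> 0" "A > 0" "B > 0" "C > 0" and large: "\<bar>a * b * c\<bar> < A * B * C"
  shows "\<exists>x y z. \<not> (x = 0 \<and> y = 0 \<and> z = 0) \<and> \<bar>x\<bar> < A \<and> \<bar>y\<bar> < B \<and> \<bar>z\<bar> < C \<and>
    a dvd y - r * z \<and> b dvd z - s * x \<and> c dvd x - t * y"
proof -
  define f where "f = (\<lambda>(x, y, z). ((y - r * z) mod \<bar>a\<bar>, (z - s * x) mod \<bar>b\<bar>, (x - t * y) mod \<bar>c\<bar>))"
  let ?D = "{0..<A} \<times> {0..<B} \<times> {0..<C}" and ?E = "{0..<\<bar>a\<bar>} \<times> {0..<\<bar>b\<bar>} \<times> {0..<\<bar>c\<bar>}"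
  have "f ` ?D \<subseteq> ?E" using assms by (auto simp: f_def)
  then have "card (f ` ?D) \<le> card ?E" by (rule card_mono[rotated]) simp
  also have "\<dots> = nat \<bar>a * b * c\<bar>"
    by (simp add: card_cartesian_product nat_mult_distrib abs_mult mult.assoc)
  also have "\<dots> < nat (A * B * C)" using large assms by simp
  also have "\<dots> = card ?D"
    using assms by (simp add: card_cartesian_product nat_mult_distrib mult.assoc)
  finally have "\<not> inj_on f ?D" by (rule pigeonhole)
  then obtain x y z x' y' z' where D: "(x, y, z) \<in> ?D" "(x', y', z') \<in> ?D"
    and ne: "(x, y, z) \<noteq> (x', y', z')" and eq: "f (x, y, z) = f (x', y', z')"
    unfolding inj_on_def by (metis prod_cases3)
  have cong: "d dvd u - v" if "u mod \<bar>d\<bar> = v mod \<bar>d\<bar>" for d u v :: int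
    using that by (metis abs_dvd_iff mod_eq_dvd_iff)
  have "a dvd (y - r * z) - (y' - r * z')" "b dvd (z - s * x) - (z' - s * x')"
    "c dvd (x - t * y) - (x' - t * y')"
    using eq by (auto simp: f_def intro!: cong)
  then have "a dvd (y - y') - r * (z - z')" "b dvd (z - z') - s * (x - x')" "c dvd (x - x') - t * (y - y')"
    by (simp_all add: algebra_simps)
  moreover have "\<bar>x - x'\<bar> < A" "\<bar>y - y'\<bar> < B" "\<bar>z - z'\<bar> < C" using D by auto
  moreover have "\<not> (x - x' = 0 \<and> y - y' = 0 \<and> z - z' = 0)" using ne by simp
  ultimately show ?thesis by blast
qed

lemma unit_leading_solution:
  fixes a b c :: int
  assumes "a > 0" "b < 0" "a * b = - 1"
  shows "\<exists>x y z. \<not> (x = 0 \<and> y = 0 \<and> z = 0) \<and> a * x\<^sup>2 + b * y\<^sup>2 + c * z\<^sup>2 = 0"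
proof -
  have "a dvd 1" using assms(3) by (metis dvd_minus_iff dvd_triv_left)
  then have "a = 1" using assms(1) by simp
  then show ?thesis using assms(3) by (intro exI[of _ 1] exI[of _ 0]) simp
qed

text \<open>
  The value of the form at a short vector of the lattice is a multiple of \<open>a b c\<close> strictly between
  \<open>-2 a b c\<close> and \<open>a b c\<close>.  If it is \<open>-a b c\<close>, then \<open>(x z - b y, y z + a x, z\<^sup>2 + a b)\<close> is a solution.
\<close>

lemma legendre_normalized_signs:
  fixes a b c :: int
  assumes signs: "a > 0" "b < 0" "c < 0"
    and sqfree: "\<And>d. d\<^sup>2 dvd a * b * c \<Longrightarrow> \<bar>d\<bar> = 1"
    and r: "a dvd b * r\<^sup>2 + c" and s: "b dvd c * s\<^sup>2 + a" and t: "c dvd a * t\<^sup>2 + b"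
  shows "\<exists>x y z. \<not> (x = 0 \<and> y = 0 \<and> z = 0) \<and> a * x\<^sup>2 + b * y\<^sup>2 + c * z\<^sup>2 = 0"
proof -
  interpret euclidean_in "UNIV :: int set" "\<lambda>n. nat \<bar>n\<bar>" by (rule euclidean_in_int)
  have pos: "b * c > 0" "- (c * a) > 0" "- (a * b) > 0" "a * b * c > 0"
    using signs by (auto simp: mult_less_0_iff zero_less_mult_iff)
  obtain A where A: "A > 0" "b * c \<le> A\<^sup>2" "\<And>x. \<bar>x\<bar> < A \<Longrightarrow> x\<^sup>2 < b * c"
    using box_side_exists[OF pos(1)] by blast
  obtain B where B: "B > 0" "- (c * a) \<le> B\<^sup>2" "\<And>x. \<bar>x\<bar> < B \<Longrightarrow> x\<^sup>2 < - (c * a)"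
    using box_side_exists[OF pos(2)] by blast
  obtain C where C: "C > 0" "- (a * b) \<le> C\<^sup>2" "\<And>x. \<bar>x\<bar> < C \<Longrightarrow> x\<^sup>2 < - (a * b)"
    using box_side_exists[OF pos(3)] by blast
  show ?thesis
  proof (cases "- (a * b) = 1")
    case True
    then show ?thesis using unit_leading_solution signs by simp
  next
    case False
    \<comment> \<open>This makes the box strictly larger than the index, and the last coordinate \<open>z\<^sup>2 + a b\<close> non-zero.\<close>
    have ab_square: "- (a * b) \<noteq> z\<^sup>2" for z
    proof
      assume eq: "- (a * b) = z\<^sup>2"
      then have "a * b * c = z\<^sup>2 * (- c)" by (metis minus_mult_commute minus_minus)
      then have "\<bar>z\<bar> = 1" using sqfree by simp
      then have "z\<^sup>2 = 1" by (metis abs_square_eq_1)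
      then show False using eq False by simp
    qed
    then have "- (a * b) < C\<^sup>2" using C(2) by (simp add: order_less_le)
    moreover have "(b * c) * (- (c * a)) \<le> A\<^sup>2 * B\<^sup>2"
      by (intro mult_mono A(2) B(2) less_imp_le[OF pos(2)] zero_le_power2)
    ultimately have "(b * c) * (- (c * a)) * (- (a * b)) < A\<^sup>2 * B\<^sup>2 * C\<^sup>2"
      by (intro mult_le_less_imp_less mult_pos_pos[OF pos(1,2)] less_imp_le[OF pos(3)])
    moreover have "(b * c) * (- (c * a)) * (- (a * b)) = (a * b * c)\<^sup>2"
      "A\<^sup>2 * B\<^sup>2 * C\<^sup>2 = (A * B * C)\<^sup>2"
      by (simp_all add: power2_eq_square)
    ultimately have "(a * b * c)\<^sup>2 < (A * B * C)\<^sup>2" by (simp only:)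
    then have "\<bar>a * b * c\<bar>\<^sup>2 < (A * B * C)\<^sup>2" by (simp only: power2_abs)
    then have large: "\<bar>a * b * c\<bar> < A * B * C"
      by (rule power2_less_imp_less) (use A(1) B(1) C(1) in simp)
    obtain x y z where xyz: "\<not> (x = 0 \<and> y = 0 \<and> z = 0)" "\<bar>x\<bar> < A" "\<bar>y\<bar> < B" "\<bar>z\<bar> < C"
      "a dvd y - r * z" "b dvd z - s * x" "c dvd x - t * y"
      using congruences_pigeonhole[OF _ _ _ A(1) B(1) C(1) large, of r s t] signs by blast
    let ?V = "a * x\<^sup>2 + b * y\<^sup>2 + c * z\<^sup>2"
    have "\<not> dvd_in UNIV (p\<^sup>2) (a * b * c)" if "prime_in UNIV p" for p
      using sqfree[of p] that by (auto simp: prime_in_def unit_in_def dvd_in_UNIV)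
    then have "dvd_in UNIV (a * b * c) ?V"
      using signs r s t xyz
      by (intro squarefree_conic_value_dvd[of a b c x y z r s t]) (auto simp: dvd_in_UNIV)
    then obtain q where q: "?V = a * b * c * q" by (auto simp: dvd_in_UNIV)
    have "a * x\<^sup>2 < a * (b * c)" using A(3)[OF xyz(2)] signs by simp
    moreover have "b * (- (c * a)) < b * y\<^sup>2" using B(3)[OF xyz(3)] signs by (intro mult_strict_left_mono_neg)
    moreover have "c * (- (a * b)) < c * z\<^sup>2" using C(3)[OF xyz(4)] signs by (intro mult_strict_left_mono_neg)
    moreover have "b * y\<^sup>2 \<le> 0" "c * z\<^sup>2 \<le> 0" "a * x\<^sup>2 \<ge> 0" using signs by (auto simp: mult_le_0_iff)
    ultimately have "?V < a * b * c" "?V > a * b * c * (- 2)" by (simp_all add: algebra_simps)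
    then have "a * b * c * q < a * b * c * 1" "a * b * c * (- 2) < a * b * c * q" unfolding q by simp_all
    then have "q < 1" "- 2 < q" using pos(4) by (simp_all only: mult_less_cancel_left_pos)
    then consider "q = 0" | "q = - 1" by linarith
    then show ?thesis
    proof cases
      case 1
      then show ?thesis using q xyz(1) by auto
    next
      case 2
      have "a * (x * z - b * y)\<^sup>2 + b * (y * z + a * x)\<^sup>2 + c * (z\<^sup>2 + a * b)\<^sup>2 =
          (z\<^sup>2 + a * b) * (?V + a * b * c)"
        by (simp add: algebra_simps power2_eq_square)
      also have "\<dots> = 0" using q 2 by simp
      finally have "a * (x * z - b * y)\<^sup>2 + b * (y * z + a * x)\<^sup>2 + c * (z\<^sup>2 + a * b)\<^sup>2 = 0" .
      moreover have "z\<^sup>2 + a * b \<noteq> 0" using ab_square[of z] by linarith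
      ultimately show ?thesis by blast
    qed
  qed
qed

text \<open>
  Rotating the coefficients and changing all signs leads to one positive and two negative coefficients.
\<close>

theorem legendre_of_roots:
  fixes a b c :: int
  assumes abc: "a \<noteq> 0" "b \<noteq> 0" "c \<noteq> 0"
    and signs: "\<not> (a > 0 \<and> b > 0 \<and> c > 0)" "\<not> (a < 0 \<and> b < 0 \<and> c < 0)"
    and sqfree: "\<And>d. d\<^sup>2 dvd a * b * c \<Longrightarrow> \<bar>d\<bar> = 1"
    and r: "a dvd b * r\<^sup>2 + c" and s: "b dvd c * s\<^sup>2 + a" and t: "c dvd a * t\<^sup>2 + b"
  shows "\<exists>x y z. \<not> (x = 0 \<and> y = 0 \<and> z = 0) \<and> a * x\<^sup>2 + b * y\<^sup>2 + c * z\<^sup>2 = 0"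
proof -
  let ?sol = "\<lambda>a b c :: int. \<exists>x y z. \<not> (x = 0 \<and> y = 0 \<and> z = 0) \<and> a * x\<^sup>2 + b * y\<^sup>2 + c * z\<^sup>2 = 0"
  have rotate: "?sol a b c" if "?sol b c a" for a b c
  proof -
    from that obtain x y z where "\<not> (x = 0 \<and> y = 0 \<and> z = 0)" "b * x\<^sup>2 + c * y\<^sup>2 + a * z\<^sup>2 = 0" by blast
    then show ?thesis by (intro exI[of _ z] exI[of _ x] exI[of _ y]) auto
  qed
  have negate: "?sol a b c" if "?sol (- a) (- b) (- c)" for a b c
  proof -
    from that obtain x y z where xyz: "\<not> (x = 0 \<and> y = 0 \<and> z = 0)"
      "- a * x\<^sup>2 + - b * y\<^sup>2 + - c * z\<^sup>2 = 0" by blast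
    then have "a * x\<^sup>2 + b * y\<^sup>2 + c * z\<^sup>2 = 0" by simp
    then show ?thesis using xyz(1) by blast
  qed
  have neg_r: "- a dvd - b * r\<^sup>2 + - c" if "a dvd b * r\<^sup>2 + c" for a b c r :: int
    using that by (metis add_uminus_conv_diff dvd_minus_iff minus_add_distrib minus_dvd_iff mult_minus_left)
  have core: "?sol a b c"
    if "(a > 0 \<and> b < 0 \<and> c < 0) \<or> (a < 0 \<and> b > 0 \<and> c > 0)" "\<And>d. d\<^sup>2 dvd a * b * c \<Longrightarrow> \<bar>d\<bar> = 1"
      "a dvd b * r\<^sup>2 + c" "b dvd c * s\<^sup>2 + a" "c dvd a * t\<^sup>2 + b" for a b c r s t :: int
    using that(1)
  proof
    assume "a > 0 \<and> b < 0 \<and> c < 0"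
    then show ?thesis using legendre_normalized_signs that by blast
  next
    assume sg: "a < 0 \<and> b > 0 \<and> c > 0"
    have "\<bar>d\<bar> = 1" if "d\<^sup>2 dvd (- a) * (- b) * (- c)" for d
      using \<open>\<And>d. d\<^sup>2 dvd a * b * c \<Longrightarrow> \<bar>d\<bar> = 1\<close>[of d] that by simp
    then have "?sol (- a) (- b) (- c)"
      using sg neg_r[OF that(3)] neg_r[OF that(4)] neg_r[OF that(5)]
      by (intro legendre_normalized_signs) auto
    then show ?thesis by (rule negate)
  qed
  have sq: "\<bar>d\<bar> = 1" if "d\<^sup>2 dvd b * c * a \<or> d\<^sup>2 dvd c * a * b" for d
    using sqfree[of d] that by (auto simp: ac_simps)
  consider "(a > 0 \<and> b < 0 \<and> c < 0) \<or> (a < 0 \<and> b > 0 \<and> c > 0)"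
    | "(b > 0 \<and> c < 0 \<and> a < 0) \<or> (b < 0 \<and> c > 0 \<and> a > 0)"
    | "(c > 0 \<and> a < 0 \<and> b < 0) \<or> (c < 0 \<and> a > 0 \<and> b > 0)"
    using abc signs by (metis linorder_neqE_linordered_idom)
  then show ?thesis
  proof cases
    case 1
    then show ?thesis using core[OF 1 sqfree r s t] by blast
  next
    case 2
    have "?sol b c a" by (rule core[OF 2 sq s t r]) simp
    then show ?thesis by (rule rotate)
  next
    case 3
    have "?sol c a b" by (rule core[OF 3 sq t r s]) simp
    then have "?sol b c a" by (rule rotate)
    then show ?thesis by (rule rotate)
  qed
qed

section \<open>Residue rings and irreducible elements\<close>

lemma ring_of_simps [simp]:
  "carrier (ring_of S) = S" "x \<otimes>\<^bsub>ring_of S\<^esub> y = x * y" "\<one>\<^bsub>ring_of S\<^esub> = 1"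
  "\<zero>\<^bsub>ring_of S\<^esub> = 0" "x \<oplus>\<^bsub>ring_of S\<^esub> y = x + y"
  by (simp_all add: ring_of_def)

lemma divides_ring_of: "x divides\<^bsub>ring_of S\<^esub> y \<longleftrightarrow> dvd_in S x y"
  by (simp add: factor_def dvd_in_def)

lemma Units_ring_of: "x \<in> Units (ring_of S) \<longleftrightarrow> x \<in> S \<and> unit_in S x"
  unfolding Units_def unit_in_def dvd_in_def by (auto simp: mult.commute)

lemma gcdof_ring_of:
  "g gcdof\<^bsub>ring_of S\<^esub> x y \<longleftrightarrow> dvd_in S g x \<and> dvd_in S g y \<and>
    (\<forall>d\<in>S. dvd_in S d x \<and> dvd_in S d y \<longrightarrow> dvd_in S d g)"
  by (simp add: isgcd_def divides_ring_of)

lemma cring_ring_of: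
  assumes "unital_subring S"
  shows "cring (ring_of S)"
proof -
  interpret unital_subring S by fact
  show ?thesis
  proof (rule cringI)
    show "abelian_group (ring_of S)"
    proof (rule abelian_groupI)
      fix x assume "x \<in> carrier (ring_of S)"
      then show "\<exists>y\<in>carrier (ring_of S). y \<oplus>\<^bsub>ring_of S\<^esub> x = \<zero>\<^bsub>ring_of S\<^esub>"
        using uminus_closed by (intro bexI[of _ "- x"]) auto
    qed (auto intro: add_closed zero_closed)
    show "comm_monoid (ring_of S)"
      by unfold_locales (auto intro: mult_closed one_closed)
  qed (auto simp: distrib_right)
qed

lemma pow_ring_of: "x [^]\<^bsub>ring_of S\<^esub> (n::nat) = x ^ n"
  by (induction n) (simp_all add: nat_pow_def mult.commute)

lemma PIdl_ring_of: "PIdl\<^bsub>ring_of S\<^esub> p = {x. dvd_in S p x}"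
  unfolding cgenideal_def dvd_in_def by (auto simp: mult.commute)

text \<open>
  A root in the residue ring is the class of an element of the ring, and the value of the reduced
  polynomial at it is the class of the value.
\<close>

lemma root_in_residue_ring_iff:
  assumes S: "unital_subring S" and pbc: "p \<in> S" "b \<in> S" "c \<in> S"
  shows "(\<exists>x. ring.is_root (ring_of S Quot (PIdl\<^bsub>ring_of S\<^esub> p))
      (map (\<lambda>r. (PIdl\<^bsub>ring_of S\<^esub> p) +>\<^bsub>ring_of S\<^esub> r) [b, 0, c]) x) \<longleftrightarrow>
    (\<exists>r\<in>S. dvd_in S p (b * r\<^sup>2 + c))"
proof -
  let ?R = "ring_of S" and ?I = "PIdl\<^bsub>ring_of S\<^esub> p"
  interpret unital_subring S by fact
  interpret R: cring ?R using S by (rule cring_ring_of)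
  interpret I: ideal ?I ?R using pbc by (intro R.cgenideal_ideal) simp
  let ?Q = "?R Quot ?I" and ?h = "\<lambda>r. ?I +>\<^bsub>?R\<^esub> r"
  interpret Q: ring ?Q by (rule I.quotient_is_ring)
  interpret h: ring_hom_ring ?R ?Q ?h by (rule I.rcos_ring_hom_ring)
  have carrier: "carrier ?Q = ?h ` S"
    unfolding FactRing_def A_RCOSETS_def' by auto
  have zero_iff: "?h v = \<zero>\<^bsub>?Q\<^esub> \<longleftrightarrow> dvd_in S p v" if "v \<in> S" for v
  proof -
    have "?h v = \<zero>\<^bsub>?Q\<^esub> \<longleftrightarrow> v \<in> ?I"
      using I.rcos_const_imp_mem[of v] I.a_rcos_const[of v] that
      by (auto simp: FactRing_def)
    then show ?thesis by (simp add: PIdl_ring_of)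
  qed
  have eval: "Q.eval (map ?h [b, 0, c]) (?h r) = ?h (b * r\<^sup>2 + c)" if r: "r \<in> S" for r
  proof -
    have "?h (b * r\<^sup>2 + c) = ?h (b \<otimes>\<^bsub>?R\<^esub> r [^]\<^bsub>?R\<^esub> (2::nat) \<oplus>\<^bsub>?R\<^esub> (0 \<otimes>\<^bsub>?R\<^esub> r [^]\<^bsub>?R\<^esub> (1::nat) \<oplus>\<^bsub>?R\<^esub>
        (c \<otimes>\<^bsub>?R\<^esub> r [^]\<^bsub>?R\<^esub> (0::nat) \<oplus>\<^bsub>?R\<^esub> \<zero>\<^bsub>?R\<^esub>)))"
      unfolding pow_ring_of by simp
    also have "\<dots> = ?h b \<otimes>\<^bsub>?Q\<^esub> ?h r [^]\<^bsub>?Q\<^esub> (2::nat) \<oplus>\<^bsub>?Q\<^esub> (?h 0 \<otimes>\<^bsub>?Q\<^esub> ?h r [^]\<^bsub>?Q\<^esub> (1::nat) \<oplus>\<^bsub>?Q\<^esub>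
        (?h c \<otimes>\<^bsub>?Q\<^esub> ?h r [^]\<^bsub>?Q\<^esub> (0::nat) \<oplus>\<^bsub>?Q\<^esub> \<zero>\<^bsub>?Q\<^esub>))"
    proof -
      have cl: "b \<in> carrier ?R" "0 \<in> carrier ?R" "c \<in> carrier ?R" "r \<in> carrier ?R"
        using pbc r zero_closed by auto
      show ?thesis
        by (simp only: h.hom_add h.hom_mult h.hom_nat_pow h.hom_zero cl R.m_closed R.a_closed
            R.nat_pow_closed R.zero_closed)
    qed
    also have "\<dots> = Q.eval (map ?h [b, 0, c]) (?h r)" by (simp add: numeral_2_eq_2)
    finally show ?thesis ..
  qed
  have "(\<exists>x. Q.is_root (map ?h [b, 0, c]) x) \<longleftrightarrow> (\<exists>r\<in>S. Q.eval (map ?h [b, 0, c]) (?h r) = \<zero>\<^bsub>?Q\<^esub>)"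
    unfolding Q.is_root_def carrier by blast
  also have "\<dots> \<longleftrightarrow> (\<exists>r\<in>S. dvd_in S p (b * r\<^sup>2 + c))"
    using pbc by (intro bex_cong refl) (simp only: eval zero_iff closed)
  finally show ?thesis .
qed

lemma ring_irreducible_iff_prime_in:
  assumes "euclidean_in S N" "p \<in> S"
  shows "ring_irreducible\<^bsub>ring_of S\<^esub> p \<longleftrightarrow> prime_in S p"
proof -
  interpret euclidean_in S N by fact
  have "ring_irreducible\<^bsub>ring_of S\<^esub> p \<longleftrightarrow> p \<noteq> 0 \<and> \<not> unit_in S p \<and>
      (\<forall>d\<in>S. dvd_in S d p \<longrightarrow> unit_in S d \<or> dvd_in S p d)"
    using assms(2) by (auto simp: ring_irreducible_def Divisibility.irreducible_def properfactor_def
        Units_ring_of divides_ring_of)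
  also have "\<dots> \<longleftrightarrow> prime_in S p"
  proof
    assume "p \<noteq> 0 \<and> \<not> unit_in S p \<and> (\<forall>d\<in>S. dvd_in S d p \<longrightarrow> unit_in S d \<or> dvd_in S p d)"
    then show "prime_in S p" using assms(2) by (intro atom_prime_in) auto
  next
    assume "prime_in S p"
    then show "p \<noteq> 0 \<and> \<not> unit_in S p \<and> (\<forall>d\<in>S. dvd_in S d p \<longrightarrow> unit_in S d \<or> dvd_in S p d)"
      using prime_in_atom by (auto simp: prime_in_def)
  qed
  finally show ?thesis .
qed

lemma (in unital_subring) associate_prime_in:
  assumes p: "prime_in S p" and q: "q \<in> S" "dvd_in S q p" "dvd_in S p q"
  shows "prime_in S q"
  unfolding prime_in_def
proof (intro conjI ballI impI)
  show "q \<noteq> 0" using p q(2) unfolding prime_in_def dvd_in_def by auto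
  show "\<not> unit_in S q" using p q(3) dvd_in_unit unfolding prime_in_def by blast
  fix x y assume "x \<in> S" "y \<in> S" "dvd_in S q (x * y)"
  then have "dvd_in S p x \<or> dvd_in S p y"
    using prime_in_mult_iff[OF p] dvd_in_trans[OF q(3)] by blast
  then show "dvd_in S q x \<or> dvd_in S q y" using dvd_in_trans[OF q(2)] by blast
qed (fact q)


section \<open>Polynomial rings and their Euclidean extensions\<close>

abbreviation Rc :: "nat \<Rightarrow> ratfun set" where "Rc k \<equiv> carrier (R k)"

abbreviation Ac :: "nat \<Rightarrow> ratfun set" where "Ac k \<equiv> carrier (R_tilde k)"

lemma R_ring_of: "R k = ring_of (Rc k)"
  by (simp add: R_def)

lemma R_tilde_ring_of: "R_tilde k = ring_of (Ac k)"
  by (simp add: R_tilde_def)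

lemma Units_R: "x \<in> Units (R k) \<longleftrightarrow> x \<in> Rc k \<and> unit_in (Rc k) x"
  using Units_ring_of R_ring_of by metis

lemma divides_R: "x divides\<^bsub>R k\<^esub> y \<longleftrightarrow> dvd_in (Rc k) x y"
  using divides_ring_of R_ring_of by metis

lemma gcdof_R:
  "g gcdof\<^bsub>R k\<^esub> x y \<longleftrightarrow> dvd_in (Rc k) g x \<and> dvd_in (Rc k) g y \<and>
    (\<forall>d\<in>Rc k. dvd_in (Rc k) d x \<and> dvd_in (Rc k) d y \<longrightarrow> dvd_in (Rc k) d g)"
  using gcdof_ring_of[of "Rc k"] unfolding R_ring_of[symmetric] .

definition const_int :: "int \<Rightarrow> ratfun" where
  "const_int n = const (of_int n)"

interpretation const_int: ring_embedding UNIV const_int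
  by unfold_locales
     (auto simp: const_int_def const_1 const_diff const_mult const_eq_iff inj_on_def)

lemma Rc_0: "Rc 0 = range const_int"
  by (auto simp: R_def const_int_def Ints_def)

lemma Ac_0: "Ac 0 = range const_int"
  by (auto simp: R_tilde_def const_int_def Ints_def)

lemma Rc_Suc: "Rc (Suc j) = rat_polys (Suc j)"
  by (simp add: R_def rat_polys_def)

lemma polys_over_Suc: "polys_over (Suc j) = polys (K j)"
  by (simp add: polys_over_def polys_def)

lemma Ac_Suc: "Ac (Suc j) = (\<lambda>f. poly f (tvar (Suc j))) ` polys (K j)"
  by (simp add: R_tilde_def polys_over_Suc)

lemma ring_embedding_polys_K: "ring_embedding (polys (K j)) (\<lambda>f. poly f (tvar (Suc j)))"
  using ring_embedding_poly_tvar[OF _ order_refl] subfield_in.axioms(1)[OF subfield_in_K] by blast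

lemma ring_embedding_polys_rat_polys: "ring_embedding (polys (rat_polys j)) (\<lambda>f. poly f (tvar (Suc j)))"
  by (rule ring_embedding_poly_tvar[OF unital_subring_rat_polys rat_polys_subset_K])

lemma euclidean_in_Ac: "\<exists>N. euclidean_in (Ac k) N"
proof (cases k)
  case 0
  show ?thesis using const_int.euclidean_in_image[OF euclidean_in_int] unfolding 0 Ac_0 by blast
next
  case (Suc j)
  show ?thesis
    using ring_embedding.euclidean_in_image[OF ring_embedding_polys_K]
      subfield_in.euclidean_in_polys[OF subfield_in_K] unfolding Suc Ac_Suc by blast
qed

lemma unital_subring_Ac: "unital_subring (Ac k)"
  using euclidean_in_Ac euclidean_in.axioms(1) by blast

lemma ufd_in_Rc: "\<exists>N. ufd_in (Rc k) N"
proof (cases k)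
  case 0
  obtain N where "euclidean_in (Ac 0) N" using euclidean_in_Ac by blast
  then interpret euclidean_in "Ac 0" N .
  show ?thesis using ufd_in_axioms unfolding 0 Ac_0 Rc_0 by blast
next
  case (Suc j)
  show ?thesis using ufd_in_rat_polys unfolding Suc Rc_Suc by blast
qed

lemma unital_subring_Rc: "unital_subring (Rc k)"
  using ufd_in_Rc ufd_in.axioms(1) by blast

lemma Rc_subset_Ac: "Rc k \<subseteq> Ac k"
proof (cases k)
  case (Suc j)
  show ?thesis
    unfolding Suc Rc_Suc Ac_Suc rat_polys_Suc using polys_mono[OF rat_polys_subset_K] by (rule image_mono)
qed (simp add: Rc_0 Ac_0)

lemma Ac_subset_K: "Ac k \<subseteq> K k"
proof (cases k)
  case 0
  then show ?thesis by (auto simp: Ac_0 K_0 const_int_def)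
next
  case (Suc j)
  interpret S: subfield_in "K (Suc j)" by (rule subfield_in_K)
  have K: "K j \<subseteq> K (Suc j)" using mpolys_mono[of j] unfolding K_def by blast
  have "tvar (Suc j) \<in> K (Suc j)" using tvar_in_rat_polys rat_polys_subset_K by blast
  then show ?thesis
    unfolding Suc Ac_Suc using K
    by (auto simp: poly_altdef polys_def intro!: S.sum_closed S.mult_closed S.power_closed)
qed

lemma K_denominator:
  assumes "x \<in> K k"
  shows "\<exists>d\<in>Rc k. d \<noteq> 0 \<and> d * x \<in> Rc k"
proof (cases k)
  case 0
  then obtain q where q: "x = const q" using assms K_0 by auto
  obtain m n where mn: "quotient_of q = (m, n)" by fastforce
  then have "n > 0" "q = of_int m / of_int n"
    using quotient_of_denom_pos quotient_of_div by blast+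
  then have "const_int n * x = const_int m" "const_int n \<noteq> 0"
    by (simp_all add: q const_int_def const_eq_0_iff flip: const_mult)
  then show ?thesis unfolding 0 Rc_0 by blast
next
  case (Suc j)
  then show ?thesis using fracs_denominator assms unfolding Suc Rc_Suc K_eq_fracs by blast
qed

lemma expansion_poly:
  assumes "f \<in> polys (K j)"
  shows "expansion (Suc j) (poly f (tvar (Suc j))) = f"
proof -
  interpret ring_embedding "polys (K j)" "\<lambda>f. poly f (tvar (Suc j))" by (rule ring_embedding_polys_K)
  show ?thesis
    unfolding expansion_def polys_over_Suc
    using assms inj_on_eq_iff[OF inj] by (intro the_equality) auto
qed

lemma deg_poly: "f \<in> polys (K j) \<Longrightarrow> deg (Suc j) (poly f (tvar (Suc j))) = degree f"
  by (simp add: deg_def expansion_poly)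

lemma lc_poly: "f \<in> polys (K j) \<Longrightarrow> lc (Suc j) (poly f (tvar (Suc j))) = lead_coeff f"
  by (simp add: lc_def expansion_poly)

text \<open>
  For \<open>k > 0\<close> a prime of \<open>\<rat>(t\<^sub>1,\<dots>,t\<^sub>k\<^sub>-\<^sub>1)[t\<^sub>k]\<close> is associated there to a primitive polynomial of
  \<open>\<rat>[t\<^sub>1,\<dots>,t\<^sub>k]\<close>, whose square is primitive again.  By Gauss's lemma every element of the smaller ring
  that the square divides in the larger ring is a multiple of it in the smaller ring.
\<close>

lemma prime_square_imp_nontrivial_square:
  assumes x: "x \<in> Rc k" and p: "prime_in (Ac k) p" and dvd: "dvd_in (Ac k) (p\<^sup>2) x"
  shows "\<exists>s. nontrivial_square k s \<and> dvd_in (Rc k) s x"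
proof (cases k)
  case 0
  then have "Ac k = Rc k" by (simp add: Ac_0 Rc_0)
  moreover then have "nontrivial_square k (p\<^sup>2)"
    using p unfolding nontrivial_square_def
    by (intro bexI[of _ p]) (auto simp: prime_in_def Units_R)
  ultimately show ?thesis using dvd by auto
next
  case (Suc j)
  let ?h = "\<lambda>f. poly f (tvar (Suc j))"
  obtain N where "ufd_in (rat_polys j) N" using ufd_in_rat_polys by blast
  then interpret M: ufd_in "rat_polys j" N .
  interpret MP: unital_subring "polys (rat_polys j)" by (rule M.unital_subring_polys)
  interpret F: subfield_in "K j" by (rule subfield_in_K)
  interpret FP: unital_subring "polys (K j)" by (rule F.unital_subring_polys)
  interpret E: ring_embedding "polys (K j)" ?h by (rule ring_embedding_polys_K)
  interpret EM: ring_embedding "polys (rat_polys j)" ?h by (rule ring_embedding_polys_rat_polys)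
  have sub: "polys (rat_polys j) \<subseteq> polys (K j)" by (rule polys_mono[OF rat_polys_subset_K])
  obtain g where g: "g \<in> polys (rat_polys j)" "x = ?h g"
    using x unfolding Suc Rc_Suc rat_polys_Suc by blast
  obtain f where f: "f \<in> polys (K j)" "p = ?h f"
    using p unfolding Suc Ac_Suc prime_in_def by blast
  have f_prime: "prime_in (polys (K j)) f" using p f unfolding Suc Ac_Suc by (simp add: E.prime_in_image)
  have "p\<^sup>2 = ?h (f\<^sup>2)" using f by simp
  then have "dvd_in (polys (K j)) (f\<^sup>2) g"
    using dvd E.dvd_in_image[of "f\<^sup>2" g] f(1) g sub FP.power_closed unfolding Suc Ac_Suc by auto
  then obtain u where u: "u \<in> polys (K j)" "g = f\<^sup>2 * u" unfolding dvd_in_def by blast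
  have deg_f: "degree f > 0"
  proof (rule ccontr)
    assume "\<not> degree f > 0"
    then obtain c where c: "f = [:c:]" by (metis degree_eq_zeroE not_gr_zero)
    have "c \<in> K j" "c \<noteq> 0" using f_prime c F.const_polys_iff by (auto simp: prime_in_def)
    then have "f * [:inverse c:] = 1" "[:inverse c:] \<in> polys (K j)"
      using c F.const_polys_iff F.inverse_closed by auto
    then have "unit_in (polys (K j)) f" unfolding unit_in_def dvd_in_def by metis
    then show False using f_prime by (simp add: prime_in_def)
  qed
  obtain d where d: "d \<in> rat_polys j" "d \<noteq> 0" "smult d f \<in> polys (rat_polys j)"
    using M.common_denominator_polys[of "K j" f] f fracs_denominator unfolding K_eq_fracs by blast
  obtain e where e: "e \<in> rat_polys j" "e \<noteq> 0" "smult e u \<in> polys (rat_polys j)"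
    using M.common_denominator_polys[of "K j" u] u fracs_denominator unfolding K_eq_fracs by blast
  have "smult d f \<noteq> 0" using d deg_f by auto
  then obtain c q where q: "c \<in> rat_polys j" "q \<in> polys (rat_polys j)" "smult d f = smult c q" "M.primitive q"
    using M.content_primitive_part d by blast
  have "c \<noteq> 0" using q \<open>smult d f \<noteq> 0\<close> by auto
  then have deg_q: "degree q > 0" using arg_cong[OF q(3), of degree] d deg_f by simp
  have "smult (d\<^sup>2 * e) g = (smult d f)\<^sup>2 * smult e u"
    unfolding u by (simp add: power2_eq_square ac_simps)
  also have "\<dots> = q\<^sup>2 * smult (c\<^sup>2) (smult e u)"
    unfolding q by (simp add: power2_eq_square ac_simps)
  finally have eq: "smult (d\<^sup>2 * e) g = q * q * smult (c\<^sup>2) (smult e u)"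
    by (simp only: power2_eq_square[of q])
  have "smult (c\<^sup>2) (smult e u) \<in> polys (rat_polys j)"
    by (rule M.smult_polys[OF M.power_closed[OF q(1)] e(3)])
  then have "dvd_in (polys (rat_polys j)) (q * q) (smult (d\<^sup>2 * e) g)"
    unfolding eq by (rule MP.dvd_in_triv)
  then have "dvd_in (polys (rat_polys j)) (q * q) g"
    by (rule M.primitive_dvd_smult[OF MP.mult_closed[OF q(2,2)] M.primitive_mult[OF q(2,2,4,4)] g(1)
          M.mult_closed[OF M.power_closed[OF d(1)] e(1)], rotated]) (use d e in simp)
  then have "dvd_in (Rc k) (?h (q * q)) x"
    unfolding Suc Rc_Suc rat_polys_Suc g by (simp only: EM.dvd_in_image MP.mult_closed q g)
  moreover have "\<not> unit_in (polys (rat_polys j)) q" using M.unit_in_polys_degree deg_q by auto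
  then have "\<not> unit_in (Rc k) (?h q)" 
    unfolding Suc Rc_Suc rat_polys_Suc using EM.unit_in_image[OF q(2)] by blast
  then have "nontrivial_square k (?h (q * q))"
    unfolding nontrivial_square_def using q deg_q EM.h_eq_0_iff[OF q(2)]
    by (intro bexI[of _ "?h q"])
       (auto simp: Units_R power2_eq_square Suc Rc_Suc rat_polys_Suc)
  ultimately show ?thesis by blast
qed


subsection \<open>Normalized primes\<close>

definition normalized :: "nat \<Rightarrow> ratfun \<Rightarrow> bool" where
  "normalized k p \<longleftrightarrow> (if k = 0 then p \<in> const ` {0<..} else lc k p = 1)"

lemma Factors_eq: "Factors k a = {p. prime_in (Ac k) p \<and> normalized k p \<and> dvd_in (Ac k) p a}"
proof -
  obtain N where N: "euclidean_in (Ac k) N" using euclidean_in_Ac by blast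
  have "ring_irreducible\<^bsub>R_tilde k\<^esub> p \<longleftrightarrow> prime_in (Ac k) p" if "p \<in> Ac k" for p
    using ring_irreducible_iff_prime_in[OF N that] R_tilde_ring_of by simp
  moreover have "p divides\<^bsub>R_tilde k\<^esub> a \<longleftrightarrow> dvd_in (Ac k) p a" for p
    using divides_ring_of R_tilde_ring_of by metis
  ultimately show ?thesis
    unfolding Factors_def normalized_def by (auto simp: prime_in_def)
qed

lemma const_int_pos_iff: "const_int n \<in> const ` {0<..} \<longleftrightarrow> n > 0"
  by (auto simp: const_int_def const_eq_iff image_iff)

lemma const_int_neg_iff: "const_int n \<in> const ` {..<0} \<longleftrightarrow> n < 0"
  by (auto simp: const_int_def const_eq_iff image_iff)

lemma normalized_associate:
  assumes p: "prime_in (Ac k) p"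
  shows "\<exists>q. prime_in (Ac k) q \<and> normalized k q \<and> dvd_in (Ac k) q p \<and> dvd_in (Ac k) p q"
proof -
  interpret unital_subring "Ac k" by (rule unital_subring_Ac)
  have "\<exists>q\<in>Ac k. normalized k q \<and> dvd_in (Ac k) q p \<and> dvd_in (Ac k) p q"
  proof (cases k)
    case 0
    obtain n where n: "p = const_int n" using p by (auto simp: 0 Ac_0 prime_in_def)
    then have "n \<noteq> 0" using p const_int.h_zero by (auto simp: prime_in_def)
    then have "normalized k (const_int \<bar>n\<bar>)" by (simp add: normalized_def 0 const_int_pos_iff)
    then show ?thesis
      unfolding n 0 Ac_0 by (intro bexI[of _ "const_int \<bar>n\<bar>"]) (auto simp: const_int.dvd_in_image dvd_in_UNIV)
  next
    case (Suc j)
    let ?h = "\<lambda>f. poly f (tvar (Suc j))"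
    interpret F: subfield_in "K j" by (rule subfield_in_K)
    interpret E: ring_embedding "polys (K j)" ?h by (rule ring_embedding_polys_K)
    obtain f where f: "f \<in> polys (K j)" "p = ?h f"
      using p unfolding Suc Ac_Suc prime_in_def by blast
    define c where "c = lead_coeff f"
    have "f \<noteq> 0" using p f by (auto simp: prime_in_def)
    then have c: "c \<in> K j" "c \<noteq> 0" using f by (auto simp: c_def coeff_polys)
    let ?g = "smult (inverse c) f"
    have g: "?g \<in> polys (K j)" using f c F.smult_polys F.inverse_closed by blast
    have "normalized k (?h ?g)"
      using c unfolding normalized_def Suc lc_poly[OF g] by (simp add: c_def)
    moreover have "dvd_in (polys (K j)) ?g f"
      unfolding dvd_in_def using c F.const_polys_iff[of c] by (intro bexI[of _ "[:c:]"]) auto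
    moreover have "dvd_in (polys (K j)) f ?g"
      unfolding dvd_in_def using c F.const_polys_iff[of "inverse c"] F.inverse_closed
      by (intro bexI[of _ "[:inverse c:]"]) auto
    ultimately show ?thesis
      unfolding f(2) Suc Ac_Suc using f g by (intro bexI[of _ "?h ?g"]) (auto simp only: E.dvd_in_image imageI)
  qed
  then show ?thesis using associate_prime_in[OF p] by blast
qed

lemma normalized_unique:
  assumes p: "prime_in (Ac k) p" "normalized k p" and q: "prime_in (Ac k) q" "normalized k q"
    and dvd: "dvd_in (Ac k) p q"
  shows "p = q"
proof -
  obtain N where "euclidean_in (Ac k) N" using euclidean_in_Ac by blast
  then interpret euclidean_in "Ac k" N .
  have dvd': "dvd_in (Ac k) q p" using prime_in_atom[OF q(1) _ dvd] p(1) by (auto simp: prime_in_def)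
  show ?thesis
  proof (cases k)
    case 0
    obtain m n where mn: "p = const_int m" "q = const_int n"
      using p q by (auto simp: 0 Ac_0 prime_in_def)
    have "m dvd n" "n dvd m"
      using dvd dvd' by (simp_all add: 0 Ac_0 mn const_int.dvd_in_image dvd_in_UNIV)
    moreover have "m > 0" "n > 0" using p q by (simp_all add: normalized_def 0 mn const_int_pos_iff)
    ultimately have "m = n" by (intro zdvd_antisym_nonneg) auto
    then show ?thesis unfolding mn by simp
  next
    case (Suc j)
    let ?h = "\<lambda>f. poly f (tvar (Suc j))"
    interpret E: ring_embedding "polys (K j)" ?h by (rule ring_embedding_polys_K)
    obtain f g where fg: "f \<in> polys (K j)" "p = ?h f" "g \<in> polys (K j)" "q = ?h g"
      using p q unfolding Suc Ac_Suc prime_in_def by blast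
    have "dvd_in (polys (K j)) f g" "dvd_in (polys (K j)) g f"
      using dvd dvd' E.dvd_in_image fg by (simp_all add: Suc Ac_Suc)
    then have "f dvd g" "g dvd f" unfolding dvd_in_def dvd_def by blast+
    then obtain u where u: "g = f * u" by blast
    have lead: "lead_coeff f = 1" "lead_coeff g = 1"
      using p q fg by (simp_all add: normalized_def Suc lc_poly)
    then have "f \<noteq> 0" "g \<noteq> 0" by auto
    then have "degree f + degree u \<le> degree f"
      using dvd_imp_degree_le[OF \<open>g dvd f\<close>] by (auto simp: u degree_mult_eq)
    then obtain c where c: "u = [:c:]" by (metis add_le_same_cancel1 le_zero_eq degree_eq_zeroE)
    have "lead_coeff g = lead_coeff f * lead_coeff u" unfolding u by (rule lead_coeff_mult)
    then have "u = 1" using lead c by (simp add: one_pCons)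
    then show ?thesis unfolding fg u by simp
  qed
qed

lemma finite_Factors:
  assumes "a \<in> Ac k" "a \<noteq> 0"
  shows "finite (Factors k a)"
proof -
  obtain N where "euclidean_in (Ac k) N" using euclidean_in_Ac by blast
  then interpret euclidean_in "Ac k" N .
  show ?thesis
    unfolding Factors_eq using normalized_unique assms by (intro finite_normalized_primes) blast+
qed

definition local_roots :: "nat \<Rightarrow> ratfun \<Rightarrow> ratfun \<Rightarrow> ratfun \<Rightarrow> bool" where
  "local_roots k a b c \<longleftrightarrow> (\<forall>p. prime_in (Ac k) p \<and> dvd_in (Ac k) p a \<longrightarrow>
     (\<exists>r\<in>Ac k. dvd_in (Ac k) p (b * r\<^sup>2 + c)))"

text \<open>
  A certificate lists only normalized primes, but every prime has a normalized associate, which divides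
  the same elements.
\<close>

lemma root_list_exists_iff:
  assumes abc: "a \<in> Ac k" "a \<noteq> 0" "b \<in> Ac k" "c \<in> Ac k"
  shows "(\<exists>rs. root_list k a b c rs) \<longleftrightarrow> local_roots k a b c"
proof -
  interpret unital_subring "Ac k" by (rule unital_subring_Ac)
  let ?root = "\<lambda>p x. ring.is_root (residue_field k p) (poly_mod k p [b, 0, c]) x"
  have root: "(\<exists>x. ?root p x) \<longleftrightarrow> (\<exists>r\<in>Ac k. dvd_in (Ac k) p (b * r\<^sup>2 + c))" if "p \<in> Ac k" for p
    using root_in_residue_ring_iff[OF unital_subring_Ac that abc(3,4)]
    unfolding residue_field_def poly_mod_def R_tilde_ring_of[symmetric] .
  have "(\<exists>rs. root_list k a b c rs) \<longleftrightarrow> (\<forall>p\<in>Factors k a. \<exists>x. ?root p x)"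
  proof
    assume "\<exists>rs. root_list k a b c rs"
    then show "\<forall>p\<in>Factors k a. \<exists>x. ?root p x" unfolding root_list_def by force
  next
    assume "\<forall>p\<in>Factors k a. \<exists>x. ?root p x"
    then obtain x where x: "\<And>p. p \<in> Factors k a \<Longrightarrow> ?root p (x p)" by metis
    obtain ps where ps: "set ps = Factors k a"
      using finite_Factors[OF abc(1,2)] finite_list by blast
    have "root_list k a b c (map (\<lambda>p. (p, x p)) ps)"
      unfolding root_list_def using ps x by (auto simp: image_image)
    then show "\<exists>rs. root_list k a b c rs" by blast
  qed
  also have "\<dots> \<longleftrightarrow> (\<forall>p\<in>Factors k a. \<exists>r\<in>Ac k. dvd_in (Ac k) p (b * r\<^sup>2 + c))"
    using root by (auto simp: Factors_eq prime_in_def)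
  also have "\<dots> \<longleftrightarrow> local_roots k a b c"
    unfolding local_roots_def
  proof (intro iffI allI impI ballI)
    fix p assume all: "\<forall>p\<in>Factors k a. \<exists>r\<in>Ac k. dvd_in (Ac k) p (b * r\<^sup>2 + c)"
      and p: "prime_in (Ac k) p \<and> dvd_in (Ac k) p a"
    obtain q where q: "prime_in (Ac k) q" "normalized k q" "dvd_in (Ac k) q p" "dvd_in (Ac k) p q"
      using normalized_associate p by blast
    then have "q \<in> Factors k a" using p dvd_in_trans[OF q(3)] by (simp add: Factors_eq)
    then obtain r where "r \<in> Ac k" "dvd_in (Ac k) q (b * r\<^sup>2 + c)" using all by blast
    then show "\<exists>r\<in>Ac k. dvd_in (Ac k) p (b * r\<^sup>2 + c)" using dvd_in_trans[OF q(4)] by blast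
  qed (auto simp: Factors_eq)
  finally show ?thesis .
qed

section \<open>Solubility and the reduction procedure\<close>

definition soluble :: "ratfun set \<Rightarrow> conic \<Rightarrow> bool" where
  "soluble S = (\<lambda>(a, b, c). \<exists>x\<in>S. \<exists>y\<in>S. \<exists>z\<in>S. \<not> (x = 0 \<and> y = 0 \<and> z = 0) \<and>
     a * x\<^sup>2 + b * y\<^sup>2 + c * z\<^sup>2 = 0)"

lemma soluble_K_iff_Ac: "soluble (K k) e \<longleftrightarrow> soluble (Ac k) e"
proof
  assume "soluble (Ac k) e"
  then show "soluble (K k) e" using Ac_subset_K[of k] unfolding soluble_def by (auto; blast)
next
  assume "soluble (K k) e"
  then obtain a b c x y z where e: "e = (a, b, c)" and xyz: "x \<in> K k" "y \<in> K k" "z \<in> K k"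
    "\<not> (x = 0 \<and> y = 0 \<and> z = 0)" "a * x\<^sup>2 + b * y\<^sup>2 + c * z\<^sup>2 = 0"
    unfolding soluble_def by (cases e) auto
  interpret unital_subring "Ac k" by (rule unital_subring_Ac)
  have den: "\<exists>d\<in>Ac k. d \<noteq> 0 \<and> d * w \<in> Ac k" if "w \<in> K k" for w
    using K_denominator[OF that] Rc_subset_Ac by blast
  obtain d1 d2 d3 where d: "d1 \<in> Ac k" "d1 \<noteq> 0" "d1 * x \<in> Ac k" "d2 \<in> Ac k" "d2 \<noteq> 0" "d2 * y \<in> Ac k"
    "d3 \<in> Ac k" "d3 \<noteq> 0" "d3 * z \<in> Ac k"
    using den[OF xyz(1)] den[OF xyz(2)] den[OF xyz(3)] by blast
  let ?d = "d1 * d2 * d3"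
  have "?d * x = d2 * d3 * (d1 * x)" "?d * y = d1 * d3 * (d2 * y)" "?d * z = d1 * d2 * (d3 * z)"
    by (simp_all add: ac_simps)
  then have "?d * x \<in> Ac k" "?d * y \<in> Ac k" "?d * z \<in> Ac k"
    using d by (simp_all only: mult_closed)
  moreover have "\<not> (?d * x = 0 \<and> ?d * y = 0 \<and> ?d * z = 0)" using d xyz(4) by simp
  moreover have "a * (?d * x)\<^sup>2 + b * (?d * y)\<^sup>2 + c * (?d * z)\<^sup>2 = ?d\<^sup>2 * (a * x\<^sup>2 + b * y\<^sup>2 + c * z\<^sup>2)"
    by (simp add: algebra_simps power2_eq_square)
  then have "a * (?d * x)\<^sup>2 + b * (?d * y)\<^sup>2 + c * (?d * z)\<^sup>2 = 0" using xyz(5) by simp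
  ultimately show "soluble (Ac k) e" unfolding e soluble_def by blast
qed

text \<open>
  Rescaling the coordinates by \<open>u\<close>, \<open>v\<close>, \<open>w\<close> multiplies the equation by \<open>m\<close>.  Up to a
  rotation, each step of the reduction is of this form, with \<open>(u, v, w) = (g, g, 1)\<close> and \<open>m = g\<close> for a greatest common divisor \<open>g\<close> of the first two
  coefficients, and \<open>(u, v, w) = (d, 1, 1)\<close> and \<open>m = 1\<close> for a square \<open>d\<^sup>2\<close> that divides the first one.
\<close>

lemma soluble_rescale:
  assumes "soluble (K k) (a, b, c)" and uvw: "u \<in> K k" "u \<noteq> 0" "v \<in> K k" "v \<noteq> 0" "w \<in> K k" "w \<noteq> 0"
    and eq: "a' * u\<^sup>2 = m * a" "b' * v\<^sup>2 = m * b" "c' * w\<^sup>2 = m * c"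
  shows "soluble (K k) (a', b', c')"
proof -
  interpret subfield_in "K k" by (rule subfield_in_K)
  obtain x y z where xyz: "x \<in> K k" "y \<in> K k" "z \<in> K k" "\<not> (x = 0 \<and> y = 0 \<and> z = 0)"
    "a * x\<^sup>2 + b * y\<^sup>2 + c * z\<^sup>2 = 0"
    using assms(1) unfolding soluble_def by auto
  have "a' * (u * x)\<^sup>2 + b' * (v * y)\<^sup>2 + c' * (w * z)\<^sup>2 =
      (a' * u\<^sup>2) * x\<^sup>2 + (b' * v\<^sup>2) * y\<^sup>2 + (c' * w\<^sup>2) * z\<^sup>2"
    by (simp add: power_mult_distrib ac_simps)
  also have "\<dots> = m * (a * x\<^sup>2 + b * y\<^sup>2 + c * z\<^sup>2)" unfolding eq by (simp add: algebra_simps)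
  finally have "a' * (u * x)\<^sup>2 + b' * (v * y)\<^sup>2 + c' * (w * z)\<^sup>2 = 0" using xyz(5) by simp
  moreover have "u * x \<in> K k" "v * y \<in> K k" "w * z \<in> K k" using uvw xyz by (auto intro: mult_closed)
  moreover have "\<not> (u * x = 0 \<and> v * y = 0 \<and> w * z = 0)" using uvw xyz(4) by simp
  ultimately show ?thesis unfolding soluble_def by blast
qed

lemma soluble_rotate: "soluble S (a, b, c) \<Longrightarrow> soluble S (b, c, a)"
  unfolding soluble_def by (auto simp: ac_simps)

definition integral :: "nat \<Rightarrow> conic \<Rightarrow> bool" where
  "integral k = (\<lambda>(a, b, c). a \<in> Rc k \<and> b \<in> Rc k \<and> c \<in> Rc k \<and> a * b * c \<noteq> 0)"

lemma Rc_subset_K: "Rc k \<subseteq> K k"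
  using Rc_subset_Ac Ac_subset_K by blast

lemma dvd_in_Rc_divide: "dvd_in (Rc k) g a \<Longrightarrow> g \<noteq> 0 \<Longrightarrow> a / g \<in> Rc k"
  by (auto simp: dvd_in_def)

lemma gcd_step_preserves:
  assumes "gcd_step k e e'" "integral k e"
  shows "integral k e'" and "soluble (K k) e' \<longleftrightarrow> soluble (K k) e"
proof -
  interpret R: unital_subring "Rc k" by (rule unital_subring_Rc)
  have one: "(1::ratfun) \<in> K k" using R.one_closed Rc_subset_K by blast
  have nonzero: "g \<noteq> 0" if "dvd_in (Rc k) g a" "a \<noteq> 0" for g a :: ratfun
    using that by (auto simp: dvd_in_def)
  have scale: "soluble (K k) (a / g, b / g, c * g) \<longleftrightarrow> soluble (K k) (a, b, c)"
    if "g \<in> Rc k" "g \<noteq> 0" for a b c g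
  proof
    have g: "g \<in> K k" using that Rc_subset_K by blast
    show "soluble (K k) (a, b, c) \<Longrightarrow> soluble (K k) (a / g, b / g, c * g)"
      by (rule soluble_rescale[of k a b c g g 1 _ g]) (use that g one in \<open>auto simp: power2_eq_square\<close>)
    show "soluble (K k) (a / g, b / g, c * g) \<Longrightarrow> soluble (K k) (a, b, c)"
      by (rule soluble_rescale[of k "a / g" "b / g" "c * g" 1 1 g _ g])
         (use that g one in \<open>auto simp: power2_eq_square\<close>)
  qed
  have rot: "soluble (K k) (a, b, c) \<longleftrightarrow> soluble (K k) (b, c, a)" for a b c
    using soluble_rotate by blast
  have "integral k e' \<and> (soluble (K k) e' \<longleftrightarrow> soluble (K k) e)"
    using assms
  proof (induction rule: gcd_step.induct)
    case (1 g a b c)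
    then have g: "dvd_in (Rc k) g a" "dvd_in (Rc k) g b" "a \<noteq> 0" by (auto simp: gcdof_R integral_def)
    then have "g \<noteq> 0" using nonzero by blast
    then have "integral k (a / g, b / g, c * g)"
      using 1 g dvd_in_Rc_divide R.mult_closed by (auto simp: integral_def)
    moreover have "soluble (K k) (a / g, b / g, c * g) \<longleftrightarrow> soluble (K k) (a, b, c)"
      using scale 1(1) \<open>g \<noteq> 0\<close> by blast
    ultimately show ?case ..
  next
    case (2 g b c a)
    then have g: "dvd_in (Rc k) g b" "dvd_in (Rc k) g c" "b \<noteq> 0" by (auto simp: gcdof_R integral_def)
    then have "g \<noteq> 0" using nonzero by blast
    then have "integral k (a * g, b / g, c / g)"
      using 2 g dvd_in_Rc_divide R.mult_closed by (auto simp: integral_def)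
    moreover have "soluble (K k) (a * g, b / g, c / g) \<longleftrightarrow> soluble (K k) (a, b, c)"
      using scale[OF 2(1) \<open>g \<noteq> 0\<close>, of b c a] rot by blast
    ultimately show ?case ..
  next
    case (3 g c a b)
    then have g: "dvd_in (Rc k) g c" "dvd_in (Rc k) g a" "c \<noteq> 0" by (auto simp: gcdof_R integral_def)
    then have "g \<noteq> 0" using nonzero by blast
    then have "integral k (a / g, b * g, c / g)"
      using 3 g dvd_in_Rc_divide R.mult_closed by (auto simp: integral_def)
    moreover have "soluble (K k) (a / g, b * g, c / g) \<longleftrightarrow> soluble (K k) (a, b, c)"
      using scale[OF 3(1) \<open>g \<noteq> 0\<close>, of c a b] rot by blast
    ultimately show ?case ..
  qed
  then show "integral k e'" "soluble (K k) e' \<longleftrightarrow> soluble (K k) e" by blast+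
qed

lemma square_step_preserves:
  assumes "square_step k e e'" "integral k e"
  shows "integral k e'" and "soluble (K k) e' \<longleftrightarrow> soluble (K k) e"
proof -
  interpret F: subfield_in "K k" by (rule subfield_in_K)
  have scale: "soluble (K k) (a / s, b, c) \<longleftrightarrow> soluble (K k) (a, b, c)"
    if sq: "nontrivial_square k s" for a b c s
  proof
    obtain d where d: "d \<in> K k" "d \<noteq> 0" "s = d\<^sup>2"
      using sq Rc_subset_K unfolding nontrivial_square_def by blast
    show "soluble (K k) (a, b, c) \<Longrightarrow> soluble (K k) (a / s, b, c)"
      by (rule soluble_rescale[of k a b c d 1 1 _ 1]) (use d F.one_closed in auto)
    show "soluble (K k) (a / s, b, c) \<Longrightarrow> soluble (K k) (a, b, c)"
      by (rule soluble_rescale[of k "a / s" b c "1 / d" 1 1 _ 1])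
         (use d F.one_closed F.divide_closed in \<open>auto simp: power_divide\<close>)
  qed
  have rot: "soluble (K k) (a, b, c) \<longleftrightarrow> soluble (K k) (b, c, a)" for a b c
    using soluble_rotate by blast
  have nonzero: "s \<noteq> 0" if "nontrivial_square k s" for s
    using that unfolding nontrivial_square_def by auto
  have "integral k e' \<and> (soluble (K k) e' \<longleftrightarrow> soluble (K k) e)"
    using assms
  proof (induction rule: square_step.induct)
    case (1 s a b c)
    then have "integral k (a / s, b, c)"
      using dvd_in_Rc_divide nonzero by (auto simp: integral_def divides_R)
    moreover have "soluble (K k) (a / s, b, c) \<longleftrightarrow> soluble (K k) (a, b, c)" using scale 1 by blast
    ultimately show ?case ..
  next
    case (2 s b a c)
    then have "integral k (a, b / s, c)"
      using dvd_in_Rc_divide nonzero by (auto simp: integral_def divides_R)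
    moreover have "soluble (K k) (a, b / s, c) \<longleftrightarrow> soluble (K k) (a, b, c)"
      using scale[OF 2(1), of b c a] rot by blast
    ultimately show ?case ..
  next
    case (3 s c a b)
    then have "integral k (a, b, c / s)"
      using dvd_in_Rc_divide nonzero by (auto simp: integral_def divides_R)
    moreover have "soluble (K k) (a, b, c / s) \<longleftrightarrow> soluble (K k) (a, b, c)"
      using scale[OF 3(1), of c a b] rot by blast
    ultimately show ?case ..
  qed
  then show "integral k e'" "soluble (K k) e' \<longleftrightarrow> soluble (K k) e" by blast+
qed

lemma reduction_preserves:
  assumes "(gcd_step k)\<^sup>*\<^sup>* e e' \<or> (square_step k)\<^sup>*\<^sup>* e e'" "integral k e"
  shows "integral k e' \<and> (soluble (K k) e' \<longleftrightarrow> soluble (K k) e)"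
  using assms(1)
proof
  assume "(gcd_step k)\<^sup>*\<^sup>* e e'"
  then show ?thesis using assms(2) by (induction rule: rtranclp_induct) (use gcd_step_preserves in auto)
next
  assume "(square_step k)\<^sup>*\<^sup>* e e'"
  then show ?thesis using assms(2) by (induction rule: rtranclp_induct) (use square_step_preserves in auto)
qed

lemma soluble_scale_iff:
  assumes "m \<in> K k" "m \<noteq> 0"
  shows "soluble (K k) (m * a, m * b, m * c) \<longleftrightarrow> soluble (K k) (a, b, c)"
proof
  interpret F: subfield_in "K k" by (rule subfield_in_K)
  show "soluble (K k) (a, b, c) \<Longrightarrow> soluble (K k) (m * a, m * b, m * c)"
    by (rule soluble_rescale[of k a b c 1 1 1 _ m]) (use F.one_closed in auto)
  show "soluble (K k) (m * a, m * b, m * c) \<Longrightarrow> soluble (K k) (a, b, c)"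
    by (rule soluble_rescale[of k "m * a" "m * b" "m * c" 1 1 1 _ "1 / m"])
       (use assms F.one_closed in auto)
qed

lemma reduced_form_soluble_iff:
  assumes "reduced_form_of k e e''"
  shows "soluble (K k) e'' \<longleftrightarrow> soluble (K k) e"
proof -
  obtain a b c where e: "e = (a, b, c)" by (cases e)
  obtain m e' where m: "m \<in> Rc k" "m \<noteq> 0" "m * a \<in> Rc k" "m * b \<in> Rc k" "m * c \<in> Rc k"
    and abc: "a * b * c \<noteq> 0"
    and steps: "(gcd_step k)\<^sup>*\<^sup>* (m * a, m * b, m * c) e'" "(square_step k)\<^sup>*\<^sup>* e' e''"
    using assms unfolding e reduced_form_of_def admissible_def by auto
  have "integral k (m * a, m * b, m * c)" using m abc by (simp add: integral_def)
  then have "integral k e'" "soluble (K k) e' \<longleftrightarrow> soluble (K k) (m * a, m * b, m * c)"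
    using reduction_preserves steps(1) by blast+
  moreover then have "soluble (K k) e'' \<longleftrightarrow> soluble (K k) e'"
    using reduction_preserves steps(2) by blast
  moreover have "m \<in> K k" using m(1) Rc_subset_K by blast
  ultimately show ?thesis using soluble_scale_iff m(2) unfolding e by blast
qed

subsection \<open>Existence of reduced forms\<close>

lemma coprime_R_iff:
  assumes "a \<in> Rc k" "b \<in> Rc k"
  shows "1 gcdof\<^bsub>R k\<^esub> a b \<longleftrightarrow> (\<forall>d\<in>Rc k. dvd_in (Rc k) d a \<and> dvd_in (Rc k) d b \<longrightarrow> unit_in (Rc k) d)"
  using assms by (auto simp: gcdof_R unit_in_def dvd_in_def)

text \<open>
  A step divides the product \<open>a b c\<close> by the greatest common divisor, so the steps with a non-unit
  terminate.
\<close>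

lemma gcd_reduction_exists:
  assumes "integral k e"
  shows "\<exists>e'. (gcd_step k)\<^sup>*\<^sup>* e e' \<and> pairwise_coprime k e'"
proof -
  obtain N where "ufd_in (Rc k) N" using ufd_in_Rc by blast
  then interpret R: ufd_in "Rc k" N .
  define size where "size = (\<lambda>(a, b, c). N (a * b * c))"
  have shrink: "\<exists>g\<in>Rc k. g gcdof\<^bsub>R k\<^esub> a b \<and> N (x * (y / g)) < N (x * y)"
    if ab: "a \<in> Rc k" "b \<in> Rc k" "a \<noteq> 0" "\<not> 1 gcdof\<^bsub>R k\<^esub> a b"
      and xy: "x \<in> Rc k" "y = a" "x * y \<noteq> 0" for a b x y
  proof -
    obtain g where g: "g \<in> Rc k" "dvd_in (Rc k) g a" "dvd_in (Rc k) g b"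
      "\<And>d. d \<in> Rc k \<Longrightarrow> dvd_in (Rc k) d a \<Longrightarrow> dvd_in (Rc k) d b \<Longrightarrow> dvd_in (Rc k) d g"
      using R.gcd_exists[OF ab(1,3,2)] by blast
    have "\<not> unit_in (Rc k) g"
      using g(4) R.dvd_in_unit ab(4) unfolding coprime_R_iff[OF ab(1,2)] by blast
    moreover have "g \<noteq> 0" using g(2) ab(3) by (auto simp: dvd_in_def)
    moreover have "y / g \<in> Rc k" using dvd_in_Rc_divide g(2) \<open>g \<noteq> 0\<close> xy(2) by blast
    ultimately have "N (x * (y / g)) < N (x * (y / g) * g)"
      using xy g(1) by (intro R.N_mult_less R.mult_closed) auto
    then have "N (x * (y / g)) < N (x * y)" using \<open>g \<noteq> 0\<close> by simp
    then show ?thesis using g by (auto simp: gcdof_R)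
  qed
  show ?thesis
    using assms
  proof (induction "size e" arbitrary: e rule: less_induct)
    case less
    obtain a b c where e: "e = (a, b, c)" by (cases e)
    have abc: "a \<in> Rc k" "b \<in> Rc k" "c \<in> Rc k" "a \<noteq> 0" "b \<noteq> 0" "c \<noteq> 0"
      using less.prems by (auto simp: e integral_def)
    have step: ?case if "gcd_step k e e1" "size e1 < size e" for e1
      using less.hyps[OF that(2)] gcd_step_preserves(1)[OF that(1) less.prems] that(1)
      by (meson converse_rtranclp_into_rtranclp)
    consider "pairwise_coprime k e" | "\<not> 1 gcdof\<^bsub>R k\<^esub> a b" | "\<not> 1 gcdof\<^bsub>R k\<^esub> b c" | "\<not> 1 gcdof\<^bsub>R k\<^esub> c a"
      unfolding e pairwise_coprime_def by blast
    then show ?case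
    proof cases
      case 1
      then show ?thesis by blast
    next
      case 2
      obtain g where g: "g \<in> Rc k" "g gcdof\<^bsub>R k\<^esub> a b" "N (b * c * (a / g)) < N (b * c * a)"
        using shrink[OF abc(1,2,4) 2, of "b * c" a] abc R.mult_closed by auto
      have "g \<noteq> 0" using g(2) abc(4) by (auto simp: gcdof_R dvd_in_def)
      show ?thesis
        by (rule step[of "(a / g, b / g, c * g)"])
           (use g \<open>g \<noteq> 0\<close> in \<open>auto simp: e size_def ac_simps intro: gcd_step.intros\<close>)
    next
      case 3
      obtain g where g: "g \<in> Rc k" "g gcdof\<^bsub>R k\<^esub> b c" "N (c * a * (b / g)) < N (c * a * b)"
        using shrink[OF abc(2,3,5) 3, of "c * a" b] abc R.mult_closed by auto
      have "g \<noteq> 0" using g(2) abc(5) by (auto simp: gcdof_R dvd_in_def)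
      show ?thesis
        by (rule step[of "(a * g, b / g, c / g)"])
           (use g \<open>g \<noteq> 0\<close> in \<open>auto simp: e size_def ac_simps intro: gcd_step.intros\<close>)
    next
      case 4
      obtain g where g: "g \<in> Rc k" "g gcdof\<^bsub>R k\<^esub> c a" "N (a * b * (c / g)) < N (a * b * c)"
        using shrink[OF abc(3,1,6) 4, of "a * b" c] abc R.mult_closed by auto
      have "g \<noteq> 0" using g(2) abc(6) by (auto simp: gcdof_R dvd_in_def)
      show ?thesis
        by (rule step[of "(a / g, b * g, c / g)"])
           (use g \<open>g \<noteq> 0\<close> in \<open>auto simp: e size_def ac_simps intro: gcd_step.intros\<close>)
    qed
  qed
qed

lemma square_step_pairwise_coprime:
  assumes "square_step k e e'" "integral k e" "pairwise_coprime k e"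
  shows "pairwise_coprime k e'"
proof -
  interpret R: unital_subring "Rc k" by (rule unital_subring_Rc)
  have div: "x / s \<in> Rc k \<and> (\<forall>d. dvd_in (Rc k) d (x / s) \<longrightarrow> dvd_in (Rc k) d x)"
    if s: "nontrivial_square k s" "s divides\<^bsub>R k\<^esub> x" for s x
  proof -
    have "s \<in> Rc k" "s \<noteq> 0" using s(1) R.power_closed unfolding nontrivial_square_def by auto
    then show ?thesis
      using s(2) R.dvd_in_mult[of _ "x / s" s] dvd_in_Rc_divide by (auto simp: divides_R)
  qed
  have left: "1 gcdof\<^bsub>R k\<^esub> (x / s) y" if "1 gcdof\<^bsub>R k\<^esub> x y" "nontrivial_square k s" "s divides\<^bsub>R k\<^esub> x"
    "x \<in> Rc k" "y \<in> Rc k" for x y s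
    using that div[OF that(2,3)] by (simp add: coprime_R_iff)
  have right: "1 gcdof\<^bsub>R k\<^esub> x (y / s)" if "1 gcdof\<^bsub>R k\<^esub> x y" "nontrivial_square k s" "s divides\<^bsub>R k\<^esub> y"
    "x \<in> Rc k" "y \<in> Rc k" for x y s
    using that div[OF that(2,3)] by (simp add: coprime_R_iff)
  show ?thesis
    using assms
    by (induction rule: square_step.induct)
       (simp_all add: pairwise_coprime_def integral_def left right)
qed

text \<open>
  Each step divides the product \<open>a b c\<close> by a non-unit, and the coefficients stay coprime because they are
  replaced by divisors.
\<close>

lemma square_reduction_exists:
  assumes "integral k e" "pairwise_coprime k e"
  shows "\<exists>e'. (square_step k)\<^sup>*\<^sup>* e e' \<and> pairwise_coprime k e' \<and> (\<nexists>e''. square_step k e' e'')"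
proof -
  obtain N where "ufd_in (Rc k) N" using ufd_in_Rc by blast
  then interpret R: ufd_in "Rc k" N .
  define size where "size = (\<lambda>(a, b, c). N (a * b * c))"
  have shrink: "N (x * (y / s)) < N (x * y)"
    if sq: "nontrivial_square k s" and that: "s divides\<^bsub>R k\<^esub> y" "x \<in> Rc k" "x * y \<noteq> 0" for x y s
  proof -
    obtain d where d: "d \<in> Rc k" "d \<noteq> 0" "\<not> unit_in (Rc k) d" "s = d\<^sup>2"
      using sq unfolding nontrivial_square_def Units_R by blast
    have s: "s \<in> Rc k" "s \<noteq> 0" using d R.power_closed by auto
    have "dvd_in (Rc k) d s" unfolding d(4) power2_eq_square using d(1) by (rule R.dvd_in_triv)
    then have "\<not> unit_in (Rc k) s" using d(3) R.dvd_in_unit by blast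
    moreover have "y / s \<in> Rc k" using that(1) s dvd_in_Rc_divide by (simp add: divides_R)
    ultimately have "N (x * (y / s)) < N (x * (y / s) * s)"
      using that s by (intro R.N_mult_less R.mult_closed) auto
    then show ?thesis using s by simp
  qed
  have size_less: "size e1 < size e" if "square_step k e e1" "integral k e" for e e1
    using that
  proof (induction rule: square_step.induct)
    case (1 s a b c)
    then show ?case using shrink[of s a "b * c"] R.mult_closed by (simp add: size_def integral_def ac_simps)
  next
    case (2 s b a c)
    then show ?case using shrink[of s b "a * c"] R.mult_closed by (simp add: size_def integral_def ac_simps)
  next
    case (3 s c a b)
    then show ?case using shrink[of s c "a * b"] R.mult_closed by (simp add: size_def integral_def ac_simps)
  qed
  show ?thesis
    using assms
  proof (induction "size e" arbitrary: e rule: less_induct)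
    case less
    show ?case
    proof (cases "\<exists>e1. square_step k e e1")
      case True
      then obtain e1 where e1: "square_step k e e1" by blast
      then show ?thesis
        using less.hyps[OF size_less[OF e1 less.prems(1)] square_step_preserves(1)[OF e1 less.prems(1)]
            square_step_pairwise_coprime[OF e1 less.prems]]
        by (meson converse_rtranclp_into_rtranclp)
    qed (use less.prems in blast)
  qed
qed

text \<open>
  A prime whose square divides \<open>a b c\<close> divides only one of the coprime factors, and its square divides
  that factor.
\<close>

lemma no_square_step_imp_squarefree:
  assumes e: "integral k (a, b, c)" "pairwise_coprime k (a, b, c)" and no_step: "\<nexists>e. square_step k (a, b, c) e"
  shows "\<not> (\<exists>s. nontrivial_square k s \<and> s divides\<^bsub>R k\<^esub> (a * b * c))"
proof
  assume "\<exists>s. nontrivial_square k s \<and> s divides\<^bsub>R k\<^esub> (a * b * c)"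
  then obtain d where d: "d \<in> Rc k" "d \<noteq> 0" "\<not> unit_in (Rc k) d" "dvd_in (Rc k) (d\<^sup>2) (a * b * c)"
    unfolding nontrivial_square_def by (auto simp: divides_R Units_R)
  obtain N where "ufd_in (Rc k) N" using ufd_in_Rc by blast
  then interpret R: ufd_in "Rc k" N .
  have abc: "a \<in> Rc k" "b \<in> Rc k" "c \<in> Rc k" using e by (auto simp: integral_def)
  obtain p where p: "prime_in (Rc k) p" "dvd_in (Rc k) p d" using R.prime_divisor d by blast
  have pR: "p \<in> Rc k" "\<not> unit_in (Rc k) p" using p by (auto simp: prime_in_def)
  have sq: "nontrivial_square k (p\<^sup>2)"
    unfolding nontrivial_square_def using p by (auto simp: prime_in_def Units_R)
  have "dvd_in (Rc k) (p\<^sup>2) (d\<^sup>2)"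
    unfolding power2_eq_square using p(2) p(2) by (rule R.dvd_in_mult_mono)
  then have p2: "dvd_in (Rc k) (p\<^sup>2) (a * b * c)" using d(4) R.dvd_in_trans by blast
  have no: "\<not> dvd_in (Rc k) (p\<^sup>2) a" "\<not> dvd_in (Rc k) (p\<^sup>2) b" "\<not> dvd_in (Rc k) (p\<^sup>2) c"
    using no_step sq square_step.intros unfolding divides_R by blast+
  have coprime: "\<not> (dvd_in (Rc k) p x \<and> dvd_in (Rc k) p y)"
    if "1 gcdof\<^bsub>R k\<^esub> x y" "x \<in> Rc k" "y \<in> Rc k" for x y
    using that pR unfolding coprime_R_iff[OF that(2,3)] by blast
  have split: "dvd_in (Rc k) (p\<^sup>2) x \<or> dvd_in (Rc k) (p\<^sup>2) y"
    if "dvd_in (Rc k) (p\<^sup>2) (x * y)" "\<not> (dvd_in (Rc k) p x \<and> dvd_in (Rc k) p y)" "x \<in> Rc k" "y \<in> Rc k" for x y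
    using that R.prime_in_square_dvd_coprime_mult[OF p(1), of x y]
      R.prime_in_square_dvd_coprime_mult[OF p(1), of y x] by (auto simp: mult.commute)
  have "\<not> (dvd_in (Rc k) p a \<and> dvd_in (Rc k) p b)" "\<not> (dvd_in (Rc k) p b \<and> dvd_in (Rc k) p c)"
    "\<not> (dvd_in (Rc k) p c \<and> dvd_in (Rc k) p a)"
    using e(2) coprime abc by (auto simp: pairwise_coprime_def)
  then have ab: "\<not> dvd_in (Rc k) (p\<^sup>2) (a * b)" and "\<not> (dvd_in (Rc k) p (a * b) \<and> dvd_in (Rc k) p c)"
    using split[of a b] no abc R.prime_in_mult_iff[OF p(1)] by blast+
  then show False using split[of "a * b" c] p2 no abc R.mult_closed by blast
qed

lemma soluble_imp_not_same_sign:
  assumes "soluble (K 0) (a, b, c)"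
  shows "\<not> same_sign (a, b, c)"
proof
  assume sign: "same_sign (a, b, c)"
  obtain x y z where xyz: "\<not> (const x = 0 \<and> const y = 0 \<and> const z = 0)"
    "a * (const x)\<^sup>2 + b * (const y)\<^sup>2 + c * (const z)\<^sup>2 = 0"
    using assms unfolding soluble_def K_0 by auto
  have nz: "\<not> (x = 0 \<and> y = 0 \<and> z = 0)" using xyz(1) by (simp add: const_eq_0_iff)
  obtain \<alpha> \<beta> \<gamma> where abc: "a = const \<alpha>" "b = const \<beta>" "c = const \<gamma>"
    and sg: "(\<alpha> > 0 \<and> \<beta> > 0 \<and> \<gamma> > 0) \<or> (\<alpha> < 0 \<and> \<beta> < 0 \<and> \<gamma> < 0)"
    using sign unfolding same_sign_def by auto
  have "const (\<alpha> * x\<^sup>2 + \<beta> * y\<^sup>2 + \<gamma> * z\<^sup>2) = 0"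
    using xyz(2) by (simp add: abc const_add const_mult const_power)
  then have zero: "\<alpha> * x\<^sup>2 + \<beta> * y\<^sup>2 + \<gamma> * z\<^sup>2 = 0" by (simp add: const_eq_0_iff)
  have pos: False if "\<alpha> > 0" "\<beta> > 0" "\<gamma> > 0" "\<alpha> * x\<^sup>2 + \<beta> * y\<^sup>2 + \<gamma> * z\<^sup>2 = 0" for \<alpha> \<beta> \<gamma> :: rat
  proof -
    have "\<alpha> * x\<^sup>2 \<ge> 0" "\<beta> * y\<^sup>2 \<ge> 0" "\<gamma> * z\<^sup>2 \<ge> 0" using that by auto
    then have "\<alpha> * x\<^sup>2 = 0" "\<beta> * y\<^sup>2 = 0" "\<gamma> * z\<^sup>2 = 0" using that(4) by linarith+
    then show False using that nz by simp
  qed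
  show False using sg pos[of \<alpha> \<beta> \<gamma>] pos[of "- \<alpha>" "- \<beta>" "- \<gamma>"] zero by auto
qed

text \<open>
  Solubility excludes equal signs of the original and of the reduced coefficients.
\<close>

lemma reduced_form_exists:
  assumes abc: "a \<in> K k" "b \<in> K k" "c \<in> K k" "a * b * c \<noteq> 0" and sol: "soluble (K k) (a, b, c)"
  shows "\<exists>e. reduced_form_of k (a, b, c) e"
proof -
  interpret R: unital_subring "Rc k" by (rule unital_subring_Rc)
  obtain d1 d2 d3 where d: "d1 \<in> Rc k" "d1 \<noteq> 0" "d1 * a \<in> Rc k" "d2 \<in> Rc k" "d2 \<noteq> 0" "d2 * b \<in> Rc k"
    "d3 \<in> Rc k" "d3 \<noteq> 0" "d3 * c \<in> Rc k"
    using K_denominator abc by metis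
  define m where "m = d1 * d2 * d3"
  have m: "m \<in> Rc k" "m \<noteq> 0" using d R.mult_closed by (auto simp: m_def)
  have "m * a = d2 * d3 * (d1 * a)" "m * b = d1 * d3 * (d2 * b)" "m * c = d1 * d2 * (d3 * c)"
    by (simp_all add: m_def ac_simps)
  then have mR: "m * a \<in> Rc k" "m * b \<in> Rc k" "m * c \<in> Rc k" using d by (simp_all only: R.mult_closed)
  let ?e = "(m * a, m * b, m * c)"
  have "integral k ?e" using m mR abc by (simp add: integral_def)
  then obtain e' where e': "(gcd_step k)\<^sup>*\<^sup>* ?e e'" "pairwise_coprime k e'" "integral k e'"
    "soluble (K k) e' \<longleftrightarrow> soluble (K k) ?e"
    using gcd_reduction_exists reduction_preserves by blast
  then obtain e'' where e'': "(square_step k)\<^sup>*\<^sup>* e' e''" "pairwise_coprime k e''" "integral k e''"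
    "soluble (K k) e'' \<longleftrightarrow> soluble (K k) e'" "\<nexists>e. square_step k e'' e"
    using square_reduction_exists reduction_preserves by blast
  have "soluble (K k) e''"
    using e' e'' sol soluble_scale_iff m Rc_subset_K by blast
  obtain a' b' c' where abc': "e'' = (a', b', c')" by (cases e'')
  have "admissible k e''"
    using \<open>soluble (K k) e''\<close> soluble_imp_not_same_sign e''(3)
    unfolding abc' admissible_def integral_def by auto
  then have "in_reduced_form k e''"
    using no_square_step_imp_squarefree e'' unfolding abc' in_reduced_form_def integral_def by auto
  moreover have "admissible k (a, b, c)"
    using abc sol soluble_imp_not_same_sign unfolding admissible_def by auto
  ultimately have "reduced_form_of k (a, b, c) e''"
    unfolding reduced_form_of_def case_prod_conv
    using abc m mR e' e'' by (intro conjI exI[of _ m] exI[of _ e']) simp_all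
  then show ?thesis by blast
qed

section \<open>Certificates and solutions\<close>

lemma in_reduced_form_squarefree:
  assumes "in_reduced_form k (a, b, c)" "prime_in (Ac k) p"
  shows "\<not> dvd_in (Ac k) (p\<^sup>2) (a * b * c)"
proof -
  interpret R: unital_subring "Rc k" by (rule unital_subring_Rc)
  have "a * b * c \<in> Rc k"
    using assms(1) R.mult_closed unfolding in_reduced_form_def by auto
  then show ?thesis
    using prime_square_imp_nontrivial_square[OF _ assms(2)] assms(1)
    unfolding in_reduced_form_def divides_R by blast
qed

lemma soluble_imp_local_roots:
  assumes red: "in_reduced_form k (a, b, c)" and sol: "soluble (K k) (a, b, c)"
  shows "local_roots k a b c" "local_roots k b c a" "local_roots k c a b"
proof -
  obtain N where "euclidean_in (Ac k) N" using euclidean_in_Ac by blast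
  then interpret A: euclidean_in "Ac k" N .
  have abc: "a \<in> Ac k" "b \<in> Ac k" "c \<in> Ac k"
    using red Rc_subset_Ac unfolding in_reduced_form_def by auto
  obtain x y z where xyz: "x \<in> Ac k" "y \<in> Ac k" "z \<in> Ac k" "\<not> (x = 0 \<and> y = 0 \<and> z = 0)"
    "a * x\<^sup>2 + b * y\<^sup>2 + c * z\<^sup>2 = 0"
    using sol unfolding soluble_K_iff_Ac unfolding soluble_def by auto
  have main: "local_roots k a b c"
    if S: "a \<in> Ac k" "b \<in> Ac k" "c \<in> Ac k" "x \<in> Ac k" "y \<in> Ac k" "z \<in> Ac k"
      and nz: "\<not> (x = 0 \<and> y = 0 \<and> z = 0)" "a * x\<^sup>2 + b * y\<^sup>2 + c * z\<^sup>2 = 0"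
      and sqfree: "\<And>p. prime_in (Ac k) p \<Longrightarrow> \<not> dvd_in (Ac k) (p\<^sup>2) (a * b * c)"
    for a b c x y z
    unfolding local_roots_def
  proof (intro allI impI)
    fix p assume p: "prime_in (Ac k) p \<and> dvd_in (Ac k) p a"
    have "\<not> dvd_in (Ac k) (p\<^sup>2) a"
      using sqfree[of p] p A.dvd_in_mult[OF A.dvd_in_mult[OF _ S(2)] S(3)] by blast
    moreover have "\<not> dvd_in (Ac k) p b"
    proof
      assume "dvd_in (Ac k) p b"
      then have "dvd_in (Ac k) (p\<^sup>2) (a * b)"
        using p unfolding power2_eq_square by (intro A.dvd_in_mult_mono) auto
      then show False using sqfree[of p] p A.dvd_in_mult[OF _ S(3)] by blast
    qed
    ultimately show "\<exists>r\<in>Ac k. dvd_in (Ac k) p (b * r\<^sup>2 + c)"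
      using p nz by (intro A.solution_imp_root_modulo_prime[OF _ S(1-3) _ _ _ S(4-6)]) auto
  qed
  note sqfree = in_reduced_form_squarefree[OF red]
  show "local_roots k a b c" using main[OF abc xyz sqfree] .
  show "local_roots k b c a"
    by (rule main[of b c a y z x]) (use abc xyz sqfree in \<open>auto simp: ac_simps\<close>)
  show "local_roots k c a b"
    by (rule main[of c a b z x y]) (use abc xyz sqfree in \<open>auto simp: ac_simps\<close>)
qed

lemma local_roots_imp_root:
  assumes abc: "a \<in> Ac k" "b \<in> Ac k" "c \<in> Ac k" "a \<noteq> 0" and roots: "local_roots k a b c"
    and sqfree: "\<And>p. prime_in (Ac k) p \<Longrightarrow> \<not> dvd_in (Ac k) (p\<^sup>2) (a * b * c)"
  shows "\<exists>r\<in>Ac k. dvd_in (Ac k) a (b * r\<^sup>2 + c)"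
proof -
  obtain N where "euclidean_in (Ac k) N" using euclidean_in_Ac by blast
  then interpret A: euclidean_in "Ac k" N .
  have "\<not> dvd_in (Ac k) (p\<^sup>2) a" if "prime_in (Ac k) p" for p
    using sqfree[OF that] A.dvd_in_mult[OF A.dvd_in_mult[OF _ abc(2)] abc(3)] by blast
  then show ?thesis
  proof (rule A.root_modulo_squarefree[OF abc(2,3,1,4)])
    show "\<exists>r\<in>Ac k. dvd_in (Ac k) p (b * r\<^sup>2 + c)" if "prime_in (Ac k) p" "dvd_in (Ac k) p a" for p
      using roots that unfolding local_roots_def by blast
  qed
qed

text \<open>
  For \<open>k = 0\<close> everything takes place in the integers; for \<open>k > 0\<close> elements are replaced by the
  polynomials whose values at \<open>t\<^sub>k\<close> they are.
\<close>

lemma local_roots_imp_soluble: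
  assumes red: "in_reduced_form k (a, b, c)"
    and roots: "local_roots k a b c" "local_roots k b c a" "local_roots k c a b"
    and leading: "conic_case k (a, b, c) = 0 \<Longrightarrow> soluble (K (k - 1)) (leading_conic k (a, b, c))"
  shows "soluble (K k) (a, b, c)"
proof -
  interpret A: unital_subring "Ac k" by (rule unital_subring_Ac)
  have abc: "a \<in> Ac k" "b \<in> Ac k" "c \<in> Ac k" "a * b * c \<noteq> 0"
    using red Rc_subset_Ac unfolding in_reduced_form_def admissible_def by auto
  then have nz: "a \<noteq> 0" "b \<noteq> 0" "c \<noteq> 0" by auto
  note sqfree = in_reduced_form_squarefree[OF red]
  have sqfree': "\<And>p. prime_in (Ac k) p \<Longrightarrow> \<not> dvd_in (Ac k) (p\<^sup>2) (b * c * a)"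
    "\<And>p. prime_in (Ac k) p \<Longrightarrow> \<not> dvd_in (Ac k) (p\<^sup>2) (c * a * b)"
    using sqfree by (simp_all add: ac_simps)
  obtain r where r: "r \<in> Ac k" "dvd_in (Ac k) a (b * r\<^sup>2 + c)"
    using local_roots_imp_root[OF abc(1-3) nz(1) roots(1) sqfree] by blast
  obtain s where s: "s \<in> Ac k" "dvd_in (Ac k) b (c * s\<^sup>2 + a)"
    using local_roots_imp_root[OF abc(2,3,1) nz(2) roots(2) sqfree'(1)] by blast
  obtain t where t: "t \<in> Ac k" "dvd_in (Ac k) c (a * t\<^sup>2 + b)"
    using local_roots_imp_root[OF abc(3,1,2) nz(3) roots(3) sqfree'(2)] by blast
  have "soluble (Ac k) (a, b, c)"
  proof (cases k)
    case 0
    obtain \<alpha> \<beta> \<gamma> \<rho> \<sigma> \<tau> where ints: "a = const_int \<alpha>" "b = const_int \<beta>" "c = const_int \<gamma>"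
      "r = const_int \<rho>" "s = const_int \<sigma>" "t = const_int \<tau>"
      using abc r(1) s(1) t(1) unfolding 0 Ac_0 by blast
    have dvd_iff: "dvd_in (Ac k) (const_int m) (const_int n) \<longleftrightarrow> m dvd n" for m n
      using const_int.dvd_in_image[of m n] unfolding 0 Ac_0 by (simp add: dvd_in_UNIV)
    have hom: "const_int (m + n) = const_int m + const_int n" "const_int (m * n) = const_int m * const_int n"
      "const_int (m\<^sup>2) = (const_int m)\<^sup>2" for m n
      using const_int.h_add const_int.h_mult by (simp_all add: power2_eq_square)
    have "\<alpha> dvd \<beta> * \<rho>\<^sup>2 + \<gamma>" "\<beta> dvd \<gamma> * \<sigma>\<^sup>2 + \<alpha>" "\<gamma> dvd \<alpha> * \<tau>\<^sup>2 + \<beta>"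
      using r(2) s(2) t(2) unfolding ints by (simp_all only: hom[symmetric] dvd_iff)
    moreover have "\<alpha> \<noteq> 0" "\<beta> \<noteq> 0" "\<gamma> \<noteq> 0" using nz const_int.h_zero unfolding ints by auto
    moreover have "\<bar>d\<bar> = 1" if "d\<^sup>2 dvd \<alpha> * \<beta> * \<gamma>" for d
    proof (rule ccontr)
      assume "\<bar>d\<bar> \<noteq> 1"
      then have "\<not> unit_in (Ac k) (const_int d)"
        using const_int.unit_in_image[of d] unfolding 0 Ac_0 by (simp add: unit_in_def dvd_in_UNIV)
      moreover have "const_int d \<noteq> 0"
        using that \<open>\<alpha> \<noteq> 0\<close> \<open>\<beta> \<noteq> 0\<close> \<open>\<gamma> \<noteq> 0\<close> const_int.h_eq_0_iff[of d] by auto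
      ultimately have "nontrivial_square k ((const_int d)\<^sup>2)"
        unfolding nontrivial_square_def 0 by (auto simp: Units_R Rc_0 Ac_0)
      moreover have "dvd_in (Ac k) (const_int (d\<^sup>2)) (const_int (\<alpha> * \<beta> * \<gamma>))"
        using that dvd_iff by blast
      then have "dvd_in (Rc k) ((const_int d)\<^sup>2) (a * b * c)"
        unfolding ints by (simp add: hom 0 Ac_0 Rc_0)
      ultimately show False using red unfolding in_reduced_form_def by (auto simp: divides_R)
    qed
    moreover have "\<not> (\<alpha> > 0 \<and> \<beta> > 0 \<and> \<gamma> > 0)" "\<not> (\<alpha> < 0 \<and> \<beta> < 0 \<and> \<gamma> < 0)"
      using red unfolding in_reduced_form_def admissible_def same_sign_def 0 ints
      by (simp_all add: const_int_pos_iff const_int_neg_iff)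
    ultimately obtain x y z where xyz: "\<not> (x = 0 \<and> y = 0 \<and> z = 0)" "\<alpha> * x\<^sup>2 + \<beta> * y\<^sup>2 + \<gamma> * z\<^sup>2 = 0"
      using legendre_of_roots[of \<alpha> \<beta> \<gamma> \<rho> \<sigma> \<tau>] by blast
    have "a * (const_int x)\<^sup>2 + b * (const_int y)\<^sup>2 + c * (const_int z)\<^sup>2 = 0"
      using arg_cong[OF xyz(2), of const_int] by (simp add: hom ints const_int.h_zero)
    moreover have "\<not> (const_int x = 0 \<and> const_int y = 0 \<and> const_int z = 0)"
      using xyz(1) const_int.h_eq_0_iff by simp
    ultimately show ?thesis unfolding soluble_def 0 Ac_0 by blast
  next
    case (Suc j)
    let ?h = "\<lambda>f. poly f (tvar (Suc j))" and ?P = "polys (K j)"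
    interpret F: subfield_in "K j" by (rule subfield_in_K)
    interpret P: unital_subring ?P by (rule F.unital_subring_polys)
    interpret E: ring_embedding ?P ?h by (rule ring_embedding_polys_K)
    obtain fa fb fc fr fs ft where f: "fa \<in> ?P" "fb \<in> ?P" "fc \<in> ?P" "fr \<in> ?P" "fs \<in> ?P" "ft \<in> ?P"
      and h: "a = ?h fa" "b = ?h fb" "c = ?h fc" "r = ?h fr" "s = ?h fs" "t = ?h ft"
      using abc r(1) s(1) t(1) unfolding Suc Ac_Suc by blast
    have root: "dvd_in ?P u (v * w\<^sup>2 + x)"
      if "dvd_in (Ac k) (?h u) (?h v * (?h w)\<^sup>2 + ?h x)" "u \<in> ?P" "v \<in> ?P" "w \<in> ?P" "x \<in> ?P" for u v w x
      using that E.dvd_in_image[of u "v * w\<^sup>2 + x"] P.closed unfolding Suc Ac_Suc by simp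
    have roots_f: "dvd_in ?P fa (fb * fr\<^sup>2 + fc)" "dvd_in ?P fb (fc * fs\<^sup>2 + fa)"
      "dvd_in ?P fc (fa * ft\<^sup>2 + fb)"
      using root r(2) s(2) t(2) f unfolding h by blast+
    have nz_f: "fa * fb * fc \<noteq> 0" using abc(4) unfolding h by auto
    have sqfree_f: "\<not> dvd_in ?P (p\<^sup>2) (fa * fb * fc)" if "prime_in ?P p" for p
    proof -
      have "p \<in> ?P" using that by (simp add: prime_in_def)
      then have "prime_in (Ac k) (?h p)" using that E.prime_in_image unfolding Suc Ac_Suc by blast
      from sqfree[OF this] show ?thesis
        using E.dvd_in_image[of "p\<^sup>2" "fa * fb * fc"] \<open>p \<in> ?P\<close> f P.closed unfolding h Suc Ac_Suc by simp
    qed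
    have "\<exists>x\<in>?P. \<exists>y\<in>?P. \<exists>z\<in>?P. \<not> (x = 0 \<and> y = 0 \<and> z = 0) \<and> fa * x\<^sup>2 + fb * y\<^sup>2 + fc * z\<^sup>2 = 0"
    proof (cases "degree fa mod 2 = degree fb mod 2 \<and> degree fb mod 2 = degree fc mod 2")
      case True
      then have "conic_case k (a, b, c) = 0"
        unfolding conic_case_def Suc h using f by (simp add: deg_poly)
      then have "soluble (K j) (lead_coeff fa, lead_coeff fb, lead_coeff fc)"
        using leading f unfolding leading_conic_def Suc h by (simp add: lc_poly)
      then obtain x y z where "x \<in> K j" "y \<in> K j" "z \<in> K j" "\<not> (x = 0 \<and> y = 0 \<and> z = 0)"
        "lead_coeff fa * x\<^sup>2 + lead_coeff fb * y\<^sup>2 + lead_coeff fc * z\<^sup>2 = 0"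
        unfolding soluble_def by auto
      then show ?thesis
        using True by (intro F.conic_solution_equal_parity[OF f(1-3) nz_f sqfree_f f(4) roots_f(1)
              f(5) roots_f(2) f(6) roots_f(3)]) auto
    next
      case False
      then show ?thesis
        by (intro F.conic_solution_mixed_parity[OF f(1-3) nz_f sqfree_f f(4) roots_f(1)
              f(5) roots_f(2) f(6) roots_f(3)]) auto
    qed
    then obtain x y z where xyz: "x \<in> ?P" "y \<in> ?P" "z \<in> ?P" "\<not> (x = 0 \<and> y = 0 \<and> z = 0)"
      "fa * x\<^sup>2 + fb * y\<^sup>2 + fc * z\<^sup>2 = 0" by blast
    have "a * (?h x)\<^sup>2 + b * (?h y)\<^sup>2 + c * (?h z)\<^sup>2 = 0"
      using arg_cong[OF xyz(5), of ?h] unfolding h by simp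
    moreover have "\<not> (?h x = 0 \<and> ?h y = 0 \<and> ?h z = 0)"
      using xyz(1-4) E.h_eq_0_iff by blast
    ultimately show ?thesis using xyz(1-3) unfolding soluble_def Suc Ac_Suc by blast
  qed
  then show ?thesis unfolding soluble_K_iff_Ac .
qed

lemma soluble_imp_leading_soluble:
  assumes red: "in_reduced_form k (a, b, c)" and sol: "soluble (K k) (a, b, c)"
    and case0: "conic_case k (a, b, c) = 0"
  shows "soluble (K (k - 1)) (leading_conic k (a, b, c))"
    and "lc k a \<in> K (k - 1)" "lc k b \<in> K (k - 1)" "lc k c \<in> K (k - 1)"
    and "lc k a * lc k b * lc k c \<noteq> 0"
proof -
  obtain j where k: "k = Suc j"
    using case0 by (cases k) (auto simp: conic_case_def)
  let ?h = "\<lambda>f. poly f (tvar (Suc j))" and ?P = "polys (K j)"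
  interpret F: subfield_in "K j" by (rule subfield_in_K)
  interpret P: unital_subring ?P by (rule F.unital_subring_polys)
  interpret E: ring_embedding ?P ?h by (rule ring_embedding_polys_K)
  have abc: "a \<in> Ac (Suc j)" "b \<in> Ac (Suc j)" "c \<in> Ac (Suc j)" "a * b * c \<noteq> 0"
    using red Rc_subset_Ac unfolding k in_reduced_form_def admissible_def by auto
  obtain fa fb fc where f: "fa \<in> ?P" "fb \<in> ?P" "fc \<in> ?P" and h: "a = ?h fa" "b = ?h fb" "c = ?h fc"
    using abc unfolding Ac_Suc by blast
  have nz: "fa \<noteq> 0" "fb \<noteq> 0" "fc \<noteq> 0" using abc(4) unfolding h by auto
  have lc: "lc (Suc j) a = lead_coeff fa" "lc (Suc j) b = lead_coeff fb" "lc (Suc j) c = lead_coeff fc"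
    using f unfolding h by (simp_all add: lc_poly)
  have parity: "degree fa mod 2 = degree fb mod 2" "degree fb mod 2 = degree fc mod 2"
    using case0 f unfolding k conic_case_def h by (auto simp: deg_poly split: if_splits)
  have "soluble (Ac (Suc j)) (a, b, c)" using sol unfolding k soluble_K_iff_Ac .
  then obtain x y z where xyz: "x \<in> ?P" "y \<in> ?P" "z \<in> ?P" "\<not> (?h x = 0 \<and> ?h y = 0 \<and> ?h z = 0)"
    "?h fa * (?h x)\<^sup>2 + ?h fb * (?h y)\<^sup>2 + ?h fc * (?h z)\<^sup>2 = 0"
    unfolding soluble_def Ac_Suc h by auto
  have "?h (fa * x\<^sup>2 + fb * y\<^sup>2 + fc * z\<^sup>2) = 0" using xyz(5) by simp
  then have "fa * x\<^sup>2 + fb * y\<^sup>2 + fc * z\<^sup>2 = 0"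
    using E.h_eq_0_iff[of "fa * x\<^sup>2 + fb * y\<^sup>2 + fc * z\<^sup>2"] f xyz by (simp add: P.closed)
  moreover have "\<not> (x = 0 \<and> y = 0 \<and> z = 0)" using xyz(4) by auto
  ultimately show "soluble (K (k - 1)) (leading_conic k (a, b, c))"
    using F.leading_form_soluble[OF nz parity xyz(1-3)] unfolding k leading_conic_def soluble_def
    by (simp add: lc)
  show "lc k a \<in> K (k - 1)" "lc k b \<in> K (k - 1)" "lc k c \<in> K (k - 1)" "lc k a * lc k b * lc k c \<noteq> 0"
    unfolding k lc diff_Suc_1 using f nz by (auto intro: coeff_polys)
qed

text \<open>
  The equation of leading coefficients is soluble exactly if its reduced form is, and the induction
  hypothesis applies to the latter.
\<close>

lemma soluble_iff_certificate:
  assumes "in_reduced_form k (a, b, c)"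
  shows "soluble (K k) (a, b, c) \<longleftrightarrow> (\<exists>C. solubility_certificate k (a, b, c) C)"
  using assms
proof (induction k arbitrary: a b c rule: less_induct)
  case (less k a b c)
  note red = less.prems
  have abc: "a \<in> Ac k" "b \<in> Ac k" "c \<in> Ac k" "a \<noteq> 0" "b \<noteq> 0" "c \<noteq> 0"
    using red Rc_subset_Ac unfolding in_reduced_form_def admissible_def by auto
  note lists = root_list_exists_iff[OF abc(1,4,2,3)] root_list_exists_iff[OF abc(2,5,3,1)]
    root_list_exists_iff[OF abc(3,6,1,2)]
  have smaller: "k - 1 < k" if "conic_case k (a, b, c) = 0"
    using that by (cases k) (auto simp: conic_case_def)
  show ?case
  proof
    assume sol: "soluble (K k) (a, b, c)"
    obtain ra rb rc where roots: "root_list k a b c ra" "root_list k b c a rb" "root_list k c a b rc"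
      using soluble_imp_local_roots[OF red sol] lists by metis
    show "\<exists>C. solubility_certificate k (a, b, c) C"
    proof (cases "conic_case k (a, b, c) = 0")
      case True
      note leading = soluble_imp_leading_soluble[OF red sol True]
      obtain e where e: "reduced_form_of (k - 1) (leading_conic k (a, b, c)) e"
        using reduced_form_exists[OF leading(2-5)] leading(1) unfolding leading_conic_def by auto
      then have "in_reduced_form (k - 1) e" unfolding reduced_form_of_def leading_conic_def by auto
      moreover have "soluble (K (k - 1)) e" using reduced_form_soluble_iff[OF e] leading(1) by simp
      ultimately obtain C where "solubility_certificate (k - 1) e C"
        using less.IH[OF smaller[OF True]] by (cases e) blast
      then show ?thesis using solubility_certificate.case_0[OF red roots True e] by blast
    next
      case False
      then have "conic_case k (a, b, c) = 1" by (auto simp: conic_case_def)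
      then show ?thesis using solubility_certificate.case_1[OF red roots] by blast
    qed
  next
    assume "\<exists>C. solubility_certificate k (a, b, c) C"
    then obtain C where C: "solubility_certificate k (a, b, c) C" by blast
    have "local_roots k a b c \<and> local_roots k b c a \<and> local_roots k c a b"
      using C lists by cases blast+
    moreover have "soluble (K (k - 1)) (leading_conic k (a, b, c))" if "conic_case k (a, b, c) = 0"
      using C
    proof cases
      case (case_0 ra rb rc e C')
      have "in_reduced_form (k - 1) e" using case_0 unfolding reduced_form_of_def leading_conic_def by auto
      then have "soluble (K (k - 1)) e" using less.IH[OF smaller[OF that]] case_0 by (cases e) auto
      then show ?thesis using reduced_form_soluble_iff case_0 by auto
    qed (use that in simp)
    ultimately show "soluble (K k) (a, b, c)" using local_roots_imp_soluble[OF red] by simp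
  qed
qed

theorem theorem1:
  fixes k :: nat and a b c :: ratfun
  assumes "a \<in> K k" and "b \<in> K k" and "c \<in> K k"
    and "in_reduced_form k (a, b, c)"
  shows "(\<exists>x \<in> K k. \<exists>y \<in> K k. \<exists>z \<in> K k.
            \<not> (x = 0 \<and> y = 0 \<and> z = 0) \<and> a * x\<^sup>2 + b * y\<^sup>2 + c * z\<^sup>2 = 0) \<longleftrightarrow>
         (\<exists>C. solubility_certificate k (a, b, c) C)"
  using soluble_iff_certificate[OF assms(4)] by (simp add: soluble_def)

end
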